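(* Let $X$ be an irreducible aperiodic homogeneous Markov chain on $\{1,\dots,N\}$ with transition matrix $P$, with $\operatorname{supp}(P)\subseteq S$, observed at random times through $Y_1,\dots,Y_n$, where $Y_k=X_{T_k}$ and the gaps $\tau_k=T_k-T_{k-1}$ are i.i.d. with distribution $\mu$ on $\mathbb N$ and independent of $X$. Let $Q=\sum_{l\ge 0}\mu(l)P^l$ be the transition matrix of $Y$, and assume that the problem is identifiable, i.e. $\mathcal A(S)\cap \operatorname{Com}(Q)=\{P\}$. Let $\hat Q$ be the empirical transition matrix of $Y_1,\dots,Y_n$ and $p=\operatorname{vec}(P)$. Then the estimator $$\hat p=\Big[\operatorname{I}-\Phi\,[\Phi^\top\Delta(\hat Q)^\top\Delta(\hat Q)\Phi]^{-1}\,\Phi^\top\Delta(\hat Q)^\top\Delta(\hat Q)\Big]p_0$$ is consistent (that is, $\hat p\to p$ in probability as $n\to\infty$) and asymptotically Gaussian, with $$\sqrt n\,(\hat p-p)\ \overset{d}{\longrightarrow}\ \mathcal N(0,B\Sigma B^\top)\qquad (n\to\infty),$$ where $B=\Phi\,[\Phi^\top\Delta(Q)^\top\Delta(Q)\Phi]^{-1}\,\Phi^\top\Delta(Q)^\top\Delta(P)$.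
   Context: Setting. $N\ge 3$; $\mathcal E=\{1,\dots,N\}$; $X=(X_m)_{m\in\mathbb N}$ is an irreducible aperiodic homogeneous Markov chain on $\mathcal E$ with transition matrix $P$ and (unique, positive) invariant distribution $\pi=(\pi_1,\dots,\pi_N)$. $\mu$ is a probability distribution on $\mathbb N=\{0,1,2,\dots\}$. The process $Y$ is then a Markov chain with transition matrix $Q=\sum_{l\ge0}\mu(l)P^l$. Support constraint. For a matrix $A\in\mathbb R^{N\times N}$, $\operatorname{supp}(A)=\{(i,j):A_{ij}\ne0\}$. $S\subset\mathcal E^2$ is a known set with $\operatorname{supp}(P)\subseteq S$, and $d=|S|$. With $\mathbf 1=(1,\dots,1)^\top$, $\mathcal A(S)=\{A\in\mathbb R^{N\times N}: A\mathbf 1=\mathbf 1,\ \operatorname{supp}(A)\subseteq S\}$ (an affine space of dimension $d-N$; entries need not be nonnegative) and $\mathcal A_{\mathrm{lin}}(S)=\{A\in\mathbb R^{N\times N}: A\mathbf 1=0,\ \operatorname{supp}(A)\subseteq S\}$. $\operatorname{Com}(Q)$ is the set of real $N\times N$ matrices commuting with $Q$. Vectorization. $\operatorname{vec}$ stacks the columns: $\operatorname{vec}(A)=(A_{1,1},\dots,A_{N,1},\dots,A_{1,N},\dots,A_{N,N})^\top$. $\operatorname I$ denotes an identity matrix of the appropriate size. For $A\in\mathbb R^{N\times N}$, $\Delta(A)=\operatorname I\otimes A-A^\top\otimes\operatorname I\in\mathbb R^{N^2\times N^2}$, so that $\Delta(A)\operatorname{vec}(M)=\operatorname{vec}(AM-MA)$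 for every $M$. $P_0$ is an arbitrary fixed element of $\mathcal A(S)$, $p_0=\operatorname{vec}(P_0)$, $(\phi_1,\dots,\phi_{d-N})$ is a fixed basis of $\mathcal A_{\mathrm{lin}}(S)$, and $\Phi=[\operatorname{vec}(\phi_1),\dots,\operatorname{vec}(\phi_{d-N})]\in\mathbb R^{N^2\times(d-N)}$. Empirical transition matrix. $\hat Q_{ij}=\dfrac{\sum_{k=1}^{n-1}\mathbf 1\{Y_k=i,\,Y_{k+1}=j\}}{\sum_{k=1}^{n-1}\mathbf 1\{Y_k=i\}}$ for $i,j=1,\dots,N$ (defined arbitrarily on the event that the denominator vanishes). When $\Phi^\top\Delta(\hat Q)^\top\Delta(\hat Q)\Phi$ is singular, $\hat p$ is understood as $p_0+\Phi\hat\beta$ with $\hat\beta$ an arbitrary minimizer of $\beta\mapsto\|\Delta(\hat Q)[p_0+\Phi\beta]\|^2$ (when it is invertible the minimizer is unique and gives the displayed formula). Asymptotic covariance. $\Sigma\in\mathbb R^{N^2\times N^2}$ is the asymptotic covariance matrix of $\sqrt n(\operatorname{vec}(\hat Q)-\operatorname{vec}(Q))$; its entry at the position of the coordinates of $\operatorname{vec}$ corresponding to $(i,j)$ and $(k,l)$ equals $Q_{ij}(1-Q_{ij})/\pi_i$ if $(i,j)=(k,l)$, equals $-Q_{ij}Q_{il}/\pi_i$ if $i=k$ and $j\ne l$, and equals $0$ otherwise. *)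

theory Defs
  imports "HOL-Probability.Probability"
begin

section \<open>Finite Markov chains\<close>

text \<open>The state space is a finite type \<^typ>\<open>'n\<close>. The operation \<^term>\<open>(**)\<close> is the matrix product,
  whereas the multiplication and power of the type classes would act on vectors entrywise.\<close>

definition mpow :: "real^'n^'n \<Rightarrow> nat \<Rightarrow> real^'n^'n" where
  "mpow A k = (((**) A) ^^ k) (mat 1)"

definition stochastic :: "real^'n^'n \<Rightarrow> bool" where
  "stochastic P \<longleftrightarrow> (\<forall>i j. 0 \<le> P $ i $ j) \<and> (\<forall>i. (\<Sum>j\<in>UNIV. P $ i $ j) = 1)"

definition irreducible_chain :: "real^'n^'n \<Rightarrow> bool" where
  "irreducible_chain P \<longleftrightarrow> (\<forall>i j. \<exists>m. 0 < mpow P m $ i $ j)"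

definition aperiodic_chain :: "real^'n^'n \<Rightarrow> bool" where
  "aperiodic_chain P \<longleftrightarrow> (\<forall>i. Gcd {m. 0 < m \<and> 0 < mpow P m $ i $ i} = 1)"

definition invariant_distribution :: "real^'n^'n \<Rightarrow> real^'n \<Rightarrow> bool" where
  "invariant_distribution P \<pi> \<longleftrightarrow>
     (\<forall>i. 0 \<le> \<pi> $ i) \<and> (\<Sum>i\<in>UNIV. \<pi> $ i) = 1 \<and> \<pi> v* P = \<pi>"

text \<open>No condition is put on the initial distribution.\<close>

definition markov_chain :: "'a measure \<Rightarrow> (nat \<Rightarrow> 'a \<Rightarrow> 'n) \<Rightarrow> real^'n^'n \<Rightarrow> bool" where
  "markov_chain M X P \<longleftrightarrow>
     (\<forall>m. X m \<in> measurable M (count_space UNIV)) \<and>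
     (\<forall>m x j. 0 < measure M {\<omega> \<in> space M. \<forall>k\<le>m. X k \<omega> = x k} \<longrightarrow>
        \<P>(\<omega> in M. X (Suc m) \<omega> = j \<bar> \<forall>k\<le>m. X k \<omega> = x k) = P $ x m $ j)"

section \<open>Observation at random times\<close>

text \<open>The gap with index \<^term>\<open>0\<close> is the initial time \<^term>\<open>T 0\<close>, so that \<^term>\<open>T k\<close> is the sum of the gaps
  with index at most \<^term>\<open>k\<close>. The gaps from index 1 on have distribution \<^term>\<open>\<mu>\<close>; the initial time
  is only required to be independent of them, which includes the case \<^term>\<open>T 0 = (\<lambda>_. 0)\<close>.\<close>

definition gap :: "(nat \<Rightarrow> 'a \<Rightarrow> nat) \<Rightarrow> nat \<Rightarrow> 'a \<Rightarrow> nat" where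
  "gap T k \<omega> = (if k = 0 then T 0 \<omega> else T k \<omega> - T (k - 1) \<omega>)"

definition observation_times ::
  "'a measure \<Rightarrow> (nat \<Rightarrow> 'a \<Rightarrow> 'n) \<Rightarrow> (nat \<Rightarrow> 'a \<Rightarrow> nat) \<Rightarrow> nat pmf \<Rightarrow> bool" where
  "observation_times M X T \<mu> \<longleftrightarrow>
     (\<forall>\<omega>\<in>space M. \<forall>k. T k \<omega> \<le> T (Suc k) \<omega>) \<and>
     prob_space.indep_vars M (\<lambda>_. count_space UNIV) (gap T) UNIV \<and>
     (\<forall>k\<ge>1. distr M (count_space UNIV) (gap T k) = measure_pmf \<mu>) \<and>
     prob_space.indep_set M
       (sets (vimage_algebra (space M) (\<lambda>\<omega> k. gap T k \<omega>) (\<Pi>\<^sub>M k\<in>UNIV. count_space UNIV)))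
       (sets (vimage_algebra (space M) (\<lambda>\<omega> m. X m \<omega>) (\<Pi>\<^sub>M m\<in>UNIV. count_space UNIV)))"

definition observed :: "(nat \<Rightarrow> 'a \<Rightarrow> 'n) \<Rightarrow> (nat \<Rightarrow> 'a \<Rightarrow> nat) \<Rightarrow> nat \<Rightarrow> 'a \<Rightarrow> 'n" where
  "observed X T k \<omega> = X (T k \<omega>) \<omega>"

definition subsampled :: "nat pmf \<Rightarrow> real^'n^'n \<Rightarrow> real^'n^'n" where
  "subsampled \<mu> P = (\<Sum>l. pmf \<mu> l *\<^sub>R mpow P l)"

text \<open>The empirical transition matrix is only determined in the rows of the states that are
  visited among \<^term>\<open>Y 1\<close>, ..., \<^term>\<open>Y (n - 1)\<close>.\<close>

definition is_empirical :: "(nat \<Rightarrow> 'n) \<Rightarrow> nat \<Rightarrow> real^'n^'n \<Rightarrow> bool" where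
  "is_empirical Y n A \<longleftrightarrow>
     (\<forall>i j. card {k\<in>{1..<n}. Y k = i} \<noteq> 0 \<longrightarrow>
        A $ i $ j = real (card {k\<in>{1..<n}. Y k = i \<and> Y (Suc k) = j})
                    / real (card {k\<in>{1..<n}. Y k = i}))"

section \<open>Support constraint and commutation\<close>

definition supp :: "real^'n^'n \<Rightarrow> ('n \<times> 'n) set" where
  "supp A = {(i, j). A $ i $ j \<noteq> 0}"

definition aff :: "('n \<times> 'n) set \<Rightarrow> (real^'n^'n) set" where
  "aff S = {A. A *v 1 = 1 \<and> supp A \<subseteq> S}"

definition aff_lin :: "('n \<times> 'n) set \<Rightarrow> (real^'n^'n) set" where
  "aff_lin S = {A. A *v 1 = 0 \<and> supp A \<subseteq> S}"

definition Com :: "real^'n^'n \<Rightarrow> (real^'n^'n) set" where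
  "Com Q = {A. A ** Q = Q ** A}"

section \<open>Vectorization\<close>

text \<open>Coordinates of the column stacking are indexed by pairs (column, row): the columns are the
  consecutive blocks, as for the index of a Kronecker product, which is the pair
  (index of the left factor, index of the right factor).\<close>

definition vectorize :: "real^'n^'m \<Rightarrow> real^('n \<times> 'm)" where
  "vectorize A = (\<chi> c. A $ snd c $ fst c)"

definition kron :: "real^'b^'a \<Rightarrow> real^'d^'c \<Rightarrow> real^('b \<times> 'd)^('a \<times> 'c)" where
  "kron A B = (\<chi> r c. A $ fst r $ fst c * B $ snd r $ snd c)"

definition Delta :: "real^'n^'n \<Rightarrow> real^('n \<times> 'n)^('n \<times> 'n)" where
  "Delta A = kron (mat 1) A - kron (transpose A) (mat 1)"

lemma Delta_vectorize: "Delta A *v vectorize M = vectorize (A ** M - M ** A)"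
proof -
  have "(Delta A *v vectorize M) $ (j, i) = vectorize (A ** M - M ** A) $ (j, i)" for i j
  proof -
    have "(Delta A *v vectorize M) $ (j, i) =
      (\<Sum>l\<in>UNIV. \<Sum>k\<in>UNIV. (if j = l then 1 else 0) * A $ i $ k * M $ k $ l
         - A $ l $ j * (if i = k then 1 else 0) * M $ k $ l)"
      unfolding Delta_def kron_def vectorize_def matrix_vector_mult_def mat_def transpose_def
      by (simp add: UNIV_Times_UNIV[symmetric] sum.cartesian_product case_prod_beta
          left_diff_distrib del: UNIV_Times_UNIV)
    also have "\<dots> = (\<Sum>l\<in>UNIV. \<Sum>k\<in>UNIV. (if j = l then A $ i $ k * M $ k $ l else 0))
         - (\<Sum>l\<in>UNIV. \<Sum>k\<in>UNIV. (if i = k then A $ l $ j * M $ k $ l else 0))"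
      unfolding sum_subtractf[symmetric] by (intro sum.cong refl) simp
    also have "(\<Sum>l\<in>UNIV. \<Sum>k\<in>UNIV. (if j = l then A $ i $ k * M $ k $ l else 0))
        = (\<Sum>k\<in>UNIV. A $ i $ k * M $ k $ j)"
      by (subst sum.swap) simp
    also have "(\<Sum>l\<in>UNIV. \<Sum>k\<in>UNIV. (if i = k then A $ l $ j * M $ k $ l else 0))
        = (\<Sum>l\<in>UNIV. M $ i $ l * A $ l $ j)"
      by (simp add: mult.commute)
    finally show ?thesis
      by (simp add: vectorize_def matrix_matrix_mult_def)
  qed
  then show ?thesis
    by (auto simp: vec_eq_iff)
qed

definition basis_matrix :: "('b \<Rightarrow> real^'n^'n) \<Rightarrow> real^'b^('n \<times> 'n)" where
  "basis_matrix \<phi> = (\<chi> r b. vectorize (\<phi> b) $ r)"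

section \<open>The estimator\<close>

definition gram :: "real^'b^('n \<times> 'n) \<Rightarrow> real^'n^'n \<Rightarrow> real^'b^'b" where
  "gram \<Phi> A = transpose \<Phi> ** transpose (Delta A) ** Delta A ** \<Phi>"

definition is_estimate ::
  "real^'b^('n \<times> 'n) \<Rightarrow> real^('n \<times> 'n) \<Rightarrow> real^'n^'n \<Rightarrow> real^('n \<times> 'n) \<Rightarrow> bool" where
  "is_estimate \<Phi> p\<^sub>0 A p \<longleftrightarrow>
     (if invertible (gram \<Phi> A)
      then p = (mat 1 - \<Phi> ** matrix_inv (gram \<Phi> A) ** transpose \<Phi> ** transpose (Delta A) ** Delta A) *v p\<^sub>0
      else \<exists>\<beta>. is_arg_min (\<lambda>\<beta>. (norm (Delta A *v (p\<^sub>0 + \<Phi> *v \<beta>)))\<^sup>2) (\<lambda>_. True) \<beta> \<and>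
               p = p\<^sub>0 + \<Phi> *v \<beta>)"

definition asym_cov :: "real^'n^'n \<Rightarrow> real^'n \<Rightarrow> real^('n \<times> 'n)^('n \<times> 'n)" where
  "asym_cov Q \<pi> = (\<chi> r c. let j = fst r; i = snd r; l = fst c; k = snd c in
     if i = k \<and> j = l then Q $ i $ j * (1 - Q $ i $ j) / \<pi> $ i
     else if i = k then - (Q $ i $ j * Q $ i $ l) / \<pi> $ i
     else 0)"

definition B_matrix ::
  "real^'b^('n \<times> 'n) \<Rightarrow> real^'n^'n \<Rightarrow> real^'n^'n \<Rightarrow> real^('n \<times> 'n)^('n \<times> 'n)" where
  "B_matrix \<Phi> Q P = \<Phi> ** matrix_inv (gram \<Phi> Q) ** transpose \<Phi> ** transpose (Delta Q) ** Delta P"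

section \<open>Modes of convergence\<close>

definition tendsto_in_prob ::
  "'a measure \<Rightarrow> (nat \<Rightarrow> 'a \<Rightarrow> 'b::metric_space) \<Rightarrow> 'b \<Rightarrow> bool" where
  "tendsto_in_prob M Z c \<longleftrightarrow>
     (\<forall>\<epsilon>>0. (\<lambda>n. measure M {\<omega> \<in> space M. dist (Z n \<omega>) c > \<epsilon>}) \<longlonglongrightarrow> 0)"

definition tendsto_in_distr ::
  "'a measure \<Rightarrow> (nat \<Rightarrow> 'a \<Rightarrow> 'b::topological_space) \<Rightarrow> 'b measure \<Rightarrow> bool" where
  "tendsto_in_distr M Z \<nu> \<longleftrightarrow>
     (\<forall>f :: 'b \<Rightarrow> real. continuous_on UNIV f \<and> bounded (range f) \<longrightarrow>
        (\<lambda>n. \<integral>x. f x \<partial>(distr M borel (Z n))) \<longlonglongrightarrow> (\<integral>x. f x \<partial>\<nu>))"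

text \<open>The Gaussian law with mean \<^term>\<open>m\<close> and a possibly singular covariance \<^term>\<open>C\<close>: every linear
  functional is univariate Gaussian, and degenerate in the directions of variance 0.\<close>

definition is_gaussian :: "real^'k \<Rightarrow> real^'k^'k \<Rightarrow> (real^'k) measure \<Rightarrow> bool" where
  "is_gaussian m C \<nu> \<longleftrightarrow>
     prob_space \<nu> \<and> sets \<nu> = sets borel \<and>
     transpose C = C \<and> (\<forall>t. 0 \<le> t \<bullet> (C *v t)) \<and>
     (\<forall>t. distr \<nu> borel (\<lambda>x. t \<bullet> x) =
        (if t \<bullet> (C *v t) = 0 then return borel (t \<bullet> m)
         else density lborel (normal_density (t \<bullet> m) (sqrt (t \<bullet> (C *v t))))))"

end

theory Submission
  imports Defs "HOL-Real_Asymp.Real_Asymp"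
begin

text \<open>
  Observed at the random times, the chain is again a Markov chain, with matrix \<open>Q\<close> and the same
  invariant distribution; \<open>Q\<close> is irreducible because \<open>P\<close> is irreducible and aperiodic and \<open>\<mu>\<close> is not
  concentrated on \<open>0\<close>, which identifiability excludes. Since \<open>\<Delta>(A)\<close> applied to \<open>p\<close> is
  \<open>- \<Delta>(P) vec (A - Q)\<close>, the error of the estimator is \<open>B(A) vec (A - Q)\<close> at \<open>A = Qhat\<close>, where \<open>B(A)\<close> is
  continuous at \<open>A = Q\<close>: identifiability says exactly that the Gram matrix is invertible at \<open>Q\<close>. It
  remains to prove the central limit theorem for \<open>Qhat\<close>.

  For a function \<open>g\<close> of transitions with conditional mean \<open>0\<close>, let \<open>h\<close> solve the Poisson equation
  \<open>h - Q h = v - \<sigma>\<^sup>2\<close>, where \<open>v\<close> is the conditional variance of \<open>g\<close> and \<open>\<sigma>\<^sup>2\<close> its stationary mean. Then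
  \<open>1 - h / 2n\<close> is up to \<open>O(n powr (- 3 / 2))\<close> an eigenvector, for the eigenvalue \<open>exp (- \<sigma>\<^sup>2 / 2n)\<close>, of the matrix
  with entries \<open>Q\<^sub>i\<^sub>j exp (\<i> g\<^sub>i\<^sub>j / sqrt n)\<close>. Its \<open>n\<close>-th power gives the characteristic function of the sum of
  \<open>g\<close> along the chain. The Poisson equation also reduces the law of large numbers for the visits to a
  second moment bound.
\<close>

section \<open>The continuity theorem for characteristic functions in several dimensions\<close>

text \<open>The obstacle is that \<open>Qhat\<close> is arbitrary in the rows of unvisited states
  and comes without measurability, and that \<open>phat\<close> is given by a closed formula only
  where the Gram matrix is invertible. Limits are therefore proved for the measurable vector
  \<open>scaled_dev\<close>, and they reach \<open>phat\<close> through a pointwise implication: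
  where the visit frequencies are near \<pi> and \<open>scaled_dev\<close> is bounded, the scaled
  error of \<open>phat\<close> is within \<epsilon> of \<open>B\<close> applied to
  \<open>scaled_dev\<close>. Only the exceptional event has to be measured. The Poisson equation
  stands in for mixing: it replaces a function of the state by its stationary mean, at the price of
  a martingale and of boundary terms that scaling makes negligible. Aperiodicity of \<open>P\<close>
  is what keeps \<open>Q\<close> irreducible: a chain of period 2 observed at every second step
  would split into two classes.\<close>

inductive trig_poly :: "('v::euclidean_space \<Rightarrow> complex) \<Rightarrow> bool" where
  iexp: "trig_poly (\<lambda>x. iexp (t \<bullet> x))"
| scale: "trig_poly h \<Longrightarrow> trig_poly (\<lambda>x. c * h x)"
| add: "trig_poly h \<Longrightarrow> trig_poly k \<Longrightarrow> trig_poly (\<lambda>x. h x + k x)"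

lemma trig_poly_const: "trig_poly (\<lambda>x. c)"
  using trig_poly.scale[OF trig_poly.iexp[of 0], of c] by simp

lemma trig_poly_iexp_mult:
  assumes "trig_poly h"
  shows "trig_poly (\<lambda>x. iexp (t \<bullet> x) * h x)"
  using assms
proof induction
  case (iexp s)
  show ?case
    using trig_poly.iexp[of "t + s"] by (simp add: inner_add_left exp_add distrib_left)
next
  case (scale h c)
  then show ?case
    using trig_poly.scale[OF scale.IH, of c] by (simp add: mult_ac)
next
  case (add h k)
  then show ?case
    using trig_poly.add[OF add.IH] by (simp add: distrib_left)
qed

text \<open>Products are derived instead of being a constructor, so that the induction for
  \<open>trig_poly_integral_tendsto\<close> meets only linear combinations, on which integrals are
  linear. They reduce to sums because a product of two characters is the character of the sum of the
  frequencies.\<close>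

lemma trig_poly_mult:
  assumes "trig_poly h" "trig_poly k"
  shows "trig_poly (\<lambda>x. h x * k x)"
  using assms(1)
proof induction
  case (iexp t)
  show ?case
    by (rule trig_poly_iexp_mult[OF assms(2)])
next
  case (scale h c)
  then show ?case
    using trig_poly.scale[OF scale.IH, of c] by (simp add: mult_ac)
next
  case (add h k)
  then show ?case
    using trig_poly.add[OF add.IH] by (simp add: distrib_right)
qed

lemma trig_poly_sum:
  assumes "finite I" "\<And>i. i \<in> I \<Longrightarrow> trig_poly (h i)"
  shows "trig_poly (\<lambda>x. \<Sum>i\<in>I. h i x)"
  using assms by (induction rule: finite_induct) (auto intro: trig_poly_const trig_poly.add)

lemma trig_poly_sin: "trig_poly (\<lambda>x. complex_of_real (sin (t \<bullet> x)))"
proof -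
  have "complex_of_real (sin (t \<bullet> x)) = (- \<i> / 2) * iexp (t \<bullet> x) + (\<i> / 2) * iexp ((- t) \<bullet> x)" for x
    by (simp add: complex_eq_iff Re_exp Im_exp)
  then show ?thesis
    by (simp only: trig_poly.intros)
qed

text \<open>The content is in the generators: a linear functional of the vector of sines is a linear
  combination of sines of linear functionals. Sums and products are closure properties.\<close>

lemma trig_poly_polynomial_sin:
  fixes p :: "'v::euclidean_space \<Rightarrow> real"
  assumes "real_polynomial_function p"
  shows "trig_poly (\<lambda>x. complex_of_real (p (\<Sum>b\<in>Basis. sin ((x \<bullet> b) / L) *\<^sub>R b)))"
  using assms
proof induction
  case (linear f)
  interpret bounded_linear f by fact
  have eq: "complex_of_real (f (\<Sum>b\<in>Basis. sin ((x \<bullet> b) / L) *\<^sub>R b)) =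
      (\<Sum>b\<in>Basis. of_real (f b) * of_real (sin ((b /\<^sub>R L) \<bullet> x)))" for x
    by (simp add: sum scaleR inner_commute divide_inverse mult_ac)
  show ?case
    unfolding eq by (intro trig_poly_sum trig_poly.scale trig_poly_sin) simp
qed (simp_all add: trig_poly_const trig_poly.add trig_poly_mult)

lemma trig_poly_continuous:
  assumes "trig_poly h"
  shows "continuous_on UNIV h"
  using assms by induction (intro continuous_intros; simp)+

lemma trig_poly_borel [measurable]: "trig_poly h \<Longrightarrow> h \<in> borel_measurable borel"
  by (intro borel_measurable_continuous_onI trig_poly_continuous)

lemma trig_poly_bounded:
  assumes "trig_poly h"
  shows "\<exists>B. \<forall>x. norm (h x) \<le> B"
  using assms
proof induction
  case (iexp t)
  show ?case by (intro exI[of _ 1]) simp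
next
  case (scale h c)
  then obtain B where "\<And>x. norm (h x) \<le> B" by blast
  then show ?case
    by (intro exI[of _ "norm c * B"]) (simp add: norm_mult mult_left_mono)
next
  case (add h k)
  then obtain B C where "\<And>x. norm (h x) \<le> B" "\<And>x. norm (k x) \<le> C" by blast
  then show ?case
    by (intro exI[of _ "B + C"] allI) (meson add_mono norm_triangle_ineq order_trans)
qed

lemma trig_poly_integrable:
  assumes "trig_poly h" "prob_space N" "Z \<in> borel_measurable N"
  shows "integrable N (\<lambda>w. h (Z w))"
proof -
  interpret prob_space N by fact
  note [measurable] = assms(3) trig_poly_borel[OF assms(1)]
  obtain B where "\<And>x. norm (h x) \<le> B"
    using trig_poly_bounded[OF assms(1)] by blast
  then show ?thesis
    by (intro integrable_const_bound[of _ B]) auto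
qed

lemma trig_poly_integral_tendsto:
  fixes Z :: "nat \<Rightarrow> 'a \<Rightarrow> 'v::euclidean_space"
  assumes "prob_space M" "prob_space \<nu>" "sets \<nu> = sets borel"
    and Z: "\<And>n. Z n \<in> borel_measurable M"
    and char: "\<And>t. (\<lambda>n. \<integral>\<omega>. iexp (t \<bullet> Z n \<omega>) \<partial>M) \<longlonglongrightarrow> (\<integral>x. iexp (t \<bullet> x) \<partial>\<nu>)"
    and "trig_poly h"
  shows "(\<lambda>n. \<integral>\<omega>. h (Z n \<omega>) \<partial>M) \<longlonglongrightarrow> (\<integral>x. h x \<partial>\<nu>)"
  using \<open>trig_poly h\<close>
proof induction
  case (iexp t)
  show ?case by (rule char)
next
  case (scale h c)
  then show ?case by (simp add: tendsto_mult_left)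
next
  case (add h k)
  have "integrable M (\<lambda>\<omega>. l (Z n \<omega>))" if "trig_poly l" for l n
    by (rule trig_poly_integrable[OF that \<open>prob_space M\<close> Z])
  moreover have "integrable \<nu> l" if "trig_poly l" for l
    using trig_poly_integrable[OF that \<open>prob_space \<nu>\<close> measurable_ident_sets[OF \<open>sets \<nu> = sets borel\<close>]] .
  ultimately show ?case
    using add by (simp add: tendsto_add)
qed

text \<open>Trigonometric polynomials in \<open>x\<close> are obtained from ordinary polynomials in \<open>sin (x\<^sub>b / L)\<close>. On a
  large box \<open>f x\<close> is \<open>f (L arcsin y)\<close> at \<open>y\<^sub>b = sin (x\<^sub>b / L)\<close>, so a Weierstrass approximation of the latter on a
  cube is close to \<open>f\<close> on the box and remains bounded outside of it.\<close>

theorem levy_continuity_euclidean: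
  fixes Z :: "nat \<Rightarrow> 'a \<Rightarrow> 'v::euclidean_space"
  assumes "prob_space M" "prob_space \<nu>" "sets \<nu> = sets borel"
    and Z: "\<And>n. Z n \<in> borel_measurable M"
    and char: "\<And>t. (\<lambda>n. \<integral>\<omega>. iexp (t \<bullet> Z n \<omega>) \<partial>M) \<longlonglongrightarrow> (\<integral>x. iexp (t \<bullet> x) \<partial>\<nu>)"
  shows "tendsto_in_distr M Z \<nu>"
  unfolding tendsto_in_distr_def
proof (intro allI impI, elim conjE)
  fix f :: "'v \<Rightarrow> real"
  assume cont: "continuous_on UNIV f" and bdd: "bounded (range f)"
  interpret prob_space M by fact
  interpret N: prob_space \<nu> by fact
  note [measurable] = Z
  have [measurable_cong]: "sets \<nu> = sets borel" by fact
  have f_borel [measurable]: "f \<in> borel_measurable borel"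
    using cont by (rule borel_measurable_continuous_onI)
  have id_borel: "(\<lambda>x. x) \<in> borel_measurable \<nu>" by measurable
  obtain D where D: "\<And>x. \<bar>f x\<bar> \<le> D"
    using bdd unfolding bounded_iff by auto
  have "D \<ge> 0" using D[of 0] by linarith
  \<comment> \<open>A continuous substitute for the indicator of |u| > R: it is 0 for |u| \<le> R
    and 1 for |u| \<ge> R + 1. Being continuous and bounded, its expectation passes to the limit,
    which makes \<open>C\<close> a measure of the mass outside a cube.\<close>
  define c where "c R u = min 1 (max 0 (\<bar>u\<bar> - R))" for R u :: real
  define C where "C R x = (\<Sum>b\<in>Basis. c R (x \<bullet> b))" for R and x :: 'v
  have c_cont: "isCont (c R) u" for R u
    unfolding c_def by (intro continuous_intros)
  have [measurable]: "c R \<in> borel_measurable borel" for R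
    unfolding c_def by measurable
  have c_bd: "0 \<le> c R u" "\<bar>c R u\<bar> \<le> 1" "c R u \<le> 1" for R u
    unfolding c_def by auto
  have C_nonneg: "0 \<le> C R x" for R x
    unfolding C_def by (intro sum_nonneg c_bd)
  have [measurable]: "C R \<in> borel_measurable borel" for R
    unfolding C_def by measurable
  have c_int: "integrable M (\<lambda>\<omega>. c R (Z n \<omega> \<bullet> b))" "integrable \<nu> (\<lambda>x. c R (x \<bullet> b))" for R n b
    using c_bd by (auto intro!: integrable_const_bound[of _ 1] N.integrable_const_bound[of _ 1])
  have C_lim_M: "(\<lambda>n. \<integral>\<omega>. C R (Z n \<omega>) \<partial>M) \<longlonglongrightarrow> (\<integral>x. C R x \<partial>\<nu>)" for R
  proof -
    have "(\<lambda>n. \<integral>\<omega>. c R (Z n \<omega> \<bullet> b) \<partial>M) \<longlonglongrightarrow> (\<integral>x. c R (x \<bullet> b) \<partial>\<nu>)" for b :: 'v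
    proof -
      let ?D = "\<lambda>n. distr M borel (\<lambda>\<omega>. Z n \<omega> \<bullet> b)"
      let ?N = "distr \<nu> borel (\<lambda>x. x \<bullet> b)"
      have rd: "real_distribution (?D n)" "real_distribution ?N" for n
        by (auto intro!: real_distribution_distr N.real_distribution_distr)
      \<comment> \<open>Tightness comes from the one-dimensional continuity theorem, applied to each
        coordinate separately.\<close>
      have "weak_conv_m ?D ?N"
      proof (rule levy_continuity[OF rd])
        fix t
        show "(\<lambda>n. char (?D n) t) \<longlonglongrightarrow> char ?N t"
          using char[of "t *\<^sub>R b"] by (simp add: char_def integral_distr inner_commute)
      qed
      from weak_conv_imp_integral_bdd_continuous_conv[OF rd this c_cont, of R 1]
      show ?thesis
        using c_bd(2) by (simp add: integral_distr)
    qed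
    then show ?thesis
      unfolding C_def by (simp add: c_int tendsto_sum)
  qed
  have C_lim: "(\<lambda>k. \<integral>x. C (real k) x \<partial>\<nu>) \<longlonglongrightarrow> 0"
  proof -
    have "(\<lambda>k. \<integral>x. C (real k) x \<partial>\<nu>) \<longlonglongrightarrow> (\<integral>x. 0 \<partial>\<nu>)"
    proof (rule integral_dominated_convergence[where w="\<lambda>_. real DIM('v)"])
      have "(\<lambda>k. C (real k) x) \<longlonglongrightarrow> 0" for x
      proof -
        have "eventually (\<lambda>k. C (real k) x = 0) sequentially"
          using eventually_ge_at_top[of "nat \<lceil>norm x\<rceil>"]
        proof eventually_elim
          case (elim k)
          have "c (real k) (x \<bullet> b) = 0" if "b \<in> Basis" for b
            using Basis_le_norm[OF that, of x] elim unfolding c_def by linarith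
          then show ?case by (simp add: C_def)
        qed
        then show ?thesis by (rule tendsto_eventually)
      qed
      then show "AE x in \<nu>. (\<lambda>k. C (real k) x) \<longlonglongrightarrow> 0" by simp
      have "norm (C (real k) x) \<le> DIM('v)" for k x
        using C_nonneg[of k x] sum_mono[of Basis "\<lambda>b. c k (x \<bullet> b)" "\<lambda>_. 1", OF c_bd(3)]
        unfolding C_def by simp
      then show "AE x in \<nu>. norm (C (real k) x) \<le> DIM('v)" for k by simp
    qed simp_all
    then show ?thesis by simp
  qed
  show "(\<lambda>n. \<integral>x. f x \<partial>distr M borel (Z n)) \<longlonglongrightarrow> (\<integral>x. f x \<partial>\<nu>)"
  proof (rule LIMSEQ_I)
    fix r :: real
    assume "0 < r"
    \<comment> \<open>The errors below add up to at most \<open>e * (4 * D + 5)\<close>, which is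
      below \<open>e * (8 * (D + 1))\<close>. The cap 1 keeps the approximating polynomial bounded
      by \<open>D + 1\<close>.\<close>
    define e where "e = min 1 (r / (8 * (D + 1)))"
    have e: "0 < e" "e \<le> 1" "e \<le> r / (8 * (D + 1))"
      using \<open>0 < r\<close> \<open>D \<ge> 0\<close> unfolding e_def by auto
    then have e_r: "e * (8 * (D + 1)) \<le> r"
      using \<open>D \<ge> 0\<close> by (subst (asm) pos_le_divide_eq) auto
    obtain k :: nat where k: "(\<integral>x. C (real k) x \<partial>\<nu>) < e"
      using order_tendstoD(2)[OF C_lim e(1)] by (auto simp: eventually_sequentially)
    \<comment> \<open>With this L, a point outside the box has a coordinate beyond k + 1, where
      \<open>c k\<close> is already 1. Inside, the arguments x / L stay in [-1, 1], where arcsin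
      inverts sin because \<pi> / 2 > 1.\<close>
    define L where "L = real k + 1"
    have L: "L > 0" unfolding L_def by simp
    define \<psi> :: "'v \<Rightarrow> 'v" where "\<psi> x = (\<Sum>b\<in>Basis. sin ((x \<bullet> b) / L) *\<^sub>R b)" for x
    define F where "F y = f (\<Sum>b\<in>Basis. (L * arcsin (y \<bullet> b)) *\<^sub>R b)" for y :: 'v
    have "continuous_on (cbox (- One) One) F"
      unfolding F_def
      by (intro continuous_on_compose2[OF cont] continuous_intros) (auto simp: mem_box)
    then obtain p where p: "real_polynomial_function p" "\<And>y. y \<in> cbox (- One) One \<Longrightarrow> \<bar>F y - p y\<bar> < e"
      using Stone_Weierstrass_real_polynomial_function[OF compact_cbox _ e(1)] by metis
    have \<psi>: "\<psi> x \<in> cbox (- One) One" for x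
      by (simp add: mem_box \<psi>_def)
    define g where "g x = p (\<psi> x)" for x
    have tg: "trig_poly (\<lambda>x. complex_of_real (g x))"
      unfolding g_def \<psi>_def by (rule trig_poly_polynomial_sin[OF p(1)])
    \<comment> \<open>The bound is global, although \<open>p\<close> approximates \<open>F\<close>
      only on the cube, because \<open>\<psi>\<close> takes all its values in that cube.\<close>
    have g_bd: "\<bar>g x\<bar> \<le> D + 1" for x
      using p(2)[OF \<psi>[of x]] D[of "\<Sum>b\<in>Basis. (L * arcsin (\<psi> x \<bullet> b)) *\<^sub>R b"] e(2)
      unfolding g_def F_def by linarith
    have [measurable]: "g \<in> borel_measurable borel"
      using trig_poly_borel[OF tg] borel_measurable_complex_iff by force
    have close: "\<bar>f x - g x\<bar> \<le> e + (2 * D + 1) * C (real k) x" for x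
    proof (cases "\<forall>b\<in>Basis. \<bar>x \<bullet> b\<bar> \<le> L")
      case True
      have "(\<Sum>b\<in>Basis. (L * arcsin (\<psi> x \<bullet> b)) *\<^sub>R b) = x"
      proof (rule euclidean_eqI)
        fix b :: 'v
        assume b: "b \<in> Basis"
        then have "\<bar>(x \<bullet> b) / L\<bar> \<le> 1" using True L by simp
        then have "arcsin (sin ((x \<bullet> b) / L)) = (x \<bullet> b) / L"
          using pi_gt3 by (intro arcsin_sin) linarith+
        then show "(\<Sum>b\<in>Basis. (L * arcsin (\<psi> x \<bullet> b)) *\<^sub>R b) \<bullet> b = x \<bullet> b"
          using b L by (simp add: \<psi>_def)
      qed
      then have "\<bar>f x - g x\<bar> < e"
        using p(2)[OF \<psi>[of x]] by (simp add: g_def F_def)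
      moreover have "0 \<le> (2 * D + 1) * C (real k) x"
        using \<open>D \<ge> 0\<close> C_nonneg by simp
      ultimately show ?thesis by linarith
    next
      case False
      then obtain b where b: "b \<in> Basis" "\<bar>x \<bullet> b\<bar> > L" by force
      have "1 = c (real k) (x \<bullet> b)"
        using b(2) by (simp add: c_def L_def)
      also have "\<dots> \<le> C (real k) x"
        unfolding C_def by (rule member_le_sum[OF b(1)]) (auto simp: c_bd)
      finally have "(2 * D + 1) * 1 \<le> (2 * D + 1) * C (real k) x"
        using \<open>D \<ge> 0\<close> by (intro mult_left_mono) auto
      moreover have "\<bar>f x - g x\<bar> \<le> 2 * D + 1"
        using g_bd[of x] D[of x] by linarith
      ultimately show ?thesis
        using e(1) by simp
    qed
    have close_int: "\<bar>(\<integral>w. f (W w) \<partial>L) - (\<integral>w. g (W w) \<partial>L)\<bar> \<le> e + (2 * D + 1) * (\<integral>w. C (real k) (W w) \<partial>L)"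
      if "prob_space L" and W [measurable]: "W \<in> borel_measurable L" for L :: "'c measure" and W
    proof -
      interpret L: prob_space L by fact
      have i: "integrable L (\<lambda>w. f (W w))"
        using D by (intro L.integrable_const_bound[of _ D]) auto
      have i2: "integrable L (\<lambda>w. g (W w))"
        using g_bd by (intro L.integrable_const_bound[of _ "D + 1"]) auto
      have i': "integrable L (\<lambda>w. C (real k) (W w))"
        unfolding C_def using c_bd by (intro Bochner_Integration.integrable_sum L.integrable_const_bound[of _ 1]) auto
      have "\<bar>(\<integral>w. f (W w) \<partial>L) - (\<integral>w. g (W w) \<partial>L)\<bar> = \<bar>\<integral>w. f (W w) - g (W w) \<partial>L\<bar>"
        using i i2 by simp
      also have "\<dots> \<le> (\<integral>w. \<bar>f (W w) - g (W w)\<bar> \<partial>L)"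
        by (rule integral_abs_bound)
      also have "\<dots> \<le> (\<integral>w. e + (2 * D + 1) * C (real k) (W w) \<partial>L)"
        using i i2 i' close by (intro integral_mono) auto
      also have "\<dots> = e + (2 * D + 1) * (\<integral>w. C (real k) (W w) \<partial>L)"
        using i' by (simp add: L.prob_space)
      finally show ?thesis .
    qed
    have "(\<lambda>n. \<integral>\<omega>. complex_of_real (g (Z n \<omega>)) \<partial>M) \<longlonglongrightarrow> (\<integral>x. complex_of_real (g x) \<partial>\<nu>)"
      by (rule trig_poly_integral_tendsto[OF assms tg])
    then have g_lim: "(\<lambda>n. \<integral>\<omega>. g (Z n \<omega>) \<partial>M) \<longlonglongrightarrow> (\<integral>x. g x \<partial>\<nu>)"
      by (simp add: tendsto_of_real_iff)
    have "eventually (\<lambda>n. \<bar>(\<integral>\<omega>. g (Z n \<omega>) \<partial>M) - (\<integral>x. g x \<partial>\<nu>)\<bar> < e) sequentially"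
      using tendstoD[OF g_lim e(1)] by (simp add: dist_real_def)
    moreover have "eventually (\<lambda>n. (\<integral>\<omega>. C (real k) (Z n \<omega>) \<partial>M) < e) sequentially"
      using order_tendstoD(2)[OF C_lim_M k] .
    ultimately have "eventually (\<lambda>n. \<bar>(\<integral>\<omega>. f (Z n \<omega>) \<partial>M) - (\<integral>x. f x \<partial>\<nu>)\<bar> < r) sequentially"
    proof eventually_elim
      case (elim n)
      have "(2 * D + 1) * (\<integral>\<omega>. C (real k) (Z n \<omega>) \<partial>M) \<le> (2 * D + 1) * e"
        "(2 * D + 1) * (\<integral>x. C (real k) x \<partial>\<nu>) \<le> (2 * D + 1) * e"
        using elim k \<open>D \<ge> 0\<close> by (auto intro!: mult_left_mono)
      then have "\<bar>(\<integral>\<omega>. f (Z n \<omega>) \<partial>M) - (\<integral>x. f x \<partial>\<nu>)\<bar> < e + 2 * (e + (2 * D + 1) * e)"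
        using close_int[OF \<open>prob_space M\<close> Z[of n]] close_int[OF \<open>prob_space \<nu>\<close> id_borel] elim(1)
        by argo
      also have "\<dots> = e * (4 * D + 5)"
        by (simp add: algebra_simps)
      also have "\<dots> \<le> e * (8 * (D + 1))"
        using e(1) \<open>D \<ge> 0\<close> by (intro mult_left_mono) auto
      finally show ?case using e_r by linarith
    qed
    then show "\<exists>no. \<forall>n\<ge>no. norm ((\<integral>x. f x \<partial>distr M borel (Z n)) - (\<integral>x. f x \<partial>\<nu>)) < r"
      by (simp add: integral_distr eventually_sequentially)
  qed
qed

section \<open>Gaussian measures with given covariance\<close>

lemma char_gaussian:
  assumes "is_gaussian 0 C \<nu>"
  shows "(\<integral>x. iexp (t \<bullet> x) \<partial>\<nu>) = of_real (exp (- (t \<bullet> (C *v t)) / 2))"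
proof -
  interpret prob_space \<nu> using assms by (simp add: is_gaussian_def)
  have [measurable_cong]: "sets \<nu> = sets borel" using assms by (simp add: is_gaussian_def)
  let ?v = "t \<bullet> (C *v t)"
  have law: "distr \<nu> borel (\<lambda>x. t \<bullet> x) =
      (if ?v = 0 then return borel 0 else density lborel (normal_density 0 (sqrt ?v)))" and "0 \<le> ?v"
    using assms by (simp_all add: is_gaussian_def)
  have "(\<integral>x. iexp (t \<bullet> x) \<partial>\<nu>) = (\<integral>u. iexp u \<partial>distr \<nu> borel (\<lambda>x. t \<bullet> x))"
    by (simp add: integral_distr)
  also have "\<dots> = of_real (exp (- ?v / 2))"
  proof (cases "?v = 0")
    case True
    then show ?thesis by (simp add: law integral_return)
  next
    case False
    with \<open>0 \<le> ?v\<close> have pos: "sqrt ?v > 0" by simp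
    interpret S: prob_space std_normal_distribution
      by (rule prob_space_normal_density) simp
    have "distributed std_normal_distribution lborel (\<lambda>x. x) std_normal_density"
      by (simp add: distributed_def distr_id2)
    from S.normal_density_affine[OF this, of "sqrt ?v" 0] pos
    have "distr std_normal_distribution lborel (\<lambda>x. sqrt ?v * x) =
        density lborel (normal_density 0 (sqrt ?v))"
      by (simp add: distributed_def)
    then have "(\<integral>u. iexp u \<partial>distr \<nu> borel (\<lambda>x. t \<bullet> x)) =
        (\<integral>u. iexp u \<partial>distr std_normal_distribution lborel (\<lambda>x. sqrt ?v * x))"
      using False by (simp add: law)
    also have "\<dots> = char std_normal_distribution (sqrt ?v)"
      by (simp add: integral_distr char_def)
    also have "\<dots> = of_real (exp (- ?v / 2))"
      using \<open>0 \<le> ?v\<close> by (simp add: char_std_normal_distribution)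
    finally show ?thesis .
  qed
  finally show ?thesis .
qed

text \<open>The measure is the law of \<open>A\<close> applied to a vector of independent standard
  normal variables. A covariance has to be presented as a product with a transpose for this, which
  is why the asymptotic covariance is factored later.\<close>

lemma gaussian_exists:
  fixes A :: "real^'c^'k"
  shows "\<exists>\<nu>. is_gaussian 0 (A ** transpose A) \<nu>"
proof -
  let ?S = std_normal_distribution
  interpret S: prob_space ?S
    by (rule prob_space_normal_density) simp
  define N :: "('c \<Rightarrow> real) measure" where "N = (\<Pi>\<^sub>M c\<in>UNIV. ?S)"
  interpret N: prob_space N
    unfolding N_def by (intro prob_space_PiM S.prob_space_axioms)
  have comp: "distr N borel (\<lambda>w. w c) = ?S" for c
  proof -
    have "distr N borel (\<lambda>w. w c) = distr N ?S (\<lambda>w. w c)"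
      by (rule distr_cong) auto
    also have "\<dots> = ?S"
      unfolding N_def by (rule distr_PiM_component) (auto intro: S.prob_space_axioms)
    finally show ?thesis .
  qed
  have [measurable]: "(\<lambda>w. w c) \<in> borel_measurable N" for c
  proof -
    have "(\<lambda>w. w c) \<in> measurable N ?S" unfolding N_def by measurable
    then show ?thesis by (simp add: measurable_def)
  qed
  have indep: "N.indep_vars (\<lambda>_. borel) (\<lambda>c w. w c) UNIV"
  proof (subst N.indep_vars_iff_distr_eq_PiM')
    have "sets N = sets (\<Pi>\<^sub>M c\<in>UNIV. borel)"
      unfolding N_def by (intro sets_PiM_cong) auto
    then have "distr N (\<Pi>\<^sub>M c\<in>UNIV. borel) (\<lambda>w. \<lambda>c\<in>UNIV. w c) = N"
      using distr_id2[of "\<Pi>\<^sub>M c\<in>UNIV. borel" N] by (simp add: restrict_UNIV)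
    then show "distr N (\<Pi>\<^sub>M c\<in>UNIV. borel) (\<lambda>w. \<lambda>c\<in>UNIV. w c) = (\<Pi>\<^sub>M c\<in>UNIV. distr N borel (\<lambda>w. w c))"
      unfolding comp by (simp add: N_def)
  qed auto
  define f where "f w = A *v (\<chi> c. w c)" for w
  have [measurable]: "f \<in> borel_measurable N"
    unfolding f_def matrix_mult_sum scalar_mult_eq_scaleR by simp
  \<comment> \<open>Coordinates with coefficient 0 are dropped, since
    \<open>normal_density_affine\<close> needs a nonzero slope. The index set becomes empty exactly
    in the directions of variance 0, where the law is a point mass. The summand 0 + and the factor 1
    below follow the shape of the library facts.\<close>
  have lin: "t \<bullet> f w = (\<Sum>c | (t v* A) $ c \<noteq> 0. 0 + (t v* A) $ c * w c)" for t w
  proof -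
    have "t \<bullet> f w = (\<Sum>c\<in>UNIV. (t v* A) $ c * w c)"
      unfolding f_def dot_lmul_matrix[symmetric] by (simp add: inner_vec_def)
    also have "\<dots> = (\<Sum>c | (t v* A) $ c \<noteq> 0. (t v* A) $ c * w c)"
      by (rule sum.mono_neutral_right) auto
    finally show ?thesis by simp
  qed
  have var: "t \<bullet> ((A ** transpose A) *v t) = (\<Sum>c | (t v* A) $ c \<noteq> 0. (\<bar>(t v* A) $ c\<bar> * 1)\<^sup>2)" for t
  proof -
    have "t \<bullet> ((A ** transpose A) *v t) = (t v* A) \<bullet> (t v* A)"
      by (simp add: dot_lmul_matrix matrix_vector_mul_assoc[symmetric])
    also have "\<dots> = (\<Sum>c\<in>UNIV. ((t v* A) $ c)\<^sup>2)"
      by (simp add: inner_vec_def power2_eq_square)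
    also have "\<dots> = (\<Sum>c | (t v* A) $ c \<noteq> 0. ((t v* A) $ c)\<^sup>2)"
      by (rule sum.mono_neutral_right) auto
    finally show ?thesis by simp
  qed
  have law: "distr (distr N borel f) borel (\<lambda>x. t \<bullet> x) =
      (if t \<bullet> ((A ** transpose A) *v t) = 0 then return borel (t \<bullet> 0)
       else density lborel (normal_density (t \<bullet> 0) (sqrt (t \<bullet> ((A ** transpose A) *v t)))))" for t
  proof -
    let ?I = "{c. (t v* A) $ c \<noteq> 0}"
    have 1: "distr (distr N borel f) borel (\<lambda>x. t \<bullet> x) = distr N borel (\<lambda>w. \<Sum>c\<in>?I. 0 + (t v* A) $ c * w c)"
      by (simp add: distr_distr comp_def lin)
    show ?thesis
    proof (cases "?I = {}")
      case True
      then have "t \<bullet> ((A ** transpose A) *v t) = 0"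
        unfolding var True by simp
      moreover have "distr N borel (\<lambda>w. \<Sum>c\<in>?I. 0 + (t v* A) $ c * w c) = return borel 0"
        unfolding True by simp
      ultimately show ?thesis
        unfolding 1 by simp
    next
      case False
      have ne: "(\<Sum>c\<in>?I. (\<bar>(t v* A) $ c\<bar> * 1)\<^sup>2) \<noteq> 0"
        using False by (subst sum_nonneg_eq_0_iff) auto
      have "N.indep_vars (\<lambda>_. borel) (\<lambda>c w. 0 + (t v* A) $ c * w c) ?I"
        by (rule N.indep_vars_compose2[OF N.indep_vars_subset[OF indep]]) auto
      moreover have "distributed N lborel (\<lambda>w. 0 + (t v* A) $ c * w c)
          (normal_density (0 + (t v* A) $ c * 0) (\<bar>(t v* A) $ c\<bar> * 1))" if "c \<in> ?I" for c
      proof (rule N.normal_density_affine)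
        have "distr N lborel (\<lambda>w. w c) = distr N borel (\<lambda>w. w c)"
          by (rule distr_cong) auto
        then show "distributed N lborel (\<lambda>w. w c) std_normal_density"
          unfolding distributed_def comp by simp
      qed (use that in auto)
      ultimately have "distributed N lborel (\<lambda>w. \<Sum>c\<in>?I. 0 + (t v* A) $ c * w c)
         (normal_density (\<Sum>c\<in>?I. 0 + (t v* A) $ c * 0) (sqrt (\<Sum>c\<in>?I. (\<bar>(t v* A) $ c\<bar> * 1)\<^sup>2)))"
        using False by (intro N.sum_indep_normal) auto
      moreover have "distr N lborel (\<lambda>w. \<Sum>c\<in>?I. 0 + (t v* A) $ c * w c) = distr N borel (\<lambda>w. \<Sum>c\<in>?I. 0 + (t v* A) $ c * w c)"
        by (rule distr_cong) auto
      ultimately show ?thesis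
        unfolding 1 var using ne by (simp add: distributed_def)
    qed
  qed
  have "is_gaussian 0 (A ** transpose A) (distr N borel f)"
    unfolding is_gaussian_def
  proof (intro conjI allI law)
    show "prob_space (distr N borel f)"
      by (rule N.prob_space_distr) simp
    show "transpose (A ** transpose A) = A ** transpose A"
      by (simp add: matrix_transpose_mul)
    show "0 \<le> t \<bullet> ((A ** transpose A) *v t)" for t
      unfolding var by (intro sum_nonneg) simp
  qed simp
  then show ?thesis by blast
qed

section \<open>Markov chains observed at random times\<close>

lemma mpow_0: "mpow A 0 = mat 1"
  by (simp add: mpow_def)

lemma mpow_Suc: "mpow A (Suc k) = A ** mpow A k"
  by (simp add: mpow_def)

lemma mpow_Suc2: "mpow A (Suc k) = mpow A k ** A"
proof (induction k)
  case 0
  show ?case by (simp add: mpow_Suc mpow_0)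
next
  case (Suc k)
  have "mpow A (Suc (Suc k)) = A ** mpow A (Suc k)"
    by (rule mpow_Suc)
  also have "\<dots> = (A ** mpow A k) ** A"
    by (simp only: Suc.IH matrix_mul_assoc)
  finally show ?case by (simp only: mpow_Suc[symmetric])
qed

lemma mpow_add: "mpow A (k + l) = mpow A k ** mpow A l"
  by (induction k) (simp_all add: mpow_0 mpow_Suc matrix_mul_assoc)

lemma stochastic_mpow:
  assumes "stochastic P"
  shows "stochastic (mpow P k)"
proof (induction k)
  case 0
  show ?case by (auto simp: mpow_0 stochastic_def mat_def)
next
  case (Suc k)
  have "(\<Sum>j\<in>UNIV. \<Sum>l\<in>UNIV. P $ i $ l * mpow P k $ l $ j) = 1" for i
  proof -
    have "(\<Sum>j\<in>UNIV. \<Sum>l\<in>UNIV. P $ i $ l * mpow P k $ l $ j) = (\<Sum>l\<in>UNIV. P $ i $ l * (\<Sum>j\<in>UNIV. mpow P k $ l $ j))"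
      by (subst sum.swap) (simp add: sum_distrib_left)
    then show ?thesis using Suc assms by (simp add: stochastic_def)
  qed
  then show ?case
    using Suc assms by (auto simp: mpow_Suc stochastic_def matrix_matrix_mult_def intro!: sum_nonneg)
qed

lemma stochastic_le_1: "stochastic P \<Longrightarrow> P $ i $ j \<le> 1"
  using member_le_sum[of j UNIV "\<lambda>j. P $ i $ j"] by (auto simp: stochastic_def)

text \<open>Events determined by the path up to time m, described by invariance under changing the
  outcome without changing that path. With finitely many states such an event is a finite union of
  path cylinders, so measurability is a consequence and no filtration has to be set up.\<close>

definition past :: "'a measure \<Rightarrow> (nat \<Rightarrow> 'a \<Rightarrow> 'n) \<Rightarrow> nat \<Rightarrow> 'a set \<Rightarrow> bool" where
  "past M X m F \<longleftrightarrow> F \<subseteq> space M \<and>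
     (\<forall>\<omega>\<in>space M. \<forall>\<omega>'\<in>space M. (\<forall>k\<le>m. X k \<omega> = X k \<omega>') \<longrightarrow> \<omega> \<in> F \<longrightarrow> \<omega>' \<in> F)"

lemma pastI:
  assumes "F \<subseteq> space M"
    and "\<And>\<omega> \<omega>'. \<omega> \<in> space M \<Longrightarrow> \<omega>' \<in> space M \<Longrightarrow> (\<And>k. k \<le> m \<Longrightarrow> X k \<omega> = X k \<omega>') \<Longrightarrow> \<omega> \<in> F \<Longrightarrow> \<omega>' \<in> F"
  shows "past M X m F"
  unfolding past_def using assms by blast

lemma pastD:
  assumes "past M X m F" "\<omega> \<in> F" "\<omega>' \<in> space M" "\<And>k. k \<le> m \<Longrightarrow> X k \<omega> = X k \<omega>'"
  shows "\<omega>' \<in> F"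
  using assms unfolding past_def by blast

lemma past_subset: "past M X m F \<Longrightarrow> F \<subseteq> space M"
  by (simp add: past_def)

lemma past_mono:
  assumes "past M X m F" "m \<le> m'"
  shows "past M X m' F"
proof (rule pastI[OF past_subset[OF assms(1)]])
  fix \<omega> \<omega>'
  assume "\<omega>' \<in> space M" "\<And>k. k \<le> m' \<Longrightarrow> X k \<omega> = X k \<omega>'" "\<omega> \<in> F"
  then show "\<omega>' \<in> F"
    using assms(2) by (intro pastD[OF assms(1), of \<omega> \<omega>']) auto
qed

lemma past_Int_state:
  assumes "past M X m F" "k \<le> m"
  shows "past M X m (F \<inter> {\<omega> \<in> space M. X k \<omega> = i})"
proof (rule pastI)
  fix \<omega> \<omega>'
  assume *: "\<omega>' \<in> space M" "\<And>k. k \<le> m \<Longrightarrow> X k \<omega> = X k \<omega>'" "\<omega> \<in> F \<inter> {\<omega> \<in> space M. X k \<omega> = i}"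
  have "\<omega>' \<in> F"
    using pastD[OF assms(1) _ *(1)] *(2,3) by blast
  then show "\<omega>' \<in> F \<inter> {\<omega> \<in> space M. X k \<omega> = i}"
    using *(1,3) *(2)[OF assms(2)] by simp
qed auto

lemma past_decomp:
  fixes X :: "nat \<Rightarrow> 'a \<Rightarrow> 'n::finite"
  assumes "past M X m F"
  obtains I where "finite I" "F = (\<Union>x\<in>I. {\<omega> \<in> space M. \<forall>k\<le>m. X k \<omega> = x k})"
    "disjoint_family_on (\<lambda>x. {\<omega> \<in> space M. \<forall>k\<le>m. X k \<omega> = x k}) I"
proof
  \<comment> \<open>\<open>restrict\<close> makes the indices agree after time m, so that each
    cylinder has exactly one index and all indices lie in a finite product.\<close>
  let ?I = "(\<lambda>\<omega>. restrict (\<lambda>k. X k \<omega>) {..m}) ` F"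
  have "?I \<subseteq> PiE {..m} (\<lambda>_. UNIV)" by (auto split: if_splits)
  then show "finite ?I"
    by (rule finite_subset) (simp add: finite_PiE)
  show "F = (\<Union>x\<in>?I. {\<omega> \<in> space M. \<forall>k\<le>m. X k \<omega> = x k})"
  proof (intro equalityI subsetI)
    fix \<omega>
    assume "\<omega> \<in> F"
    then show "\<omega> \<in> (\<Union>x\<in>?I. {\<omega> \<in> space M. \<forall>k\<le>m. X k \<omega> = x k})"
      using past_subset[OF assms] by auto
  next
    fix \<omega>'
    assume "\<omega>' \<in> (\<Union>x\<in>?I. {\<omega> \<in> space M. \<forall>k\<le>m. X k \<omega> = x k})"
    then obtain \<omega> where "\<omega> \<in> F" "\<omega>' \<in> space M" "\<And>k. k \<le> m \<Longrightarrow> X k \<omega> = X k \<omega>'" by auto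
    then show "\<omega>' \<in> F" by (rule pastD[OF assms])
  qed
  show "disjoint_family_on (\<lambda>x. {\<omega> \<in> space M. \<forall>k\<le>m. X k \<omega> = x k}) ?I"
  proof (unfold disjoint_family_on_def, intro ballI impI)
    fix x y
    assume xy: "x \<in> ?I" "y \<in> ?I" "x \<noteq> y"
    then obtain k where "x k \<noteq> y k" by (meson ext)
    with xy(1,2) have "k \<le> m" by (intro leI notI) auto
    with \<open>x k \<noteq> y k\<close>
    show "{\<omega> \<in> space M. \<forall>k\<le>m. X k \<omega> = x k} \<inter> {\<omega> \<in> space M. \<forall>k\<le>m. X k \<omega> = y k} = {}" by auto
  qed
qed

context
  fixes M :: "'a measure" and X :: "nat \<Rightarrow> 'a \<Rightarrow> 'n::finite" and P :: "real^'n^'n"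
  assumes prob: "prob_space M" and chain: "markov_chain M X P"
begin

interpretation prob_space M by (rule prob)

lemma chain_measurable [measurable]: "X m \<in> measurable M (count_space UNIV)"
  using chain by (simp add: markov_chain_def)

lemma path_event: "{\<omega> \<in> space M. \<forall>k\<le>m. X k \<omega> = x k} \<in> sets M"
  by measurable

lemma past_event:
  assumes "past M X m F"
  shows "F \<in> sets M"
proof -
  obtain I where I: "finite I" "F = (\<Union>x\<in>I. {\<omega> \<in> space M. \<forall>k\<le>m. X k \<omega> = x k})"
    "disjoint_family_on (\<lambda>x. {\<omega> \<in> space M. \<forall>k\<le>m. X k \<omega> = x k}) I"
    by (rule past_decomp[OF assms])
  show ?thesis
    unfolding I(2) by (intro sets.finite_UN I(1) path_event)
qed

lemma state_event: "{\<omega> \<in> space M. X m \<omega> = i} \<in> sets M"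
  by measurable

lemma measure_split_state:
  assumes "F \<in> sets M"
  shows "measure M F = (\<Sum>i\<in>UNIV. measure M (F \<inter> {\<omega> \<in> space M. X m \<omega> = i}))"
proof -
  have "F = (\<Union>i. F \<inter> {\<omega> \<in> space M. X m \<omega> = i})"
    using sets.sets_into_space[OF assms] by auto
  then have "measure M F = measure M (\<Union>i. F \<inter> {\<omega> \<in> space M. X m \<omega> = i})" by simp
  also have "\<dots> = (\<Sum>i\<in>UNIV. measure M (F \<inter> {\<omega> \<in> space M. X m \<omega> = i}))"
    using assms state_event by (intro finite_measure_finite_Union) (auto simp: disjoint_family_on_def)
  finally show ?thesis .
qed

text \<open>\<open>markov_chain\<close> conditions on a complete path. Summing over the disjoint
  paths that make up the event, all of which end in state i, replaces the path by an arbitrary event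
  of the past.\<close>

lemma markov_step:
  assumes "past M X m F"
  shows "measure M (F \<inter> {\<omega> \<in> space M. X m \<omega> = i} \<inter> {\<omega> \<in> space M. X (Suc m) \<omega> = j})
    = measure M (F \<inter> {\<omega> \<in> space M. X m \<omega> = i}) * P $ i $ j"
proof -
  let ?A = "\<lambda>x. {\<omega> \<in> space M. \<forall>k\<le>m. X k \<omega> = x k}"
  let ?S = "{\<omega> \<in> space M. X (Suc m) \<omega> = j}"
  obtain I where I: "finite I" "F \<inter> {\<omega> \<in> space M. X m \<omega> = i} = (\<Union>x\<in>I. ?A x)" "disjoint_family_on ?A I"
    by (rule past_decomp[OF past_Int_state[OF assms order_refl, of i]])
  have step: "measure M (?A x \<inter> ?S) = measure M (?A x) * P $ i $ j" if "x \<in> I" for x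
  proof (cases "measure M (?A x) = 0")
    \<comment> \<open>\<open>markov_chain\<close> is silent about paths of probability 0; for these
      both sides vanish.\<close>
    case True
    then have "measure M (?A x \<inter> ?S) \<le> 0"
      using finite_measure_mono[of "?A x \<inter> ?S" "?A x"] path_event by simp
    then show ?thesis using True by (simp add: measure_le_0_iff)
  next
    case False
    then have pos: "0 < measure M (?A x)"
      by (simp add: zero_less_measure_iff)
    then have "?A x \<noteq> {}" by (intro notI) simp
    then obtain \<omega> where \<omega>: "\<omega> \<in> ?A x" by blast
    then have "\<omega> \<in> F \<inter> {\<omega> \<in> space M. X m \<omega> = i}" unfolding I(2) using that by blast
    then have "x m = i" using \<omega> by simp
    have "measure M {\<omega> \<in> space M. X (Suc m) \<omega> = j \<and> (\<forall>k\<le>m. X k \<omega> = x k)} / measure M (?A x) = P $ x m $ j"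
      using chain pos unfolding markov_chain_def cond_prob_def by blast
    moreover have "{\<omega> \<in> space M. X (Suc m) \<omega> = j \<and> (\<forall>k\<le>m. X k \<omega> = x k)} = ?A x \<inter> ?S"
      by auto
    ultimately show ?thesis
      using False \<open>x m = i\<close> by (simp add: field_simps)
  qed
  have "F \<inter> {\<omega> \<in> space M. X m \<omega> = i} \<inter> ?S = (\<Union>x\<in>I. ?A x \<inter> ?S)"
    unfolding I(2) by auto
  also have "measure M \<dots> = (\<Sum>x\<in>I. measure M (?A x \<inter> ?S))"
    using I(1,3) path_event state_event
    by (intro finite_measure_finite_Union) (auto simp: disjoint_family_on_def)
  also have "\<dots> = (\<Sum>x\<in>I. measure M (?A x)) * P $ i $ j"
    by (simp add: step sum_distrib_right)
  also have "(\<Sum>x\<in>I. measure M (?A x)) = measure M (\<Union>x\<in>I. ?A x)"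
    using I(1,3) path_event by (intro finite_measure_finite_Union[symmetric]) auto
  finally show ?thesis unfolding I(2) .
qed

lemma markov_steps:
  assumes "past M X m F"
  shows "measure M (F \<inter> {\<omega> \<in> space M. X m \<omega> = i} \<inter> {\<omega> \<in> space M. X (m + l) \<omega> = j})
    = measure M (F \<inter> {\<omega> \<in> space M. X m \<omega> = i}) * mpow P l $ i $ j"
proof (induction l arbitrary: j)
  case 0
  have "F \<inter> {\<omega> \<in> space M. X m \<omega> = i} \<inter> {\<omega> \<in> space M. X m \<omega> = j} =
      (if i = j then F \<inter> {\<omega> \<in> space M. X m \<omega> = i} else {})" by auto
  then show ?case by (simp add: mpow_0 mat_def)
next
  case (Suc l)
  let ?F = "F \<inter> {\<omega> \<in> space M. X m \<omega> = i}"
  have F: "past M X (m + l) ?F"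
    using past_Int_state[OF past_mono[OF assms, of "m + l"], of m i] by simp
  have "measure M (?F \<inter> {\<omega> \<in> space M. X (m + Suc l) \<omega> = j}) =
      (\<Sum>k\<in>UNIV. measure M (?F \<inter> {\<omega> \<in> space M. X (m + Suc l) \<omega> = j} \<inter> {\<omega> \<in> space M. X (m + l) \<omega> = k}))"
    using past_event[OF F] state_event by (intro measure_split_state) auto
  also have "\<dots> = (\<Sum>k\<in>UNIV. measure M (?F \<inter> {\<omega> \<in> space M. X (m + l) \<omega> = k} \<inter> {\<omega> \<in> space M. X (Suc (m + l)) \<omega> = j}))"
    by (intro sum.cong refl arg_cong[where f="measure M"]) auto
  also have "\<dots> = (\<Sum>k\<in>UNIV. measure M ?F * mpow P l $ i $ k * P $ k $ j)"
    by (simp only: markov_step[OF F] Suc.IH)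
  also have "\<dots> = measure M ?F * mpow P (Suc l) $ i $ j"
    by (simp add: mpow_Suc2 matrix_matrix_mult_def sum_distrib_left mult.assoc)
  finally show ?case .
qed

end

section \<open>The chain seen at the observation times\<close>

lemma emeasure_countable_split:
  fixes K :: "'a \<Rightarrow> 'c::countable"
  assumes K [measurable]: "K \<in> measurable M (count_space UNIV)" and E [measurable]: "E \<in> sets M"
  shows "emeasure M E = (\<integral>\<^sup>+c. emeasure M (E \<inter> {\<omega> \<in> space M. K \<omega> = c}) \<partial>count_space UNIV)"
proof -
  have "E = (\<Union>c. E \<inter> {\<omega> \<in> space M. K \<omega> = c})"
    using sets.sets_into_space[OF E] by auto
  then have "emeasure M E = emeasure M (\<Union>c. E \<inter> {\<omega> \<in> space M. K \<omega> = c})" by simp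
  also have "\<dots> = (\<integral>\<^sup>+c. emeasure M (E \<inter> {\<omega> \<in> space M. K \<omega> = c}) \<partial>count_space UNIV)"
    by (rule emeasure_UN_countable) (auto simp: disjoint_family_on_def)
  finally show ?thesis .
qed

lemma pmf_nat_sums: "pmf (\<mu> :: nat pmf) sums 1"
proof -
  have "integrable (count_space UNIV) (pmf \<mu>)"
    by (rule integrable_pmf)
  moreover have "(\<integral>x. pmf \<mu> x \<partial>count_space UNIV) = 1"
    by (simp add: integral_pmf)
  ultimately show ?thesis
    using sums_integral_count_space_nat[of "pmf \<mu>"] by simp
qed

text \<open>The series in \<open>subsampled\<close> is a limit in the space of matrices. Domination
  of each entry by \<open>pmf \<mu>\<close> gives convergence, after which the entries can be
  handled as real series.\<close>

lemma subsampled_component: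
  fixes P :: "real^'n^'n"
  assumes "stochastic P"
  shows "(\<lambda>l. pmf \<mu> l * mpow P l $ i $ j) sums (subsampled \<mu> P $ i $ j)"
proof -
  have summ: "summable (\<lambda>l. pmf \<mu> l * mpow P l $ i $ j)" for i j
  proof (rule summable_comparison_test')
    show "summable (pmf \<mu>)"
      using pmf_nat_sums[of \<mu>] by (simp add: sums_iff)
    show "norm (pmf \<mu> l * mpow P l $ i $ j) \<le> pmf \<mu> l" for l
      using stochastic_le_1[OF stochastic_mpow[OF assms], of l i j] stochastic_mpow[OF assms, of l]
      by (simp add: stochastic_def mult_left_le)
  qed
  define R :: "real^'n^'n" where "R = (\<chi> i j. \<Sum>l. pmf \<mu> l * mpow P l $ i $ j)"
  have "(\<lambda>n. (\<Sum>l<n. pmf \<mu> l *\<^sub>R mpow P l)) \<longlonglongrightarrow> R"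
    using summable_LIMSEQ[OF summ] by (intro vec_tendstoI) (simp add: R_def sum_component)
  then have "subsampled \<mu> P = R"
    unfolding subsampled_def by (simp add: sums_def sums_unique[symmetric])
  then show ?thesis
    using summable_sums[OF summ] by (simp add: R_def)
qed

text \<open>Conditionally on the gaps up to index m, the observation times are constants and the
  past of the observed chain is an event about \<open>X\<close> at fixed times. The next gap is
  independent of this and has law \<mu>, so the transition matrix is the \<mu>-average of the powers
  of \<open>P\<close>.\<close>

lemma markov_chain_observed:
  fixes X :: "nat \<Rightarrow> 'a \<Rightarrow> 'n::finite"
  assumes "prob_space M" "stochastic P" "markov_chain M X P" "observation_times M X T \<mu>"
  shows "markov_chain M (observed X T) (subsampled \<mu> P)"
proof -
  interpret prob_space M by fact
  let ?Q = "subsampled \<mu> P"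
  have mono: "T k \<omega> \<le> T (Suc k) \<omega>" if "\<omega> \<in> space M" for k \<omega>
    using assms(4) that by (simp add: observation_times_def)
  have indep: "indep_vars (\<lambda>_. count_space UNIV) (gap T) UNIV"
    using assms(4) by (simp add: observation_times_def)
  have gap_law: "distr M (count_space UNIV) (gap T (Suc k)) = measure_pmf \<mu>" for k
    using assms(4) by (simp add: observation_times_def)
  let ?SG = "sets (vimage_algebra (space M) (\<lambda>\<omega> k. gap T k \<omega>) (\<Pi>\<^sub>M k\<in>UNIV. count_space UNIV))"
  let ?SX = "sets (vimage_algebra (space M) (\<lambda>\<omega> m. X m \<omega>) (\<Pi>\<^sub>M m\<in>UNIV. count_space UNIV))"
  have indep_TX: "indep_set ?SG ?SX"
    using assms(4) by (simp add: observation_times_def)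
  have [measurable]: "X k \<in> measurable M (count_space UNIV)" for k
    using assms(3) by (simp add: markov_chain_def)
  have [measurable]: "gap T k \<in> measurable M (count_space UNIV)" for k
    using indep by (simp add: indep_vars_def)
  have T_sum: "T k \<omega> = (\<Sum>i\<le>k. gap T i \<omega>)" if "\<omega> \<in> space M" for k \<omega>
  proof (induction k)
    case 0
    show ?case by (simp add: gap_def)
  next
    case (Suc k)
    have "T (Suc k) \<omega> = T k \<omega> + gap T (Suc k) \<omega>"
      using mono[OF that, of k] by (simp add: gap_def)
    then show ?case using Suc by simp
  qed
  have T_meas [measurable]: "T k \<in> measurable M (count_space UNIV)" for k
  proof -
    have "(\<lambda>\<omega>. \<Sum>i\<le>k. gap T i \<omega>) \<in> measurable M (count_space UNIV)" by measurable
    then show ?thesis by (subst measurable_cong[OF T_sum])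
  qed
  have Y_meas [measurable]: "observed X T k \<in> measurable M (count_space UNIV)" for k
    unfolding observed_def[abs_def]
    by (rule measurable_compose_countable[of "\<lambda>t \<omega>. X t \<omega>"]) measurable
  have step: "measure M ({\<omega> \<in> space M. \<forall>k\<le>m. observed X T k \<omega> = y k} \<inter> {\<omega> \<in> space M. observed X T (Suc m) \<omega> = j})
      = measure M {\<omega> \<in> space M. \<forall>k\<le>m. observed X T k \<omega> = y k} * ?Q $ y m $ j" for m y j
  proof -
    let ?F = "{\<omega> \<in> space M. \<forall>k\<le>m. observed X T k \<omega> = y k}"
    let ?E = "{\<omega> \<in> space M. observed X T (Suc m) \<omega> = j}"
    \<comment> \<open>The gap history as a list: lists of natural numbers are countable, so events
      can be split according to its value. Index 0, the initial time, is included.\<close>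
    define K where "K \<omega> = map (\<lambda>k. gap T k \<omega>) [0..<Suc m]" for \<omega>
    have K_eq: "{\<omega> \<in> space M. K \<omega> = \<tau>} =
        (if length \<tau> = Suc m then {\<omega> \<in> space M. \<forall>k\<le>m. gap T k \<omega> = \<tau> ! k} else {})" for \<tau>
      unfolding K_def list_eq_iff_nth_eq by (auto simp: less_Suc_eq_le simp del: upt_Suc)
    have [measurable]: "K \<in> measurable M (count_space UNIV)"
    proof (subst measurable_count_space_eq2_countable, intro conjI ballI)
      fix \<tau>
      have "K -` {\<tau>} \<inter> space M = {\<omega> \<in> space M. K \<omega> = \<tau>}" by auto
      also have "\<dots> \<in> sets M" unfolding K_eq by (cases "length \<tau> = Suc m") simp_all
      finally show "K -` {\<tau>} \<inter> space M \<in> sets M" .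
    qed auto
    let ?G = "\<lambda>\<tau>. {\<omega> \<in> space M. K \<omega> = \<tau>}"
    let ?L = "\<lambda>l. {\<omega> \<in> space M. gap T (Suc m) \<omega> = l}"
    \<comment> \<open>For fixed gaps the observations are the states of \<open>X\<close> at the
      deterministic times \<open>t k\<close>, and the probability factors into gap history, new gap
      and path of \<open>X\<close>.\<close>
    have joint: "measure M (?F \<inter> ?E \<inter> ?G \<tau> \<inter> ?L l) = measure M (?F \<inter> ?G \<tau>) * (pmf \<mu> l * mpow P l $ y m $ j)" for \<tau> l
    proof (cases "length \<tau> = Suc m")
      case True
      define t where "t k = (\<Sum>i\<le>k. \<tau> ! i)" for k
      have t_mono: "t k \<le> t m" if "k \<le> m" for k
        unfolding t_def using that by (intro sum_mono2) auto
      have T_t: "T k \<omega> = t k" if "\<omega> \<in> ?G \<tau>" "k \<le> m" for k \<omega>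
        using that True T_sum[of \<omega> k] unfolding K_eq t_def by simp
      have T_Suc: "T (Suc m) \<omega> = t m + l" if "\<omega> \<in> ?G \<tau>" "\<omega> \<in> ?L l" for \<omega>
        using T_t[OF that(1) order_refl] that T_sum[of \<omega> m] T_sum[of \<omega> "Suc m"] by simp
      let ?A = "{\<omega> \<in> space M. \<forall>k\<le>m. X (t k) \<omega> = y k}"
      let ?B = "{\<omega> \<in> space M. X (t m + l) \<omega> = j}"
      have SG1: "?G \<tau> \<inter> ?L l \<in> ?SG"
      proof -
        have "?G \<tau> \<inter> ?L l = (\<lambda>\<omega> k. gap T k \<omega>) -` {g \<in> space (\<Pi>\<^sub>M k\<in>UNIV. count_space UNIV). (\<forall>k\<le>m. g k = \<tau> ! k) \<and> g (Suc m) = l} \<inter> space M"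
          using True unfolding K_eq by (auto simp: space_PiM)
        then show ?thesis by (simp only:) (rule in_vimage_algebra, measurable)
      qed
      have SG2: "?G \<tau> \<in> ?SG"
      proof -
        have "?G \<tau> = (\<lambda>\<omega> k. gap T k \<omega>) -` {g \<in> space (\<Pi>\<^sub>M k\<in>UNIV. count_space UNIV). \<forall>k\<le>m. g k = \<tau> ! k} \<inter> space M"
          using True unfolding K_eq by (auto simp: space_PiM)
        then show ?thesis by (simp only:) (rule in_vimage_algebra, measurable)
      qed
      have SX1: "?A \<inter> ?B \<in> ?SX"
      proof -
        have "?A \<inter> ?B = (\<lambda>\<omega> k. X k \<omega>) -` {g \<in> space (\<Pi>\<^sub>M k\<in>UNIV. count_space UNIV). (\<forall>k\<le>m. g (t k) = y k) \<and> g (t m + l) = j} \<inter> space M"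
          by (auto simp: space_PiM)
        then show ?thesis by (simp only:) (rule in_vimage_algebra, measurable)
      qed
      have SX2: "?A \<in> ?SX"
      proof -
        have "?A = (\<lambda>\<omega> k. X k \<omega>) -` {g \<in> space (\<Pi>\<^sub>M k\<in>UNIV. count_space UNIV). \<forall>k\<le>m. g (t k) = y k} \<inter> space M"
          by (auto simp: space_PiM)
        then show ?thesis by (simp only:) (rule in_vimage_algebra, measurable)
      qed
      have "measure M (?A \<inter> ?B) = measure M ?A * mpow P l $ y m $ j"
      proof -
        have "past M X (t m) ?A"
          by (rule pastI) (use t_mono in auto)
        moreover have "?A \<inter> {\<omega> \<in> space M. X (t m) \<omega> = y m} = ?A" by auto
        ultimately show ?thesis
          using markov_steps[OF assms(1,3), of "t m" ?A "y m" l j] by simp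
      qed
      moreover have "measure M (?G \<tau> \<inter> ?L l) = measure M (?G \<tau>) * pmf \<mu> l"
      proof -
        \<comment> \<open>One family of sets describes both events: its indices up to m give the
          history, and index \<open>Suc m\<close> adds the new gap. The two product formulas then
          differ by a single factor.\<close>
        let ?a = "\<lambda>k. if k \<le> m then {\<tau> ! k} else {l}"
        have 1: "?G \<tau> = (\<Inter>k\<in>{..m}. gap T k -` ?a k \<inter> space M)"
          using True unfolding K_eq by auto
        have 2: "?G \<tau> \<inter> ?L l = (\<Inter>k\<in>{..Suc m}. gap T k -` ?a k \<inter> space M)"
          unfolding 1 by (auto simp: atMost_Suc)
        have "measure M (?L l) = pmf \<mu> l"
        proof -
          have "measure M (?L l) = measure (distr M (count_space UNIV) (gap T (Suc m))) {l}"
            by (subst measure_distr) (auto intro!: arg_cong[where f="measure M"])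
          then show ?thesis by (simp add: gap_law pmf.rep_eq)
        qed
        moreover have "gap T (Suc m) -` {l} \<inter> space M = ?L l" by auto
        moreover have "measure M (?G \<tau>) = (\<Prod>k\<in>{..m}. measure M (gap T k -` ?a k \<inter> space M))"
          unfolding 1 by (rule indep_varsD[OF indep]) auto
        moreover have "measure M (?G \<tau> \<inter> ?L l) = (\<Prod>k\<in>{..Suc m}. measure M (gap T k -` ?a k \<inter> space M))"
          unfolding 2 by (rule indep_varsD[OF indep]) auto
        ultimately show ?thesis by simp
      qed
      moreover have "?F \<inter> ?E \<inter> ?G \<tau> \<inter> ?L l = (?G \<tau> \<inter> ?L l) \<inter> (?A \<inter> ?B)"
        using T_t T_Suc by (auto simp: observed_def)
      moreover have "?F \<inter> ?G \<tau> = ?G \<tau> \<inter> ?A"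
        using T_t by (auto simp: observed_def)
      ultimately show ?thesis
        using indep_setD[OF indep_TX SG1 SX1] indep_setD[OF indep_TX SG2 SX2] by simp
    next
      case False
      then have "?G \<tau> = {}" unfolding K_eq by simp
      then show ?thesis by (simp only: Int_empty_right Int_empty_left measure_empty mult_zero_left)
    qed
    have nn: "0 \<le> pmf \<mu> l * mpow P l $ y m $ j" for l
      using stochastic_mpow[OF assms(2), of l] by (simp add: stochastic_def)
    note Q = subsampled_component[OF assms(2), of \<mu> "y m" j]
    \<comment> \<open>Summation over histories and over the new gap takes place in the extended
      nonnegative reals, where no summability has to be checked.\<close>
    have "emeasure M (?F \<inter> ?E) = (\<integral>\<^sup>+\<tau>. emeasure M (?F \<inter> ?E \<inter> ?G \<tau>) \<partial>count_space UNIV)"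
      by (rule emeasure_countable_split) measurable
    also have "\<dots> = (\<integral>\<^sup>+\<tau>. (\<integral>\<^sup>+l. emeasure M (?F \<inter> ?E \<inter> ?G \<tau> \<inter> ?L l) \<partial>count_space UNIV) \<partial>count_space UNIV)"
      by (intro nn_integral_cong emeasure_countable_split) measurable
    also have "\<dots> = (\<integral>\<^sup>+\<tau>. (\<integral>\<^sup>+l. emeasure M (?F \<inter> ?G \<tau>) * ennreal (pmf \<mu> l * mpow P l $ y m $ j) \<partial>count_space UNIV) \<partial>count_space UNIV)"
      by (simp only: emeasure_eq_measure joint) (simp add: ennreal_mult nn)
    also have "\<dots> = (\<integral>\<^sup>+\<tau>. emeasure M (?F \<inter> ?G \<tau>) * ennreal (?Q $ y m $ j) \<partial>count_space UNIV)"
      using Q nn by (simp add: nn_integral_cmult nn_integral_count_space_nat suminf_ennreal2 sums_iff)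
    also have "\<dots> = (\<integral>\<^sup>+\<tau>. emeasure M (?F \<inter> ?G \<tau>) \<partial>count_space UNIV) * ennreal (?Q $ y m $ j)"
      by (rule nn_integral_multc) simp
    also have "(\<integral>\<^sup>+\<tau>. emeasure M (?F \<inter> ?G \<tau>) \<partial>count_space UNIV) = emeasure M ?F"
      by (rule emeasure_countable_split[symmetric]) measurable
    finally have "emeasure M (?F \<inter> ?E) = emeasure M ?F * ennreal (?Q $ y m $ j)" .
    moreover have "0 \<le> ?Q $ y m $ j"
      using suminf_nonneg[OF sums_summable[OF Q] nn] sums_unique[OF Q] by simp
    ultimately show ?thesis
      by (simp add: emeasure_eq_measure ennreal_mult[symmetric])
  qed
  show ?thesis
    unfolding markov_chain_def
  proof (intro conjI allI impI)
    fix m y j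
    assume pos: "0 < measure M {\<omega> \<in> space M. \<forall>k\<le>m. observed X T k \<omega> = y k}"
    have "{\<omega> \<in> space M. observed X T (Suc m) \<omega> = j \<and> (\<forall>k\<le>m. observed X T k \<omega> = y k)} =
        {\<omega> \<in> space M. \<forall>k\<le>m. observed X T k \<omega> = y k} \<inter> {\<omega> \<in> space M. observed X T (Suc m) \<omega> = j}"
      by auto
    then show "\<P>(\<omega> in M. observed X T (Suc m) \<omega> = j \<bar> \<forall>k\<le>m. observed X T k \<omega> = y k) = ?Q $ y m $ j"
      unfolding cond_prob_def using pos by (simp add: step)
  qed (rule Y_meas)
qed

section \<open>Irreducibility and invariance of the subsampled chain\<close>

lemma mpow_entry_pos_trans:
  assumes "stochastic P" "0 < mpow P m $ i $ j" "0 < mpow P n $ j $ k"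
  shows "0 < mpow P (m + n) $ i $ k"
proof -
  have "0 \<le> mpow P m $ i $ a * mpow P n $ a $ k" for a
    using stochastic_mpow[OF assms(1)] by (simp add: stochastic_def)
  moreover have "0 < mpow P m $ i $ j * mpow P n $ j $ k" using assms by simp
  ultimately have "0 < (\<Sum>a\<in>UNIV. mpow P m $ i $ a * mpow P n $ a $ k)"
    by (intro sum_pos2[of UNIV j]) auto
  then show ?thesis by (simp add: mpow_add matrix_matrix_mult_def)
qed

text \<open>A positive entry of a power is a path in the graph of positive entries, and enlarging
  the graph keeps the path. It is applied to a power of \<open>P\<close> and to \<open>Q\<close>,
  whose graph contains the graph of that power.\<close>

lemma mpow_pos_mono:
  fixes A B :: "real^'n^'n"
  assumes A: "\<And>i j. 0 \<le> A $ i $ j" and B: "\<And>i j. 0 \<le> B $ i $ j"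
    and AB: "\<And>i j. 0 < A $ i $ j \<Longrightarrow> 0 < B $ i $ j"
    and pos: "0 < mpow A k $ i $ j"
  shows "0 < mpow B k $ i $ j"
proof -
  have nonneg: "0 \<le> mpow C k $ i $ j" if "\<And>i j. 0 \<le> C $ i $ j" for C :: "real^'n^'n" and k i j
  proof (induction k arbitrary: i j)
    case 0
    show ?case by (simp add: mpow_0 mat_def)
  next
    case (Suc k)
    show ?case
      unfolding mpow_Suc matrix_matrix_mult_def using that Suc by (simp add: sum_nonneg)
  qed
  show ?thesis
    using pos
  proof (induction k arbitrary: i j)
    case 0
    then show ?case by (simp add: mpow_0)
  next
    case (Suc k)
    then have "0 < (\<Sum>a\<in>UNIV. A $ i $ a * mpow A k $ a $ j)"
      by (simp add: mpow_Suc matrix_matrix_mult_def)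
    then obtain a where "0 < A $ i $ a * mpow A k $ a $ j"
      by (meson not_less sum_nonpos)
    then have "0 < A $ i $ a" "0 < mpow A k $ a $ j"
      using A[of i a] by (auto simp: zero_less_mult_iff)
    then have "0 < B $ i $ a * mpow B k $ a $ j"
      using AB Suc.IH by simp
    then have "0 < (\<Sum>a\<in>UNIV. B $ i $ a * mpow B k $ a $ j)"
      using B nonneg[OF B] by (intro sum_pos2[of UNIV a]) auto
    then show ?case by (simp add: mpow_Suc matrix_matrix_mult_def)
  qed
qed

lemma mpow_mpow: "mpow (mpow A l) k = mpow A (l * k)"
  by (induction k) (simp_all add: mpow_0 mpow_Suc mpow_add[symmetric])

text \<open>As for ideals of the integers, the least positive difference g of two elements of
  \<open>R\<close> divides all elements, so g = 1. One copy of b + 1 and l - 1 copies of b then sum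
  to l b + 1.\<close>

lemma additive_nat_set_residue:
  fixes R :: "nat set"
  assumes add: "\<And>a b. a \<in> R \<Longrightarrow> b \<in> R \<Longrightarrow> a + b \<in> R" and "0 \<in> R"
    and gcd: "Gcd {m. 0 < m \<and> m \<in> R} = 1" and "1 \<le> l"
  obtains s where "l * s + 1 \<in> R"
proof -
  have mult: "n * a \<in> R" if "a \<in> R" for n a
    using that by (induction n) (auto intro: add \<open>0 \<in> R\<close>)
  define D where "D = {n. \<exists>r\<in>R. \<exists>s\<in>R. r = s + n}"
  have "{m. 0 < m \<and> m \<in> R} \<noteq> {}"
  proof
    assume "{m. 0 < m \<and> m \<in> R} = {}"
    then show False using gcd by (simp only: Gcd_empty)
  qed
  then obtain r0 where r0: "0 < r0" "r0 \<in> R" by auto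
  then have ex: "0 < r0 \<and> r0 \<in> D" using \<open>0 \<in> R\<close> by (auto simp: D_def)
  define g where "g = (LEAST n. 0 < n \<and> n \<in> D)"
  have g: "0 < g" "g \<in> D" and least: "\<And>n. 0 < n \<Longrightarrow> n \<in> D \<Longrightarrow> g \<le> n"
    unfolding g_def using LeastI[of "\<lambda>n. 0 < n \<and> n \<in> D", OF ex] by (auto intro: Least_le)
  obtain a b where ab: "a \<in> R" "b \<in> R" "a = b + g" using g(2) by (auto simp: D_def)
  have "g dvd r" if "r \<in> R" for r
  proof -
    \<comment> \<open>Division by g = a - b without subtraction: the identity exhibits
      \<open>r mod g\<close> as a difference of two elements of \<open>R\<close>, and minimality of
      g makes it 0.\<close>
    have "r + (r div g) * b = (r div g) * a + r mod g"
      using div_mult_mod_eq[of r g] unfolding ab(3) by (simp only: distrib_left)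
    moreover have "r + (r div g) * b \<in> R" "(r div g) * a \<in> R"
      by (auto intro!: add mult that ab)
    ultimately have "r mod g \<in> D" unfolding D_def by blast
    moreover have "r mod g < g" using g(1) by simp
    ultimately have "r mod g = 0" using least[of "r mod g"] by fastforce
    then show ?thesis by (simp add: dvd_eq_mod_eq_0)
  qed
  then have "g dvd Gcd {m. 0 < m \<and> m \<in> R}" by (intro Gcd_greatest) auto
  then have "g = 1" using gcd by simp
  have "a + (l - 1) * b \<in> R" by (intro add mult ab)
  moreover have "a + (l - 1) * b = l * b + 1"
    using \<open>1 \<le> l\<close> ab(3) \<open>g = 1\<close> by (cases l) auto
  ultimately show ?thesis using that by metis
qed

text \<open>A path from i to j of length m is prolonged by loops at j. Aperiodicity provides a loop
  of length 1 modulo l, and m (l - 1) copies of it make the total length divisible by l.\<close>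

lemma irreducible_mpow:
  assumes st: "stochastic P" and irr: "irreducible_chain P" and aper: "aperiodic_chain P" and "1 \<le> l"
  shows "irreducible_chain (mpow P l)"
  unfolding irreducible_chain_def
proof (intro allI)
  fix i j
  define R where "R = {m. 0 < mpow P m $ j $ j}"
  obtain m where m: "0 < mpow P m $ i $ j"
    using irr unfolding irreducible_chain_def by blast
  have add: "a + b \<in> R" if "a \<in> R" "b \<in> R" for a b
    using that mpow_entry_pos_trans[OF st, of a j j b j] by (simp add: R_def)
  have 0: "0 \<in> R" by (simp add: R_def mpow_0 mat_def)
  have "Gcd {m. 0 < m \<and> m \<in> R} = 1"
    using aper by (simp add: R_def aperiodic_chain_def)
  with add 0 obtain s where s: "l * s + 1 \<in> R"
    using additive_nat_set_residue[of R l] \<open>1 \<le> l\<close> by blast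
  have mult: "n * a \<in> R" if "a \<in> R" for n a
    using that by (induction n) (auto intro: add 0)
  have "(m * (l - 1)) * (l * s + 1) \<in> R" by (rule mult[OF s])
  then have "0 < mpow P (m + (m * (l - 1)) * (l * s + 1)) $ i $ j"
    using mpow_entry_pos_trans[OF st m] by (simp add: R_def)
  moreover have "m + (m * (l - 1)) * (l * s + 1) = l * (m + m * (l - 1) * s)"
    using \<open>1 \<le> l\<close> by (cases l) (auto simp: algebra_simps)
  ultimately have "0 < mpow (mpow P l) (m + m * (l - 1) * s) $ i $ j"
    by (simp add: mpow_mpow)
  then show "\<exists>k. 0 < mpow (mpow P l) k $ i $ j" by blast
qed

lemma stochastic_subsampled:
  fixes P :: "real^'n^'n"
  assumes "stochastic P"
  shows "stochastic (subsampled \<mu> P)"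
  unfolding stochastic_def
proof (intro conjI allI)
  note Q = subsampled_component[OF assms, of \<mu>]
  show "0 \<le> subsampled \<mu> P $ i $ j" for i j
    using sums_le[OF _ sums_zero Q[of i j]] stochastic_mpow[OF assms] by (simp add: stochastic_def)
  fix i
  have "(\<lambda>l. \<Sum>j\<in>UNIV. pmf \<mu> l * mpow P l $ i $ j) sums (\<Sum>j\<in>UNIV. subsampled \<mu> P $ i $ j)"
    by (intro sums_sum Q)
  moreover have "(\<Sum>j\<in>UNIV. pmf \<mu> l * mpow P l $ i $ j) = pmf \<mu> l" for l
    using stochastic_mpow[OF assms, of l] by (simp add: sum_distrib_left[symmetric] stochastic_def)
  ultimately show "(\<Sum>j\<in>UNIV. subsampled \<mu> P $ i $ j) = 1"
    using sums_unique2[OF _ pmf_nat_sums] by simp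
qed

lemma irreducible_subsampled:
  assumes "stochastic P" "irreducible_chain P" "aperiodic_chain P" "1 \<le> l" "0 < pmf \<mu> l"
  shows "irreducible_chain (subsampled \<mu> P)"
  unfolding irreducible_chain_def
proof (intro allI)
  fix i j
  obtain k where k: "0 < mpow (mpow P l) k $ i $ j"
    using irreducible_mpow[OF assms(1-4)] unfolding irreducible_chain_def by blast
  have nn: "0 \<le> mpow P l $ i $ j" for l i j
    using stochastic_mpow[OF assms(1)] by (simp add: stochastic_def)
  have "0 < subsampled \<mu> P $ i $ j" if "0 < mpow P l $ i $ j" for i j
  proof -
    note Q = subsampled_component[OF assms(1), of \<mu> i j]
    have "0 < pmf \<mu> l * mpow P l $ i $ j" using that assms(5) by simp
    also have "\<dots> \<le> (\<Sum>l. pmf \<mu> l * mpow P l $ i $ j)"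
      using sum_le_suminf[OF sums_summable[OF Q], of "{l}"] nn by simp
    finally show ?thesis using sums_unique[OF Q] by simp
  qed
  moreover have "0 \<le> subsampled \<mu> P $ i $ j" for i j
    using stochastic_subsampled[OF assms(1)] by (simp add: stochastic_def)
  ultimately have "0 < mpow (subsampled \<mu> P) k $ i $ j"
    by (intro mpow_pos_mono[OF nn _ _ k]) auto
  then show "\<exists>k. 0 < mpow (subsampled \<mu> P) k $ i $ j" by blast
qed

lemma vector_mpow_fixed:
  fixes A :: "real^'n^'n"
  assumes "x v* A = x"
  shows "x v* mpow A k = x"
  by (induction k) (simp_all add: mpow_0 mpow_Suc vector_matrix_mul_assoc[symmetric] assms)

lemma invariant_subsampled:
  fixes P :: "real^'n^'n"
  assumes "stochastic P" "invariant_distribution P \<pi>"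
  shows "invariant_distribution (subsampled \<mu> P) \<pi>"
proof -
  have "(\<pi> v* subsampled \<mu> P) $ j = \<pi> $ j" for j
  proof -
    have "(\<lambda>l. \<Sum>i\<in>UNIV. \<pi> $ i * (pmf \<mu> l * mpow P l $ i $ j)) sums (\<Sum>i\<in>UNIV. \<pi> $ i * subsampled \<mu> P $ i $ j)"
      by (intro sums_sum sums_mult subsampled_component assms)
    moreover have "(\<Sum>i\<in>UNIV. \<pi> $ i * (pmf \<mu> l * mpow P l $ i $ j)) = pmf \<mu> l * \<pi> $ j" for l
    proof -
      have "\<pi> v* mpow P l = \<pi>"
        using assms(2) by (intro vector_mpow_fixed) (simp add: invariant_distribution_def)
      then have "(\<Sum>i\<in>UNIV. \<pi> $ i * mpow P l $ i $ j) = \<pi> $ j"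
        by (simp add: vec_eq_iff vector_matrix_mult_def mult.commute)
      moreover have "(\<Sum>i\<in>UNIV. \<pi> $ i * (pmf \<mu> l * mpow P l $ i $ j)) = pmf \<mu> l * (\<Sum>i\<in>UNIV. \<pi> $ i * mpow P l $ i $ j)"
        by (simp add: sum_distrib_left mult.left_commute)
      ultimately show ?thesis by simp
    qed
    moreover have "(\<lambda>l. pmf \<mu> l * \<pi> $ j) sums (1 * \<pi> $ j)"
      by (intro sums_mult2 pmf_nat_sums)
    ultimately have "(\<Sum>i\<in>UNIV. \<pi> $ i * subsampled \<mu> P $ i $ j) = \<pi> $ j"
      using sums_unique2 by fastforce
    then show ?thesis by (simp add: vector_matrix_mult_def mult.commute)
  qed
  then show ?thesis
    using assms(2) by (simp add: invariant_distribution_def vec_eq_iff)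
qed

lemma invariant_distribution_pos:
  fixes P :: "real^'n^'n"
  assumes "stochastic P" "irreducible_chain P" "invariant_distribution P \<pi>"
  shows "0 < \<pi> $ j"
proof -
  have nn: "0 \<le> \<pi> $ i" for i using assms(3) by (simp add: invariant_distribution_def)
  have "(\<Sum>i\<in>UNIV. \<pi> $ i) = 1" using assms(3) by (simp add: invariant_distribution_def)
  then have "\<exists>i. \<pi> $ i \<noteq> 0" by (metis sum.neutral zero_neq_one)
  then obtain i where i: "0 < \<pi> $ i" using nn by (metis less_eq_real_def)
  obtain m where m: "0 < mpow P m $ i $ j"
    using assms(2) unfolding irreducible_chain_def by blast
  have "\<pi> v* mpow P m = \<pi>"
    using assms(3) by (intro vector_mpow_fixed) (simp add: invariant_distribution_def)
  then have "\<pi> $ j = (\<Sum>i\<in>UNIV. \<pi> $ i * mpow P m $ i $ j)"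
    by (simp add: vec_eq_iff vector_matrix_mult_def mult.commute)
  also have "0 < \<dots>"
    using i m nn stochastic_mpow[OF assms(1), of m]
    by (intro sum_pos2[of UNIV i]) (auto simp: stochastic_def)
  finally show ?thesis .
qed

section \<open>Additive functionals of a finite Markov chain\<close>

text \<open>The counterpart of \<open>past\<close> for functions. Such a function takes finitely
  many values, so measurability and integrability are automatic for every functional of the path
  used below.\<close>

definition past_fun :: "'a measure \<Rightarrow> (nat \<Rightarrow> 'a \<Rightarrow> 'n) \<Rightarrow> nat \<Rightarrow> ('a \<Rightarrow> 'c) \<Rightarrow> bool" where
  "past_fun M Y m G \<longleftrightarrow> (\<forall>\<omega>\<in>space M. \<forall>\<omega>'\<in>space M. (\<forall>k\<le>m. Y k \<omega> = Y k \<omega>') \<longrightarrow> G \<omega> = G \<omega>')"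

lemma past_funI:
  assumes "\<And>\<omega> \<omega>'. (\<And>k. k \<le> m \<Longrightarrow> Y k \<omega> = Y k \<omega>') \<Longrightarrow> G \<omega> = G \<omega>'"
  shows "past_fun M Y m G"
  unfolding past_fun_def using assms by blast

lemma past_fun_vimage:
  assumes "past_fun M Y m G"
  shows "past M Y m {\<omega> \<in> space M. G \<omega> = v}"
proof (rule pastI)
  fix \<omega> \<omega>'
  assume "\<omega> \<in> space M" "\<omega>' \<in> space M" "\<And>k. k \<le> m \<Longrightarrow> Y k \<omega> = Y k \<omega>'" "\<omega> \<in> {\<omega> \<in> space M. G \<omega> = v}"
  moreover from this have "G \<omega> = G \<omega>'" using assms unfolding past_fun_def by blast
  ultimately show "\<omega>' \<in> {\<omega> \<in> space M. G \<omega> = v}" by simp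
qed auto

lemma past_fun_finite_range:
  fixes Y :: "nat \<Rightarrow> 'a \<Rightarrow> 'n::finite"
  assumes "past_fun M Y m G"
  shows "finite (G ` space M)"
proof -
  define r where "r \<omega> = restrict (\<lambda>k. Y k \<omega>) {..m}" for \<omega>
  have "r ` space M \<subseteq> PiE {..m} (\<lambda>_. UNIV)"
    unfolding r_def by (auto split: if_splits)
  then have fin: "finite (r ` space M)"
    by (rule finite_subset) (simp add: finite_PiE)
  \<comment> \<open>\<open>G\<close> factors through the restricted path, by choosing one outcome
    for each path that occurs.\<close>
  have "G \<omega> = G (inv_into (space M) r (r \<omega>))" if "\<omega> \<in> space M" for \<omega>
  proof -
    let ?u = "inv_into (space M) r (r \<omega>)"
    have u: "r ?u = r \<omega>" "?u \<in> space M"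
      using that by (auto intro: f_inv_into_f inv_into_into)
    have "\<forall>k\<le>m. Y k \<omega> = Y k ?u"
    proof (intro allI impI)
      fix k
      assume "k \<le> m"
      then show "Y k \<omega> = Y k ?u" using fun_cong[OF u(1), of k] by (simp add: r_def)
    qed
    with assms that u(2) show ?thesis unfolding past_fun_def by blast
  qed
  then have "G ` space M \<subseteq> (\<lambda>x. G (inv_into (space M) r x)) ` r ` space M"
    by blast
  with fin show ?thesis by (meson finite_imageI finite_subset)
qed

locale finite_chain = prob_space M for M :: "'a measure" +
  fixes Y :: "nat \<Rightarrow> 'a \<Rightarrow> 'n::finite" and Q :: "real^'n^'n"
  assumes chain: "markov_chain M Y Q" and stoch: "stochastic Q"
begin

lemma Y_measurable [measurable]: "Y m \<in> measurable M (count_space UNIV)"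
  using chain by (simp add: markov_chain_def)

lemma Q_nonneg: "0 \<le> Q $ i $ j" and Q_sum: "(\<Sum>j\<in>UNIV. Q $ i $ j) = 1"
  using stoch by (simp_all add: stochastic_def)

lemma past_fun_measurable:
  fixes G :: "'a \<Rightarrow> 'c::topological_space"
  assumes "past_fun M Y m G"
  shows "G \<in> borel_measurable M"
proof (rule measurableI)
  fix A :: "'c set"
  have "G -` A \<inter> space M = (\<Union>v\<in>G ` space M \<inter> A. {\<omega> \<in> space M. G \<omega> = v})" by auto
  also have "\<dots> \<in> sets M"
    using past_fun_finite_range[OF assms] past_event[OF prob_space_axioms chain past_fun_vimage[OF assms]]
    by (intro sets.finite_UN) auto
  finally show "G -` A \<inter> space M \<in> sets M" .
qed simp

lemma past_fun_integrable:
  fixes G :: "'a \<Rightarrow> 'c::{banach, second_countable_topology}"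
  assumes "past_fun M Y m G"
  shows "integrable M G"
proof (rule integrable_const_bound)
  show "AE \<omega> in M. norm (G \<omega>) \<le> (\<Sum>v\<in>G ` space M. norm v)"
    using past_fun_finite_range[OF assms] by (intro AE_I2 member_le_sum[of _ _ norm]) auto
qed (rule past_fun_measurable[OF assms])

text \<open>The event \<open>A\<close> may involve the next state, so that the resulting finite sum
  of probabilities is in the form to which \<open>markov_step\<close> applies.\<close>

lemma past_fun_integral:
  fixes G :: "'a \<Rightarrow> 'c::{banach, second_countable_topology}"
  assumes "past_fun M Y m G" and A [measurable]: "A \<in> sets M"
  shows "(\<integral>\<omega>. indicator A \<omega> *\<^sub>R G \<omega> \<partial>M) = (\<Sum>v\<in>G ` space M. measure M ({\<omega> \<in> space M. G \<omega> = v} \<inter> A) *\<^sub>R v)"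
proof -
  note fin = past_fun_finite_range[OF assms(1)]
  have ev: "{\<omega> \<in> space M. G \<omega> = v} \<in> sets M" for v
    by (rule past_event[OF prob_space_axioms chain past_fun_vimage[OF assms(1)]])
  have "(\<integral>\<omega>. indicator A \<omega> *\<^sub>R G \<omega> \<partial>M) =
      (\<integral>\<omega>. (\<Sum>v\<in>G ` space M. indicator ({\<omega> \<in> space M. G \<omega> = v} \<inter> A) \<omega> *\<^sub>R v) \<partial>M)"
  proof (rule Bochner_Integration.integral_cong[OF refl])
    fix \<omega>
    assume \<omega>: "\<omega> \<in> space M"
    have "(\<Sum>v\<in>G ` space M. indicator ({\<omega> \<in> space M. G \<omega> = v} \<inter> A) \<omega> *\<^sub>R v) =
        (\<Sum>v\<in>G ` space M. if v = G \<omega> then indicator A \<omega> *\<^sub>R G \<omega> else 0)"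
      using \<omega> by (intro sum.cong) (auto simp: indicator_def)
    also have "\<dots> = indicator A \<omega> *\<^sub>R G \<omega>"
      using \<omega> fin by (simp add: sum.delta)
    finally show "indicator A \<omega> *\<^sub>R G \<omega> = (\<Sum>v\<in>G ` space M. indicator ({\<omega> \<in> space M. G \<omega> = v} \<inter> A) \<omega> *\<^sub>R v)" by simp
  qed
  also have "\<dots> = (\<Sum>v\<in>G ` space M. measure M ({\<omega> \<in> space M. G \<omega> = v} \<inter> A) *\<^sub>R v)"
    using ev by (subst Bochner_Integration.integral_sum) (auto intro!: integrable_scaleR_left simp: emeasure_eq_measure)
  finally show ?thesis .
qed

text \<open>The Markov property as a conditional expectation given the past, written without one:
  integrals become finite sums over the values of \<open>G\<close> and over states. The values lie
  in a normed algebra because the rule serves real second moments as well as complex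
  exponentials.\<close>

lemma expectation_step:
  fixes G :: "'a \<Rightarrow> 'c::{real_normed_algebra_1, banach, second_countable_topology}"
  assumes G: "past_fun M Y m G"
  shows "(\<integral>\<omega>. G \<omega> * h (Y m \<omega>) (Y (Suc m) \<omega>) \<partial>M) =
    (\<integral>\<omega>. G \<omega> * (\<Sum>j\<in>UNIV. Q $ Y m \<omega> $ j *\<^sub>R h (Y m \<omega>) j) \<partial>M)"
proof -
  let ?S = "\<lambda>k i. {\<omega> \<in> space M. Y k \<omega> = i}"
  have Gi: "past_fun M Y m (\<lambda>\<omega>. G \<omega> * h (Y m \<omega>) j)" for j
    using G unfolding past_fun_def by (metis order_refl)
  have int: "integrable M (\<lambda>\<omega>. indicator A \<omega> *\<^sub>R (G \<omega> * h (Y m \<omega>) j))" if [measurable]: "A \<in> sets M" for A j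
    using past_fun_integrable[OF Gi[of j]] by (intro integrable_mult_indicator) auto
  have single: "(\<integral>\<omega>. indicator (?S (Suc m) j) \<omega> *\<^sub>R (G \<omega> * h (Y m \<omega>) j) \<partial>M) =
      (\<integral>\<omega>. Q $ Y m \<omega> $ j *\<^sub>R (G \<omega> * h (Y m \<omega>) j) \<partial>M)" for j
  proof -
    let ?G = "\<lambda>\<omega>. G \<omega> * h (Y m \<omega>) j"
    \<comment> \<open>Used in both directions: first to turn the transition probability into the
      constant \<open>Q $ i $ j\<close>, then to reassemble
      \<open>Q $ Y m \<omega> $ j\<close>.\<close>
    have split: "(\<integral>\<omega>. f \<omega> *\<^sub>R ?G \<omega> \<partial>M) = (\<Sum>i\<in>UNIV. \<integral>\<omega>. (f \<omega> * indicator (?S m i) \<omega>) *\<^sub>R ?G \<omega> \<partial>M)"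
      if "integrable M (\<lambda>\<omega>. f \<omega> *\<^sub>R ?G \<omega>)" for f :: "'a \<Rightarrow> real"
    proof -
      have "(\<integral>\<omega>. f \<omega> *\<^sub>R ?G \<omega> \<partial>M) = (\<integral>\<omega>. (\<Sum>i\<in>UNIV. indicator (?S m i) \<omega> *\<^sub>R (f \<omega> *\<^sub>R ?G \<omega>)) \<partial>M)"
      proof (rule Bochner_Integration.integral_cong[OF refl])
        fix \<omega>
        assume "\<omega> \<in> space M"
        then have "indicator (?S m i) \<omega> *\<^sub>R (f \<omega> *\<^sub>R ?G \<omega>) = (if Y m \<omega> = i then f \<omega> *\<^sub>R ?G \<omega> else 0)" for i
          by (simp add: indicator_def)
        then show "f \<omega> *\<^sub>R ?G \<omega> = (\<Sum>i\<in>UNIV. indicator (?S m i) \<omega> *\<^sub>R (f \<omega> *\<^sub>R ?G \<omega>))"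
          by simp
      qed
      also have "\<dots> = (\<Sum>i\<in>UNIV. \<integral>\<omega>. indicator (?S m i) \<omega> *\<^sub>R (f \<omega> *\<^sub>R ?G \<omega>) \<partial>M)"
        using that by (intro Bochner_Integration.integral_sum integrable_mult_indicator) auto
      finally show ?thesis by (simp add: mult.commute)
    qed
    have "(\<integral>\<omega>. indicator (?S (Suc m) j) \<omega> *\<^sub>R ?G \<omega> \<partial>M) =
        (\<Sum>i\<in>UNIV. \<integral>\<omega>. (indicator (?S (Suc m) j) \<omega> * indicator (?S m i) \<omega>) *\<^sub>R ?G \<omega> \<partial>M)"
      by (intro split int) auto
    also have "\<dots> = (\<Sum>i\<in>UNIV. \<integral>\<omega>. indicator (?S (Suc m) j \<inter> ?S m i) \<omega> *\<^sub>R ?G \<omega> \<partial>M)"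
      by (simp add: indicator_inter_arith)
    also have "\<dots> = (\<Sum>i\<in>UNIV. Q $ i $ j *\<^sub>R (\<integral>\<omega>. indicator (?S m i) \<omega> *\<^sub>R ?G \<omega> \<partial>M))"
    proof (intro sum.cong refl)
      fix i
      have "measure M ({\<omega> \<in> space M. ?G \<omega> = v} \<inter> (?S (Suc m) j \<inter> ?S m i)) =
          Q $ i $ j * measure M ({\<omega> \<in> space M. ?G \<omega> = v} \<inter> ?S m i)" for v
      proof -
        have "{\<omega> \<in> space M. ?G \<omega> = v} \<inter> (?S (Suc m) j \<inter> ?S m i) = {\<omega> \<in> space M. ?G \<omega> = v} \<inter> ?S m i \<inter> ?S (Suc m) j"
          by auto
        then show ?thesis
          using markov_step[OF prob_space_axioms chain past_fun_vimage[OF Gi[of j], of v], of i j]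
          by (simp add: mult.commute)
      qed
      then show "(\<integral>\<omega>. indicator (?S (Suc m) j \<inter> ?S m i) \<omega> *\<^sub>R ?G \<omega> \<partial>M) =
          Q $ i $ j *\<^sub>R (\<integral>\<omega>. indicator (?S m i) \<omega> *\<^sub>R ?G \<omega> \<partial>M)"
        by (simp add: past_fun_integral[OF Gi] scaleR_sum_right)
    qed
    also have "\<dots> = (\<Sum>i\<in>UNIV. \<integral>\<omega>. (Q $ Y m \<omega> $ j * indicator (?S m i) \<omega>) *\<^sub>R ?G \<omega> \<partial>M)"
    proof (intro sum.cong refl)
      fix i
      have "Q $ i $ j *\<^sub>R (\<integral>\<omega>. indicator (?S m i) \<omega> *\<^sub>R ?G \<omega> \<partial>M) = (\<integral>\<omega>. Q $ i $ j *\<^sub>R (indicator (?S m i) \<omega> *\<^sub>R ?G \<omega>) \<partial>M)"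
        by (rule integral_scaleR_right[symmetric])
      also have "\<dots> = (\<integral>\<omega>. (Q $ Y m \<omega> $ j * indicator (?S m i) \<omega>) *\<^sub>R ?G \<omega> \<partial>M)"
        by (intro Bochner_Integration.integral_cong) (auto simp: indicator_def)
      finally show "Q $ i $ j *\<^sub>R (\<integral>\<omega>. indicator (?S m i) \<omega> *\<^sub>R ?G \<omega> \<partial>M) = (\<integral>\<omega>. (Q $ Y m \<omega> $ j * indicator (?S m i) \<omega>) *\<^sub>R ?G \<omega> \<partial>M)" .
    qed
    also have "\<dots> = (\<integral>\<omega>. Q $ Y m \<omega> $ j *\<^sub>R ?G \<omega> \<partial>M)"
    proof (rule split[symmetric], rule past_fun_integrable)
      show "past_fun M Y m (\<lambda>\<omega>. Q $ Y m \<omega> $ j *\<^sub>R ?G \<omega>)"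
        using G unfolding past_fun_def by (metis order_refl)
    qed
    finally show ?thesis .
  qed
  have "(\<integral>\<omega>. G \<omega> * h (Y m \<omega>) (Y (Suc m) \<omega>) \<partial>M) =
      (\<integral>\<omega>. (\<Sum>j\<in>UNIV. indicator (?S (Suc m) j) \<omega> *\<^sub>R (G \<omega> * h (Y m \<omega>) j)) \<partial>M)"
  proof (rule Bochner_Integration.integral_cong[OF refl])
    fix \<omega>
    assume "\<omega> \<in> space M"
    then have "indicator (?S (Suc m) j) \<omega> *\<^sub>R (G \<omega> * h (Y m \<omega>) j) =
        (if Y (Suc m) \<omega> = j then G \<omega> * h (Y m \<omega>) j else 0)" for j
      by (simp add: indicator_def)
    then show "G \<omega> * h (Y m \<omega>) (Y (Suc m) \<omega>) = (\<Sum>j\<in>UNIV. indicator (?S (Suc m) j) \<omega> *\<^sub>R (G \<omega> * h (Y m \<omega>) j))"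
      by simp
  qed
  also have "\<dots> = (\<Sum>j\<in>UNIV. \<integral>\<omega>. indicator (?S (Suc m) j) \<omega> *\<^sub>R (G \<omega> * h (Y m \<omega>) j) \<partial>M)"
    by (intro Bochner_Integration.integral_sum int) auto
  also have "\<dots> = (\<Sum>j\<in>UNIV. \<integral>\<omega>. Q $ Y m \<omega> $ j *\<^sub>R (G \<omega> * h (Y m \<omega>) j) \<partial>M)"
    by (simp only: single)
  also have "\<dots> = (\<integral>\<omega>. (\<Sum>j\<in>UNIV. Q $ Y m \<omega> $ j *\<^sub>R (G \<omega> * h (Y m \<omega>) j)) \<partial>M)"
  proof (rule Bochner_Integration.integral_sum[symmetric], rule past_fun_integrable)
    fix j
    show "past_fun M Y m (\<lambda>\<omega>. Q $ Y m \<omega> $ j *\<^sub>R (G \<omega> * h (Y m \<omega>) j))"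
      using G unfolding past_fun_def by (metis order_refl)
  qed
  finally show ?thesis by (simp add: sum_distrib_left)
qed

text \<open>The index range is that of the empirical matrix: there are n - 1 increments, none for n
  \<le> 1, and the last state involved is \<open>Y n\<close>.\<close>

definition msum :: "('n \<Rightarrow> 'n \<Rightarrow> real) \<Rightarrow> nat \<Rightarrow> 'a \<Rightarrow> real" where
  "msum g n \<omega> = (\<Sum>k\<in>{1..<n}. g (Y k \<omega>) (Y (Suc k) \<omega>))"

lemma msum_past: "past_fun M Y n (\<lambda>\<omega>. F (msum g n \<omega>) (Y n \<omega>))"
proof (rule past_funI)
  fix \<omega> \<omega>'
  assume *: "\<And>k. k \<le> n \<Longrightarrow> Y k \<omega> = Y k \<omega>'"
  have "msum g n \<omega> = msum g n \<omega>'"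
    unfolding msum_def using * by (intro sum.cong) auto
  with *[of n] show "F (msum g n \<omega>) (Y n \<omega>) = F (msum g n \<omega>') (Y n \<omega>')" by simp
qed

lemma msum_Suc: "1 \<le> n \<Longrightarrow> msum g (Suc n) \<omega> = msum g n \<omega> + g (Y n \<omega>) (Y (Suc n) \<omega>)"
  by (simp add: msum_def)

lemma msum_measurable [measurable]: "msum g n \<in> borel_measurable M"
  using past_fun_measurable[OF msum_past[of n "\<lambda>s _. s" g]] by simp

text \<open>Martingale increments are orthogonal: the cross term vanishes by
  \<open>expectation_step\<close>, and each increment contributes at most the square of
  \<open>c\<close>.\<close>

lemma msum_second_moment:
  assumes mart: "\<And>i. (\<Sum>j\<in>UNIV. Q $ i $ j * g i j) = 0" and bound: "\<And>i j. \<bar>g i j\<bar> \<le> c"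
  shows "(\<integral>\<omega>. (msum g n \<omega>)\<^sup>2 \<partial>M) \<le> real n * c\<^sup>2"
proof (induction n)
  case 0
  show ?case by (simp add: msum_def)
next
  case (Suc n)
  have "0 \<le> c" using bound[of undefined undefined] by linarith
  show ?case
  proof (cases "n = 0")
    case True
    then show ?thesis by (simp add: msum_def)
  next
    case False
    let ?g = "\<lambda>\<omega>. g (Y n \<omega>) (Y (Suc n) \<omega>)"
    have i1: "integrable M (\<lambda>\<omega>. (msum g n \<omega>)\<^sup>2)"
      by (rule past_fun_integrable[OF msum_past])
    have past2: "past_fun M Y (Suc n) (\<lambda>\<omega>. f (msum g n \<omega>) (Y n \<omega>) (Y (Suc n) \<omega>))" for f :: "real \<Rightarrow> 'n \<Rightarrow> 'n \<Rightarrow> real"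
      using msum_past[of n "\<lambda>s y. (s, y)" g] unfolding past_fun_def
      by (metis (no_types, lifting) le_Suc_eq order_refl prod.inject)
    have i2: "integrable M (\<lambda>\<omega>. 2 * (msum g n \<omega> * ?g \<omega>))"
      by (rule past_fun_integrable[OF past2])
    have i3: "integrable M (\<lambda>\<omega>. (?g \<omega>)\<^sup>2)"
      by (rule past_fun_integrable[OF past2])
    have "(\<integral>\<omega>. (msum g (Suc n) \<omega>)\<^sup>2 \<partial>M) = (\<integral>\<omega>. (msum g n \<omega>)\<^sup>2 + 2 * (msum g n \<omega> * ?g \<omega>) + (?g \<omega>)\<^sup>2 \<partial>M)"
      using False by (simp add: msum_Suc power2_sum algebra_simps)
    also have "\<dots> = (\<integral>\<omega>. (msum g n \<omega>)\<^sup>2 \<partial>M) + 2 * (\<integral>\<omega>. msum g n \<omega> * ?g \<omega> \<partial>M) + (\<integral>\<omega>. (?g \<omega>)\<^sup>2 \<partial>M)"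
      using i1 i2 i3 by simp
    also have "(\<integral>\<omega>. msum g n \<omega> * ?g \<omega> \<partial>M) = 0"
      using expectation_step[OF msum_past[of n "\<lambda>s _. s" g], of g] by (simp add: mart)
    also have "(\<integral>\<omega>. (?g \<omega>)\<^sup>2 \<partial>M) \<le> (\<integral>\<omega>. c\<^sup>2 \<partial>M)"
      using i3 bound \<open>0 \<le> c\<close> by (intro integral_mono) (auto simp: abs_le_square_iff[symmetric])
    finally show ?thesis
      using Suc by (simp add: prob_space algebra_simps)
  qed
qed

end

section \<open>Harmonic functions and the Poisson equation\<close>

lemma mpow_fixed:
  assumes "A *v h = h"
  shows "mpow A k *v h = h"
  by (induction k) (simp_all add: mpow_0 mpow_Suc matrix_vector_mul_assoc[symmetric] assms)

text \<open>The maximum principle. At a maximiser a, the value of h is an average of values of h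
  under a row of some power of \<open>Q\<close> that gives positive weight to j, so h must be
  maximal at j too.\<close>

lemma harmonic_const:
  fixes Q :: "real^'n^'n"
  assumes "stochastic Q" "irreducible_chain Q" "Q *v h = h"
  shows "h $ j = h $ i"
proof -
  have "Max (range (\<lambda>i. h $ i)) \<in> range (\<lambda>i. h $ i)" by (rule Max_in) auto
  then obtain a where a: "h $ a = Max (range (\<lambda>i. h $ i))" by (metis rangeE)
  have le: "h $ j \<le> h $ a" for j unfolding a by (intro Max_ge) auto
  have eq: "h $ j = h $ a" for j
  proof -
    obtain m where m: "0 < mpow Q m $ a $ j"
      using assms(2) unfolding irreducible_chain_def by blast
    have st: "stochastic (mpow Q m)" by (rule stochastic_mpow[OF assms(1)])
    have "(\<Sum>j\<in>UNIV. mpow Q m $ a $ j * h $ j) = h $ a"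
      using arg_cong[OF mpow_fixed[OF assms(3), of m], of "\<lambda>x. x $ a"] by (simp add: matrix_vector_mult_def)
    moreover have "(\<Sum>j\<in>UNIV. mpow Q m $ a $ j * h $ a) = h $ a"
      using st by (simp add: sum_distrib_right[symmetric] stochastic_def)
    ultimately have "(\<Sum>j\<in>UNIV. mpow Q m $ a $ j * (h $ a - h $ j)) = 0"
      by (simp add: right_diff_distrib sum_subtractf)
    moreover have "0 \<le> mpow Q m $ a $ j * (h $ a - h $ j)" for j
      using st le[of j] by (simp add: stochastic_def)
    ultimately have "\<forall>j\<in>UNIV. mpow Q m $ a $ j * (h $ a - h $ j) = 0"
      by (subst (asm) sum_nonneg_eq_0_iff) (rule finite, blast+)
    then have "mpow Q m $ a $ j * (h $ a - h $ j) = 0" by blast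
    then show ?thesis using m by simp
  qed
  show ?thesis by (rule trans[OF eq eq[symmetric]])
qed

text \<open>The rank-one perturbation makes \<open>1 - Q\<close> invertible without changing the equation, because
  applying \<open>\<pi>\<close> to it shows \<open>\<pi> \<bullet> h = 0\<close>.\<close>

lemma poisson_equation:
  fixes Q :: "real^'n^'n"
  assumes "stochastic Q" "irreducible_chain Q" "invariant_distribution Q \<pi>" "\<pi> \<bullet> f = 0"
  shows "\<exists>h. h - Q *v h = f"
proof -
  have inv: "\<pi> \<bullet> (Q *v h) = \<pi> \<bullet> h" for h
    using assms(3) by (simp add: invariant_distribution_def dot_lmul_matrix[symmetric])
  have one: "\<pi> \<bullet> 1 = 1"
    using assms(3) by (simp add: invariant_distribution_def inner_vec_def)
  define L where "L h = h - Q *v h + (\<pi> \<bullet> h) *\<^sub>R 1" for h :: "real^'n"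
  have lin: "linear L"
    unfolding L_def
    by (rule linearI) (simp_all add: matrix_vector_right_distrib inner_add_right algebra_simps
        matrix_vector_mult_scaleR)
  have \<pi>L: "\<pi> \<bullet> L h = \<pi> \<bullet> h" for h
    by (simp add: L_def inner_add_right inner_diff_right inv one)
  have "inj L"
  proof (rule linear_injective_0[OF lin, THEN iffD2], intro allI impI)
    fix h
    assume "L h = 0"
    then have 0: "\<pi> \<bullet> h = 0" using \<pi>L[of h] by simp
    with \<open>L h = 0\<close> have "Q *v h = h" by (simp add: L_def)
    then have "h = (h $ undefined) *\<^sub>R 1"
      using harmonic_const[OF assms(1,2)] by (simp add: vec_eq_iff)
    moreover from this have "\<pi> \<bullet> h = h $ undefined"
      by (metis inner_scaleR_right mult.right_neutral one)
    ultimately show "h = 0" using 0 by simp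
  qed
  then have "surj L" by (rule linear_inj_imp_surj[OF lin])
  then obtain h where h: "L h = f" by (metis surjD)
  then have "\<pi> \<bullet> h = 0" using \<pi>L[of h] assms(4) by simp
  with h show ?thesis by (auto simp: L_def)
qed

section \<open>Characteristic functions of martingale sums\<close>

lemma geometric_recursion_error:
  fixes a :: "nat \<Rightarrow> complex"
  assumes "\<And>k. 1 \<le> k \<Longrightarrow> norm (a (Suc k) - of_real \<rho> * a k) \<le> \<delta>" and "0 \<le> \<rho>" "\<rho> \<le> 1"
  shows "norm (a (Suc n) - of_real \<rho> ^ n * a 1) \<le> real n * \<delta>"
proof (induction n)
  case (Suc n)
  have "a (Suc (Suc n)) - of_real \<rho> ^ Suc n * a 1 =
      (a (Suc (Suc n)) - of_real \<rho> * a (Suc n)) + of_real \<rho> * (a (Suc n) - of_real \<rho> ^ n * a 1)"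
    by (simp add: algebra_simps)
  also have "norm \<dots> \<le> \<delta> + \<rho> * (real n * \<delta>)"
  proof (intro order_trans[OF norm_triangle_ineq] add_mono)
    show "norm (of_real \<rho> * (a (Suc n) - of_real \<rho> ^ n * a 1)) \<le> \<rho> * (real n * \<delta>)"
      using Suc assms(2) by (simp add: norm_mult mult_left_mono)
  qed (rule assms(1), simp)
  \<comment> \<open>Multiplication by \<rho> \<le> 1 does not enlarge earlier errors, so they add up
    at most linearly.\<close>
  also have "\<rho> * (real n * \<delta>) \<le> 1 * (real n * \<delta>)"
    using assms(3) order_trans[OF norm_ge_zero assms(1)[of 1]] by (intro mult_right_mono) auto
  finally show ?case by (simp add: algebra_simps)
qed simp

lemma exp_minus_taylor: "\<bar>exp (- x) - (1 - x)\<bar> \<le> x\<^sup>2" if "0 \<le> x" for x :: real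
proof -
  have "1 - x \<le> exp (- x)" using exp_ge_add_one_self[of "- x"] by simp
  moreover have "exp (- x) \<le> 1 - x + x\<^sup>2"
  proof -
    have "exp (- x) * (1 + x) \<le> exp (- x) * exp x"
      using exp_ge_add_one_self[of x] by (intro mult_left_mono) auto
    also have "\<dots> = 1" by (simp add: exp_minus)
    finally have "exp (- x) \<le> 1 / (1 + x)" using that by (simp add: field_simps)
    also have "\<dots> \<le> 1 - x + x\<^sup>2"
    proof -
      \<comment> \<open>The product equals 1 + x^3.\<close>
      have "1 \<le> (1 - x + x\<^sup>2) * (1 + x)"
        using that by (simp add: algebra_simps power2_eq_square)
      then show ?thesis using that by (simp add: pos_divide_le_eq)
    qed
    finally show ?thesis .
  qed
  ultimately show ?thesis by linarith
qed

lemma norm_add4_le: "norm (a + b + c + d) \<le> norm a + norm b + norm c + norm d"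
  for a b c d :: "'a::real_normed_vector"
  by (meson add_mono_thms_linordered_semiring(3) norm_triangle_ineq order_trans)

lemma (in prob_space) norm_expectation_le:
  fixes f :: "'a \<Rightarrow> 'c::{banach, second_countable_topology}"
  assumes "integrable M f" "\<And>\<omega>. norm (f \<omega>) \<le> c"
  shows "norm (\<integral>\<omega>. f \<omega> \<partial>M) \<le> c"
proof -
  have "norm (\<integral>\<omega>. f \<omega> \<partial>M) \<le> (\<integral>\<omega>. norm (f \<omega>) \<partial>M)"
    by (rule integral_norm_bound)
  also have "\<dots> \<le> (\<integral>\<omega>. c \<partial>M)"
    using assms by (intro integral_mono) auto
  finally show ?thesis by (simp add: prob_space)
qed

locale ergodic_chain = finite_chain M Y Q
  for M :: "'a measure" and Y :: "nat \<Rightarrow> 'a \<Rightarrow> 'n::finite" and Q :: "real^'n^'n" +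
  fixes \<pi> :: "real^'n"
  assumes irr: "irreducible_chain Q" and inv: "invariant_distribution Q \<pi>"
begin

lemma pi_nonneg: "0 \<le> \<pi> $ i" and pi_sum: "(\<Sum>i\<in>UNIV. \<pi> $ i) = 1"
  using inv by (simp_all add: invariant_distribution_def)

text \<open>The corrector \<open>1 - \<epsilon>\<^sup>2 h / 2\<close> turns the perturbed transition operator into multiplication by a
  scalar, up to an error of third order.\<close>

lemma perturbed_step:
  assumes mart: "\<And>i. (\<Sum>j\<in>UNIV. Q $ i $ j * g i j) = 0"
    and g: "\<And>i j. \<bar>g i j\<bar> \<le> c" and h: "\<And>i. \<bar>h i\<bar> \<le> H" and "0 \<le> s"
    and poisson: "\<And>i. h i - (\<Sum>j\<in>UNIV. Q $ i $ j * h j) = (\<Sum>j\<in>UNIV. Q $ i $ j * (g i j)\<^sup>2) - s"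
    and \<epsilon>: "0 < \<epsilon>" "\<epsilon> \<le> 1"
  shows "norm ((\<Sum>j\<in>UNIV. Q $ i $ j *\<^sub>R (iexp (\<epsilon> * g i j) * of_real (1 - \<epsilon>\<^sup>2 / 2 * h j)))
      - of_real (exp (- (\<epsilon>\<^sup>2 / 2 * s))) * of_real (1 - \<epsilon>\<^sup>2 / 2 * h i))
    \<le> (c ^ 3 + c * H + s * H + s\<^sup>2 * (1 + H)) * \<epsilon> ^ 3"
proof -
  define \<eta> where "\<eta> = \<epsilon>\<^sup>2 / 2"
  \<comment> \<open>Three Taylor remainders: \<open>e\<close> is of order 3 in \<epsilon>;
    \<open>d\<close> is of order 1 and will be multiplied by \<open>\<eta>\<close>, of order 2;
    \<open>r\<close> is of order 2 in \<open>\<eta>\<close>.\<close>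
  define e where "e j = iexp (\<epsilon> * g i j) - (1 + \<i> * of_real (\<epsilon> * g i j) - of_real (\<eta> * (g i j)\<^sup>2))" for j
  define d where "d j = iexp (\<epsilon> * g i j) - 1" for j
  define r where "r = exp (- (\<eta> * s)) - (1 - \<eta> * s)"
  have c: "0 \<le> c" using g[of undefined undefined] by linarith
  have H: "0 \<le> H" using h[of undefined] by linarith
  have "\<epsilon>\<^sup>2 \<le> 1"
    using \<epsilon> by (intro power_le_one) auto
  then have \<eta>: "0 \<le> \<eta>" "\<eta> \<le> 1" "\<eta> \<le> \<epsilon>\<^sup>2"
    unfolding \<eta>_def by auto
  have \<epsilon>43: "\<epsilon> ^ 4 \<le> \<epsilon> ^ 3"
    using \<epsilon> by (intro power_decreasing) auto
  have \<eta>2: "\<eta>\<^sup>2 \<le> \<epsilon> ^ 3"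
    using power_mono[OF \<eta>(3,1), of 2] \<epsilon>43 by (simp flip: power_mult)
  have \<epsilon>g: "\<bar>\<epsilon> * g i j\<bar> \<le> \<epsilon> * c" for j
    using g[of i j] \<epsilon> by (simp add: abs_mult mult_left_mono)
  have e: "norm (e j) \<le> c ^ 3 * \<epsilon> ^ 3" for j
  proof -
    have "norm (e j) \<le> \<bar>\<epsilon> * g i j\<bar> ^ 3 / 6"
      using iexp_approx1[of "\<epsilon> * g i j" 2]
      by (simp add: e_def \<eta>_def numeral_2_eq_2 numeral_3_eq_3 power_mult_distrib algebra_simps fact_numeral)
    also have "\<dots> \<le> \<bar>\<epsilon> * g i j\<bar> ^ 3" by simp
    also have "\<dots> \<le> (\<epsilon> * c) ^ 3" using \<epsilon>g by (intro power_mono) auto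
    finally show ?thesis by (simp add: power_mult_distrib mult.commute)
  qed
  have d: "norm (d j) \<le> \<epsilon> * c" for j
    using iexp_approx1[of "\<epsilon> * g i j" 0] \<epsilon>g[of j] by (simp add: d_def)
  have r: "\<bar>r\<bar> \<le> s\<^sup>2 * \<epsilon> ^ 3"
  proof -
    have "\<bar>r\<bar> \<le> (\<eta> * s)\<^sup>2"
      unfolding r_def using \<eta> \<open>0 \<le> s\<close> by (intro exp_minus_taylor) simp
    also have "\<dots> = s\<^sup>2 * \<eta>\<^sup>2" by (simp add: power_mult_distrib mult.commute)
    also have "\<dots> \<le> s\<^sup>2 * \<epsilon> ^ 3" using \<eta>2 by (intro mult_left_mono) auto
    finally show ?thesis .
  qed
  have avg: "norm (\<Sum>j\<in>UNIV. Q $ i $ j *\<^sub>R z j) \<le> B" if "\<And>j. norm (z j) \<le> B" for z :: "'n \<Rightarrow> complex" and B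
  proof -
    have "norm (\<Sum>j\<in>UNIV. Q $ i $ j *\<^sub>R z j) \<le> (\<Sum>j\<in>UNIV. Q $ i $ j * B)"
      using that Q_nonneg by (intro sum_norm_le) (simp add: mult_left_mono)
    then show ?thesis by (simp add: sum_distrib_right[symmetric] Q_sum)
  qed
  have "(\<Sum>j\<in>UNIV. Q $ i $ j *\<^sub>R (iexp (\<epsilon> * g i j) * of_real (1 - \<eta> * h j)))
      = (\<Sum>j\<in>UNIV. of_real (Q $ i $ j) + \<i> * of_real \<epsilon> * of_real (Q $ i $ j * g i j)
          - of_real \<eta> * of_real (Q $ i $ j * (g i j)\<^sup>2) - of_real \<eta> * of_real (Q $ i $ j * h j)
          + Q $ i $ j *\<^sub>R e j - Q $ i $ j *\<^sub>R (of_real (\<eta> * h j) * d j))"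
    by (intro sum.cong refl) (simp add: e_def d_def scaleR_conv_of_real algebra_simps)
  also have "\<dots> = of_real (\<Sum>j\<in>UNIV. Q $ i $ j) + \<i> * of_real \<epsilon> * of_real (\<Sum>j\<in>UNIV. Q $ i $ j * g i j)
          - of_real \<eta> * of_real (\<Sum>j\<in>UNIV. Q $ i $ j * (g i j)\<^sup>2) - of_real \<eta> * of_real (\<Sum>j\<in>UNIV. Q $ i $ j * h j)
          + (\<Sum>j\<in>UNIV. Q $ i $ j *\<^sub>R e j) - (\<Sum>j\<in>UNIV. Q $ i $ j *\<^sub>R (of_real (\<eta> * h j) * d j))"
    by (simp add: sum.distrib sum_subtractf sum_distrib_left)
  \<comment> \<open>The martingale condition removes the term of order \<epsilon>, and the Poisson
    equation merges the two terms of order \<open>\<eta>\<close> into h i + s.\<close>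
  also have "\<dots> = of_real (1 - \<eta> * (h i + s))
          + (\<Sum>j\<in>UNIV. Q $ i $ j *\<^sub>R e j) - (\<Sum>j\<in>UNIV. Q $ i $ j *\<^sub>R (of_real (\<eta> * h j) * d j))"
  proof -
    have v: "(\<Sum>j\<in>UNIV. Q $ i $ j * (g i j)\<^sup>2) = h i - (\<Sum>j\<in>UNIV. Q $ i $ j * h j) + s"
      using poisson[of i] by simp
    show ?thesis
      unfolding Q_sum mart v by (simp add: algebra_simps del: of_real_sum)
  qed
  \<comment> \<open>Since (1 - \<eta> s) (1 - \<eta> h i) = 1 - \<eta> (h i + s) + \<eta>^2 s h i,
    the main terms cancel. The four terms that remain yield, in this order, the four summands of the
    constant in the claim.\<close>
  also have "\<dots> - of_real (exp (- (\<eta> * s))) * of_real (1 - \<eta> * h i) =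
      (\<Sum>j\<in>UNIV. Q $ i $ j *\<^sub>R e j) + (\<Sum>j\<in>UNIV. Q $ i $ j *\<^sub>R (of_real (- \<eta> * h j) * d j))
      + of_real (- (\<eta>\<^sup>2 * s * h i)) + of_real (- (r * (1 - \<eta> * h i)))"
    by (simp add: r_def algebra_simps power2_eq_square sum_negf)
  finally have eq: "(\<Sum>j\<in>UNIV. Q $ i $ j *\<^sub>R (iexp (\<epsilon> * g i j) * of_real (1 - \<eta> * h j)))
      - of_real (exp (- (\<eta> * s))) * of_real (1 - \<eta> * h i) =
      (\<Sum>j\<in>UNIV. Q $ i $ j *\<^sub>R e j) + (\<Sum>j\<in>UNIV. Q $ i $ j *\<^sub>R (of_real (- \<eta> * h j) * d j))
      + of_real (- (\<eta>\<^sup>2 * s * h i)) + of_real (- (r * (1 - \<eta> * h i)))" .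
  have "norm (of_real (- \<eta> * h j) * d j) \<le> c * H * \<epsilon> ^ 3" for j
  proof -
    have "norm (of_real (- \<eta> * h j) * d j) = \<eta> * \<bar>h j\<bar> * norm (d j)"
      using \<eta>(1) by (simp add: norm_mult abs_mult)
    also have "\<dots> \<le> \<epsilon>\<^sup>2 * H * (\<epsilon> * c)"
      using \<eta> h[of j] d[of j] H by (intro mult_mono) auto
    finally show ?thesis by (simp add: power2_eq_square power3_eq_cube mult_ac)
  qed
  then have B2: "norm (\<Sum>j\<in>UNIV. Q $ i $ j *\<^sub>R (of_real (- \<eta> * h j) * d j)) \<le> c * H * \<epsilon> ^ 3"
    by (rule avg)
  have B3: "norm (of_real (- (\<eta>\<^sup>2 * s * h i)) :: complex) \<le> s * H * \<epsilon> ^ 3"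
  proof -
    have "norm (of_real (- (\<eta>\<^sup>2 * s * h i)) :: complex) = s * \<bar>h i\<bar> * \<eta>\<^sup>2"
      using \<open>0 \<le> s\<close> by (simp add: abs_mult norm_mult norm_power)
    also have "\<dots> \<le> s * H * \<epsilon> ^ 3"
      using \<eta>2 h[of i] H \<open>0 \<le> s\<close> by (intro mult_mono) auto
    finally show ?thesis .
  qed
  have B4: "norm (of_real (- (r * (1 - \<eta> * h i))) :: complex) \<le> s\<^sup>2 * (1 + H) * \<epsilon> ^ 3"
  proof -
    have "\<bar>\<eta> * h i\<bar> \<le> 1 * H"
      using \<eta> h[of i] by (simp only: abs_mult) (intro mult_mono, auto)
    then have "\<bar>1 - \<eta> * h i\<bar> \<le> 1 + H" by linarith
    then have "\<bar>r\<bar> * \<bar>1 - \<eta> * h i\<bar> \<le> (s\<^sup>2 * \<epsilon> ^ 3) * (1 + H)"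
      using r \<epsilon> by (intro mult_mono) auto
    then show ?thesis by (simp only: norm_of_real abs_minus_cancel abs_mult) (simp add: mult_ac)
  qed
  have B1: "norm (\<Sum>j\<in>UNIV. Q $ i $ j *\<^sub>R e j) \<le> c ^ 3 * \<epsilon> ^ 3"
    by (rule avg[OF e])
  show ?thesis
    unfolding \<eta>_def[symmetric] eq
    by (simp only: distrib_right[of _ _ "\<epsilon> ^ 3"]) (intro order_trans[OF norm_add4_le] add_mono B1 B2 B3 B4)
qed

text \<open>At scale \<epsilon> = 1 / sqrt n, there are n - 1 steps with an error of order
  \<epsilon>^3 each, which accumulate only to order \<epsilon>. Irreducibility enters through the
  solvability of the Poisson equation.\<close>

lemma msum_char_limit:
  assumes mart: "\<And>i. (\<Sum>j\<in>UNIV. Q $ i $ j * g i j) = 0"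
  shows "(\<lambda>n. \<integral>\<omega>. iexp (msum g n \<omega> / sqrt (real n)) \<partial>M) \<longlonglongrightarrow>
    of_real (exp (- (\<Sum>i\<in>UNIV. \<pi> $ i * (\<Sum>j\<in>UNIV. Q $ i $ j * (g i j)\<^sup>2)) / 2))"
proof -
  define s where "s = (\<Sum>i\<in>UNIV. \<pi> $ i * (\<Sum>j\<in>UNIV. Q $ i $ j * (g i j)\<^sup>2))"
  have s: "0 \<le> s"
    unfolding s_def by (intro sum_nonneg mult_nonneg_nonneg pi_nonneg Q_nonneg) auto
  define f :: "real^'n" where "f = (\<chi> i. (\<Sum>j\<in>UNIV. Q $ i $ j * (g i j)\<^sup>2) - s)"
  have "\<pi> \<bullet> f = 0"
    by (simp add: f_def inner_vec_def right_diff_distrib sum_subtractf sum_distrib_right[symmetric] pi_sum)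
      (simp add: s_def)
  then obtain h where "h - Q *v h = f"
    using poisson_equation[OF stoch irr inv] by blast
  then have poisson: "h $ i - (\<Sum>j\<in>UNIV. Q $ i $ j * h $ j) = (\<Sum>j\<in>UNIV. Q $ i $ j * (g i j)\<^sup>2) - s" for i
    by (auto simp: f_def vec_eq_iff matrix_vector_mult_def)
  define c where "c = (\<Sum>i\<in>UNIV. \<Sum>j\<in>UNIV. \<bar>g i j\<bar>)"
  have c: "\<bar>g i j\<bar> \<le> c" for i j
  proof -
    have "\<bar>g i j\<bar> \<le> (\<Sum>j\<in>UNIV. \<bar>g i j\<bar>)" by (rule member_le_sum) auto
    also have "\<dots> \<le> c" unfolding c_def
      by (rule member_le_sum[of i UNIV "\<lambda>i. \<Sum>j\<in>UNIV. \<bar>g i j\<bar>"]) (auto intro: sum_nonneg)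
    finally show ?thesis .
  qed
  define H where "H = (\<Sum>i\<in>UNIV. \<bar>h $ i\<bar>)"
  have H: "\<bar>h $ i\<bar> \<le> H" for i unfolding H_def by (rule member_le_sum) auto
  define C where "C = c ^ 3 + c * H + s * H + s\<^sup>2 * (1 + H)"
  define \<phi> where "\<phi> n = (\<integral>\<omega>. iexp (msum g n \<omega> / sqrt (real n)) \<partial>M)" for n
  \<comment> \<open>The factor 1 - 1 / n in the exponent reflects that the sum has n - 1
    increments.\<close>
  have bound: "norm (\<phi> n - of_real (exp (- (s * (1 - 1 / real n)) / 2))) \<le> C / sqrt (real n) + H / real n" if n: "1 \<le> n" for n
  proof -
    define \<epsilon> where "\<epsilon> = 1 / sqrt (real n)"
    have \<epsilon>: "0 < \<epsilon>" "\<epsilon> \<le> 1" "\<epsilon>\<^sup>2 = 1 / real n"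
      using that by (auto simp: \<epsilon>_def power_divide)
    define w where "w i = 1 - \<epsilon>\<^sup>2 / 2 * h $ i" for i
    define \<rho> where "\<rho> = exp (- (\<epsilon>\<^sup>2 / 2 * s))"
    define a where "a k = (\<integral>\<omega>. iexp (\<epsilon> * msum g k \<omega>) * of_real (w (Y k \<omega>)) \<partial>M)" for k
    have rec: "norm (a (Suc k) - of_real \<rho> * a k) \<le> C * \<epsilon> ^ 3" if "1 \<le> k" for k
    proof -
      let ?h = "\<lambda>i j. iexp (\<epsilon> * g i j) * of_real (w j)"
      let ?W = "\<lambda>i. (\<Sum>j\<in>UNIV. Q $ i $ j *\<^sub>R ?h i j)"
      have past: "past_fun M Y k (\<lambda>\<omega>. iexp (\<epsilon> * msum g k \<omega>) * z (Y k \<omega>))" for z :: "'n \<Rightarrow> complex"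
        by (rule msum_past)
      have "a (Suc k) = (\<integral>\<omega>. iexp (\<epsilon> * msum g k \<omega>) * ?h (Y k \<omega>) (Y (Suc k) \<omega>) \<partial>M)"
        unfolding a_def using that by (simp add: msum_Suc exp_add distrib_left mult_ac)
      also have "\<dots> = (\<integral>\<omega>. iexp (\<epsilon> * msum g k \<omega>) * ?W (Y k \<omega>) \<partial>M)"
        using past[of "\<lambda>_. 1"] by (intro expectation_step) simp
      finally have a_Suc: "a (Suc k) = (\<integral>\<omega>. iexp (\<epsilon> * msum g k \<omega>) * ?W (Y k \<omega>) \<partial>M)" .
      have "a (Suc k) - of_real \<rho> * a k =
          (\<integral>\<omega>. iexp (\<epsilon> * msum g k \<omega>) * ?W (Y k \<omega>) - of_real \<rho> * (iexp (\<epsilon> * msum g k \<omega>) * of_real (w (Y k \<omega>))) \<partial>M)"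
      proof -
        have i: "integrable M (\<lambda>\<omega>. iexp (\<epsilon> * msum g k \<omega>) * ?W (Y k \<omega>))"
          "integrable M (\<lambda>\<omega>. of_real \<rho> * (iexp (\<epsilon> * msum g k \<omega>) * of_real (w (Y k \<omega>))))"
          by (rule past_fun_integrable[OF past], rule integrable_mult_right, rule past_fun_integrable[OF past])
        show ?thesis
          unfolding a_Suc unfolding a_def integral_mult_right_zero[symmetric]
          by (rule Bochner_Integration.integral_diff[OF i, symmetric])
      qed
      also have "\<dots> = (\<integral>\<omega>. iexp (\<epsilon> * msum g k \<omega>) * (?W (Y k \<omega>) - of_real \<rho> * of_real (w (Y k \<omega>))) \<partial>M)"
        by (simp only: right_diff_distrib mult.left_commute[of "of_real \<rho>"])
      also have "norm \<dots> \<le> C * \<epsilon> ^ 3"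
      proof (rule norm_expectation_le)
        show "integrable M (\<lambda>\<omega>. iexp (\<epsilon> * msum g k \<omega>) * (?W (Y k \<omega>) - of_real \<rho> * of_real (w (Y k \<omega>))))"
          by (rule past_fun_integrable[OF past])
        fix \<omega>
        show "norm (iexp (\<epsilon> * msum g k \<omega>) * (?W (Y k \<omega>) - of_real \<rho> * of_real (w (Y k \<omega>)))) \<le> C * \<epsilon> ^ 3"
          unfolding norm_mult norm_exp_i_times mult_1_left C_def w_def \<rho>_def
          by (rule perturbed_step[OF mart c H s poisson \<epsilon>(1,2)])
      qed
      finally show ?thesis .
    qed
    obtain m where m: "n = Suc m" using n by (cases n) auto
    have \<rho>: "0 \<le> \<rho>" "\<rho> \<le> 1" using s by (auto simp: \<rho>_def)
    from geometric_recursion_error[of a \<rho> "C * \<epsilon> ^ 3" m, OF rec this]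
    have R: "norm (a n - of_real \<rho> ^ m * a 1) \<le> real m * (C * \<epsilon> ^ 3)" by (simp add: m)
    \<comment> \<open>The corrector \<open>w\<close> is within \<epsilon>^2 H / 2 of 1. It has to be
      removed at both ends, k = n and k = 1, which together costs H / n.\<close>
    have near: "norm (a k - (\<integral>\<omega>. iexp (\<epsilon> * msum g k \<omega>) \<partial>M)) \<le> \<epsilon>\<^sup>2 / 2 * H" for k
    proof -
      have past: "past_fun M Y k (\<lambda>\<omega>. iexp (\<epsilon> * msum g k \<omega>) * z (Y k \<omega>))" for z :: "'n \<Rightarrow> complex"
        by (rule msum_past)
      have "a k - (\<integral>\<omega>. iexp (\<epsilon> * msum g k \<omega>) \<partial>M) =
          (\<integral>\<omega>. iexp (\<epsilon> * msum g k \<omega>) * of_real (w (Y k \<omega>)) - iexp (\<epsilon> * msum g k \<omega>) \<partial>M)"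
        unfolding a_def
        by (rule Bochner_Integration.integral_diff[symmetric]; rule past_fun_integrable[OF msum_past])
      also have "\<dots> = (\<integral>\<omega>. iexp (\<epsilon> * msum g k \<omega>) * of_real (- (\<epsilon>\<^sup>2 / 2 * h $ Y k \<omega>)) \<partial>M)"
        by (simp add: w_def algebra_simps)
      also have "norm \<dots> \<le> \<epsilon>\<^sup>2 / 2 * H"
      proof (rule norm_expectation_le)
        show "integrable M (\<lambda>\<omega>. iexp (\<epsilon> * msum g k \<omega>) * of_real (- (\<epsilon>\<^sup>2 / 2 * h $ Y k \<omega>)))"
          by (rule past_fun_integrable[OF past])
        fix \<omega>
        show "norm (iexp (\<epsilon> * msum g k \<omega>) * of_real (- (\<epsilon>\<^sup>2 / 2 * h $ Y k \<omega>))) \<le> \<epsilon>\<^sup>2 / 2 * H"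
          using H[of "Y k \<omega>"] by (simp only: norm_mult norm_of_real norm_exp_i_times abs_mult abs_minus_cancel)
            (simp add: mult_left_mono)
      qed
      finally show ?thesis .
    qed
    \<comment> \<open>For k = 1 the sum is empty, so the recursion starts near 1 whatever the law of
      the first state is.\<close>
    have "(\<integral>\<omega>. iexp (\<epsilon> * msum g 1 \<omega>) \<partial>M) = 1"
      by (simp add: msum_def prob_space)
    with near[of 1] have n1: "norm (of_real \<rho> ^ m * a 1 - of_real \<rho> ^ m) \<le> \<epsilon>\<^sup>2 / 2 * H"
    proof -
      have "norm (of_real \<rho> ^ m * a 1 - of_real \<rho> ^ m) = \<rho> ^ m * norm (a 1 - 1)"
      proof -
        have "of_real \<rho> ^ m * a 1 - of_real \<rho> ^ m = of_real \<rho> ^ m * (a 1 - 1)"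
          by (simp add: right_diff_distrib)
        then show ?thesis using \<rho>(1) by (simp only: norm_mult norm_power norm_of_real abs_of_nonneg)
      qed
      also have "\<dots> \<le> 1 * (\<epsilon>\<^sup>2 / 2 * H)"
        using near[of 1] \<rho> \<open>(\<integral>\<omega>. iexp (\<epsilon> * msum g 1 \<omega>) \<partial>M) = 1\<close>
        by (intro mult_mono power_le_one) auto
      finally show ?thesis by simp
    qed
    have "\<phi> n - of_real \<rho> ^ m = ((\<phi> n - a n) + (a n - of_real \<rho> ^ m * a 1)) + (of_real \<rho> ^ m * a 1 - of_real \<rho> ^ m)"
      by simp
    also have "norm \<dots> \<le> (norm (\<phi> n - a n) + norm (a n - of_real \<rho> ^ m * a 1)) + norm (of_real \<rho> ^ m * a 1 - of_real \<rho> ^ m)"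
      by (intro order_trans[OF norm_triangle_ineq] add_mono norm_triangle_ineq order_refl)
    also have "\<dots> \<le> (\<epsilon>\<^sup>2 / 2 * H + real m * (C * \<epsilon> ^ 3)) + \<epsilon>\<^sup>2 / 2 * H"
    proof (intro add_mono n1 R)
      show "norm (\<phi> n - a n) \<le> \<epsilon>\<^sup>2 / 2 * H"
        using near[of n] by (simp add: \<phi>_def \<epsilon>_def norm_minus_commute)
    qed
    also have "\<dots> = real m * (C * \<epsilon> ^ 3) + H / real n"
      using \<epsilon>(3) by simp
    also have "real m * (C * \<epsilon> ^ 3) \<le> real n * (C * \<epsilon> ^ 3)"
      using order_trans[OF norm_ge_zero rec[of 1]] by (intro mult_right_mono) (auto simp: m)
    also have "\<dots> = C / sqrt (real n)"
    proof -
      have "real n * \<epsilon> ^ 3 = (real n * \<epsilon>\<^sup>2) * \<epsilon>" by (simp add: power2_eq_square power3_eq_cube)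
      also have "\<dots> = \<epsilon>" using that by (simp add: \<epsilon>(3))
      finally have "real n * (C * \<epsilon> ^ 3) = C * \<epsilon>"
        by (simp only: mult.left_commute[of "real n"])
      then show ?thesis by (simp add: \<epsilon>_def)
    qed
    finally have "norm (\<phi> n - of_real \<rho> ^ m) \<le> C / sqrt (real n) + H / real n" by simp
    moreover have "\<rho> ^ m = exp (- (s * (1 - 1 / real n)) / 2)"
    proof -
      have "\<rho> ^ m = exp (real m * (- (\<epsilon>\<^sup>2 / 2 * s)))"
        unfolding \<rho>_def by (rule exp_of_nat_mult[symmetric])
      also have "real m * (- (\<epsilon>\<^sup>2 / 2 * s)) = - (s * (1 - 1 / real n)) / 2"
        unfolding \<epsilon>(3) by (simp add: m field_simps)
      finally show ?thesis .
    qed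
    ultimately show ?thesis by (simp flip: of_real_power)
  qed
  have "(\<lambda>n. C / sqrt (real n) + H / real n) \<longlonglongrightarrow> 0"
    by real_asymp
  then have "(\<lambda>n. \<phi> n - of_real (exp (- (s * (1 - 1 / real n)) / 2))) \<longlonglongrightarrow> 0"
    by (rule Lim_null_comparison[rotated])
      (use bound in \<open>auto intro!: eventually_sequentiallyI[of 1]\<close>)
  moreover have "(\<lambda>n. of_real (exp (- (s * (1 - 1 / real n)) / 2)) :: complex) \<longlonglongrightarrow> of_real (exp (- s / 2))"
  proof (intro tendsto_of_real tendsto_exp)
    show "(\<lambda>n. - (s * (1 - 1 / real n)) / 2) \<longlonglongrightarrow> - s / 2"
      by real_asymp
  qed
  ultimately show ?thesis
    using tendsto_add[of _ 0 sequentially] unfolding \<phi>_def s_def by fastforce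
qed

section \<open>Law of large numbers for the visits\<close>

definition visits :: "'n \<Rightarrow> nat \<Rightarrow> 'a \<Rightarrow> real" where
  "visits i n \<omega> = real (card {k\<in>{1..<n}. Y k \<omega> = i})"

lemma visits_sum: "visits i n \<omega> = (\<Sum>k\<in>{1..<n}. if Y k \<omega> = i then 1 else 0)"
  unfolding visits_def by (simp add: sum.If_cases Int_def conj_commute)

lemma visits_measurable [measurable]: "visits i n \<in> borel_measurable M"
  unfolding visits_sum[abs_def] by measurable

text \<open>The Poisson equation for the centred indicator of i writes the centred number of visits
  as a martingale sum plus a telescoping sum. The first has second moment of order n, the second is
  bounded, and Chebyshev's inequality concludes.\<close>

lemma visits_in_prob:
  assumes "0 < \<gamma>"
  shows "(\<lambda>n. measure M {\<omega> \<in> space M. \<gamma> \<le> \<bar>visits i n \<omega> / real n - \<pi> $ i\<bar>}) \<longlonglongrightarrow> 0"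
proof -
  define f :: "real^'n" where "f = axis i 1 - (\<pi> $ i) *\<^sub>R 1"
  have "\<pi> \<bullet> f = 0"
    using pi_sum by (simp add: f_def inner_diff_right inner_axis) (simp add: inner_vec_def)
  then obtain h where h: "h - Q *v h = f"
    using poisson_equation[OF stoch irr inv] by blast
  define H where "H = (\<Sum>i\<in>UNIV. \<bar>h $ i\<bar>)"
  have H: "\<bar>h $ i\<bar> \<le> H" for i unfolding H_def by (rule member_le_sum) auto
  define g where "g a b = h $ b - (Q *v h) $ a" for a b
  have Qh: "\<bar>(Q *v h) $ a\<bar> \<le> H" for a
  proof -
    have "\<bar>(Q *v h) $ a\<bar> \<le> (\<Sum>j\<in>UNIV. Q $ a $ j * H)"
      unfolding matrix_vector_mult_def using Q_nonneg H
      by (simp, intro order_trans[OF sum_abs] sum_mono) (simp add: abs_mult mult_left_mono)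
    then show ?thesis by (simp add: sum_distrib_right[symmetric] Q_sum)
  qed
  have g: "\<bar>g a b\<bar> \<le> 2 * H" for a b
    using H[of b] Qh[of a] unfolding g_def by linarith
  have mart: "(\<Sum>b\<in>UNIV. Q $ a $ b * g a b) = 0" for a
  proof -
    have "(\<Sum>b\<in>UNIV. Q $ a $ b * g a b) = (\<Sum>b\<in>UNIV. Q $ a $ b * h $ b) - (\<Sum>b\<in>UNIV. Q $ a $ b) * (Q *v h) $ a"
      by (simp add: g_def right_diff_distrib sum_subtractf sum_distrib_right)
    then show ?thesis by (simp add: Q_sum matrix_vector_mult_def)
  qed
  have tele: "visits i n \<omega> - real (n - 1) * \<pi> $ i = msum g n \<omega> + (h $ Y 1 \<omega> - h $ Y n \<omega>)" if "1 \<le> n" for n \<omega>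
  proof -
    have "visits i n \<omega> - real (n - 1) * \<pi> $ i = (\<Sum>k\<in>{1..<n}. f $ Y k \<omega>)"
      by (simp add: visits_sum f_def sum_subtractf axis_def eq_commute)
    also have "\<dots> = (\<Sum>k\<in>{1..<n}. g (Y k \<omega>) (Y (Suc k) \<omega>) + (h $ Y k \<omega> - h $ Y (Suc k) \<omega>))"
      by (simp add: h[symmetric] g_def)
    also have "\<dots> = msum g n \<omega> + (\<Sum>k\<in>{1..<n}. h $ Y k \<omega> - h $ Y (Suc k) \<omega>)"
      by (simp add: sum.distrib msum_def)
    also have "(\<Sum>k\<in>{1..<n}. h $ Y k \<omega> - h $ Y (Suc k) \<omega>) = h $ Y 1 \<omega> - h $ Y n \<omega>"
      using that by (induction n rule: dec_induct) simp_all
    finally show ?thesis .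
  qed
  \<comment> \<open>2 H bounds the telescoped boundary terms; the 1 pays for replacing the n - 1
    observation times by n, as \<open>\<pi> $ i \<le> 1\<close>.\<close>
  define K where "K = 2 * H + 1"
  have dev: "\<bar>visits i n \<omega> / real n - \<pi> $ i\<bar> \<le> \<bar>msum g n \<omega>\<bar> / real n + K / real n" if "1 \<le> n" for n \<omega>
  proof -
    have "\<pi> $ i \<le> 1"
      using member_le_sum[of i UNIV "\<lambda>i. \<pi> $ i"] pi_nonneg pi_sum by simp
    then have "\<bar>visits i n \<omega> - real n * \<pi> $ i\<bar> \<le> \<bar>msum g n \<omega>\<bar> + K"
      using tele[OF that, of \<omega>] H[of "Y 1 \<omega>"] H[of "Y n \<omega>"] pi_nonneg[of i] that
      unfolding K_def by (simp add: of_nat_diff left_diff_distrib)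
    then have "\<bar>visits i n \<omega> - real n * \<pi> $ i\<bar> / real n \<le> (\<bar>msum g n \<omega>\<bar> + K) / real n"
      by (intro divide_right_mono) auto
    moreover have "visits i n \<omega> / real n - \<pi> $ i = (visits i n \<omega> - real n * \<pi> $ i) / real n"
      using that by (simp add: field_simps)
    ultimately show ?thesis by (simp add: add_divide_distrib)
  qed
  \<comment> \<open>Half of \<gamma> goes to the martingale; the other half absorbs K / n.\<close>
  have cheb: "measure M {\<omega> \<in> space M. \<gamma> / 2 * real n \<le> \<bar>msum g n \<omega>\<bar>} \<le> (real n * (2 * H)\<^sup>2) / (\<gamma> / 2 * real n)\<^sup>2" if "1 \<le> n" for n
  proof -
    have "measure M {\<omega> \<in> space M. \<gamma> / 2 * real n \<le> \<bar>msum g n \<omega>\<bar>} \<le> measure M {\<omega> \<in> space M. (\<gamma> / 2 * real n)\<^sup>2 \<le> (msum g n \<omega>)\<^sup>2}"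
      using assms by (intro finite_measure_mono) (auto simp: abs_le_square_iff[symmetric])
    also have "\<dots> \<le> (\<integral>\<omega>. (msum g n \<omega>)\<^sup>2 \<partial>M) / (\<gamma> / 2 * real n)\<^sup>2"
      using assms that past_fun_integrable[OF msum_past[of n "\<lambda>s _. s\<^sup>2" g]]
      by (intro integral_Markov_inequality_measure[of _ _ "{}", simplified]) auto
    also have "\<dots> \<le> (real n * (2 * H)\<^sup>2) / (\<gamma> / 2 * real n)\<^sup>2"
      by (intro divide_right_mono msum_second_moment[OF mart g]) auto
    finally show ?thesis .
  qed
  show ?thesis
  proof (rule tendsto_sandwich[OF _ _ tendsto_const])
    show "eventually (\<lambda>n. 0 \<le> measure M {\<omega> \<in> space M. \<gamma> \<le> \<bar>visits i n \<omega> / real n - \<pi> $ i\<bar>}) sequentially"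
      by simp
    have "eventually (\<lambda>n. K / real n < \<gamma> / 2) sequentially"
      using assms by real_asymp
    then show "eventually (\<lambda>n. measure M {\<omega> \<in> space M. \<gamma> \<le> \<bar>visits i n \<omega> / real n - \<pi> $ i\<bar>} \<le>
        (real n * (2 * H)\<^sup>2) / (\<gamma> / 2 * real n)\<^sup>2) sequentially"
      using eventually_ge_at_top[of 1]
    proof eventually_elim
      case (elim n)
      have "measure M {\<omega> \<in> space M. \<gamma> \<le> \<bar>visits i n \<omega> / real n - \<pi> $ i\<bar>} \<le>
          measure M {\<omega> \<in> space M. \<gamma> / 2 * real n \<le> \<bar>msum g n \<omega>\<bar>}"
      proof (intro finite_measure_mono subsetI)
        fix \<omega>
        assume "\<omega> \<in> {\<omega> \<in> space M. \<gamma> \<le> \<bar>visits i n \<omega> / real n - \<pi> $ i\<bar>}"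
        then have *: "\<gamma> \<le> \<bar>visits i n \<omega> / real n - \<pi> $ i\<bar>" "\<omega> \<in> space M" by auto
        then have "\<gamma> / 2 \<le> \<bar>msum g n \<omega>\<bar> / real n"
          using dev[OF elim(2), of \<omega>] elim(1) by linarith
        then show "\<omega> \<in> {\<omega> \<in> space M. \<gamma> / 2 * real n \<le> \<bar>msum g n \<omega>\<bar>}"
          using elim(2) *(2) by (simp add: field_simps)
      qed simp
      also note cheb[OF elim(2)]
      finally show ?case .
    qed
    show "(\<lambda>n. (real n * (2 * H)\<^sup>2) / (\<gamma> / 2 * real n)\<^sup>2) \<longlonglongrightarrow> 0"
      using assms by real_asymp
  qed
qed

end

section \<open>The estimator as a function of the empirical matrix\<close>

lemma tendsto_matrix_mult:
  fixes f :: "'z \<Rightarrow> real^'k^'m" and g :: "'z \<Rightarrow> real^'l^'k"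
  assumes "(f \<longlongrightarrow> A) F" "(g \<longlongrightarrow> B) F"
  shows "((\<lambda>x. f x ** g x) \<longlongrightarrow> A ** B) F"
  unfolding matrix_matrix_mult_def
  by (intro vec_tendstoI) (auto intro!: tendsto_sum tendsto_mult tendsto_vec_nth assms)

lemma tendsto_transpose:
  fixes f :: "'z \<Rightarrow> real^'k^'m"
  assumes "(f \<longlongrightarrow> A) F"
  shows "((\<lambda>x. transpose (f x)) \<longlongrightarrow> transpose A) F"
  unfolding transpose_def
  by (intro vec_tendstoI) (auto intro!: tendsto_vec_nth assms)

lemma tendsto_det:
  fixes f :: "'z \<Rightarrow> real^'k^'k"
  assumes "\<And>i j. ((\<lambda>x. f x $ i $ j) \<longlongrightarrow> A $ i $ j) F"
  shows "((\<lambda>x. det (f x)) \<longlongrightarrow> det A) F"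
  unfolding det_def
  by (intro tendsto_sum tendsto_mult tendsto_prod tendsto_const assms)

lemma invertible_matrix_inv:
  fixes A :: "real^'k^'k"
  assumes "invertible A"
  shows "A ** matrix_inv A = mat 1" "matrix_inv A ** A = mat 1"
  using someI_ex[OF assms[unfolded invertible_def]] by (simp_all add: matrix_inv_def)

lemma matrix_mult_diff_left: "A ** (B - C) = A ** B - A ** C"
  and matrix_mult_diff_right: "(B - C) ** D = B ** D - C ** D"
  for A :: "real^'k^'m" and B C :: "real^'l^'k" and D :: "real^'m^'l"
  by (simp_all add: matrix_matrix_mult_def vec_eq_iff algebra_simps sum_subtractf)

lemma matrix_add_rdistrib: "(B + C) ** D = B ** D + C ** D"
  for B C :: "real^'l^'k" and D :: "real^'m^'l"
  by (simp add: matrix_matrix_mult_def vec_eq_iff distrib_right sum.distrib)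

text \<open>This makes the entries of the inverse quotients of polynomials in the entries of the
  matrix, from which continuity of inversion is read off.\<close>

lemma matrix_inv_cramer:
  fixes A :: "real^'k^'k"
  assumes "det A \<noteq> 0"
  shows "matrix_inv A $ i $ j = det (\<chi> r c. if c = i then axis j 1 $ r else A $ r $ c) / det A"
proof -
  have "invertible A" using assms by (simp add: invertible_det_nz)
  then have "A *v (matrix_inv A *v axis j 1) = axis j 1"
    by (simp add: matrix_vector_mul_assoc invertible_matrix_inv)
  then have "matrix_inv A *v axis j 1 = (\<chi> k. det (\<chi> r c. if c = k then axis j 1 $ r else A $ r $ c) / det A)"
    using cramer[OF assms] by blast
  moreover have "matrix_inv A $ i $ j = (matrix_inv A *v axis j 1) $ i"
    by (simp add: matrix_vector_mul_component inner_axis)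
  ultimately show ?thesis by simp
qed

lemma tendsto_matrix_inv:
  fixes f :: "'z \<Rightarrow> real^'k^'k"
  assumes f: "(f \<longlongrightarrow> A) F" and inv: "invertible A"
  shows "((\<lambda>x. matrix_inv (f x)) \<longlongrightarrow> matrix_inv A) F" "eventually (\<lambda>x. invertible (f x)) F"
proof -
  have entry: "((\<lambda>x. f x $ i $ j) \<longlongrightarrow> A $ i $ j) F" for i j
    by (intro tendsto_vec_nth f)
  have det: "((\<lambda>x. det (f x)) \<longlongrightarrow> det A) F"
    by (rule tendsto_det[OF entry])
  have "det A \<noteq> 0" using inv by (simp add: invertible_det_nz)
  then have ev: "eventually (\<lambda>x. det (f x) \<noteq> 0) F"
    by (rule tendsto_imp_eventually_ne[OF det])
  then show "eventually (\<lambda>x. invertible (f x)) F" by (simp add: invertible_det_nz)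
  show "((\<lambda>x. matrix_inv (f x)) \<longlongrightarrow> matrix_inv A) F"
  proof (intro vec_tendstoI)
    fix i j
    have "((\<lambda>x. det (\<chi> r c. if c = i then axis j 1 $ r else f x $ r $ c) / det (f x))
        \<longlongrightarrow> det (\<chi> r c. if c = i then axis j 1 $ r else A $ r $ c) / det A) F"
      using \<open>det A \<noteq> 0\<close> by (intro tendsto_divide det tendsto_det) (auto intro: entry)
    then have "((\<lambda>x. det (\<chi> r c. if c = i then axis j 1 $ r else f x $ r $ c) / det (f x))
        \<longlongrightarrow> matrix_inv A $ i $ j) F"
      by (simp only: matrix_inv_cramer[OF \<open>det A \<noteq> 0\<close>])
    then show "((\<lambda>x. matrix_inv (f x) $ i $ j) \<longlongrightarrow> matrix_inv A $ i $ j) F"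
      by (rule Lim_transform_eventually) (rule eventually_mono[OF ev], simp add: matrix_inv_cramer)
  qed
qed

lemma tendsto_Delta:
  assumes "(f \<longlongrightarrow> A) F"
  shows "((\<lambda>x. Delta (f x)) \<longlongrightarrow> Delta A) F"
  unfolding Delta_def kron_def transpose_def
  by (intro tendsto_diff vec_tendstoI; simp; intro tendsto_mult tendsto_const tendsto_vec_nth assms)

lemma tendsto_gram:
  assumes "(f \<longlongrightarrow> A) F"
  shows "((\<lambda>x. gram \<Phi> (f x)) \<longlongrightarrow> gram \<Phi> A) F"
  unfolding gram_def
  by (intro tendsto_matrix_mult tendsto_transpose tendsto_Delta tendsto_const assms)

lemma tendsto_B_matrix:
  assumes "(f \<longlongrightarrow> Q) F" "invertible (gram \<Phi> Q)"
  shows "((\<lambda>x. B_matrix \<Phi> (f x) P) \<longlongrightarrow> B_matrix \<Phi> Q P) F"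
  unfolding B_matrix_def
  by (intro tendsto_matrix_mult tendsto_transpose tendsto_Delta tendsto_const
      tendsto_matrix_inv(1) tendsto_gram assms)

section \<open>Gram matrix, identifiability and the error of the estimator\<close>

lemma vectorize_add: "vectorize (A + B) = vectorize A + vectorize B"
  and vectorize_diff: "vectorize (A - B) = vectorize A - vectorize B"
  by (simp_all add: vectorize_def vec_eq_iff)

lemma vectorize_inject: "vectorize A = vectorize B \<longleftrightarrow> A = B"
  by (auto simp: vectorize_def vec_eq_iff)

lemma basis_matrix_mult: "basis_matrix \<phi> *v \<beta> = vectorize (\<Sum>b\<in>UNIV. \<beta> $ b *\<^sub>R \<phi> b)"
  by (simp add: vec_eq_iff basis_matrix_def matrix_vector_mult_def vectorize_def sum_component mult.commute)

lemma inner_transpose_mult: "x \<bullet> (transpose A *v y) = (A *v x) \<bullet> y" for A :: "real^'k^'m"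
  by (simp add: dot_lmul_matrix[symmetric] inner_commute)

text \<open>The quadratic form of the Gram matrix at x is the squared norm of the vectorized
  commutator of \<open>Q\<close> with the matrix Z that has coordinates x. A kernel vector thus
  gives a commuting Z in the span, which is 0 by assumption, and x = 0 follows by
  independence.\<close>

lemma gram_invertible:
  assumes "inj \<phi>" "independent (range \<phi>)"
    and ker: "\<And>Z. Z \<in> span (range \<phi>) \<Longrightarrow> Q ** Z = Z ** Q \<Longrightarrow> Z = 0"
  shows "invertible (gram (basis_matrix \<phi>) Q)"
proof -
  let ?\<Phi> = "basis_matrix \<phi>"
  have "x = 0" if "gram ?\<Phi> Q *v x = 0" for x
  proof -
    let ?v = "Delta Q *v (?\<Phi> *v x)" and ?Z = "\<Sum>b\<in>UNIV. x $ b *\<^sub>R \<phi> b"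
    have "?v \<bullet> ?v = x \<bullet> (gram ?\<Phi> Q *v x)"
      unfolding gram_def by (simp only: matrix_vector_mul_assoc[symmetric] inner_transpose_mult)
    then have "?v = 0" using that by simp
    then have "vectorize (Q ** ?Z - ?Z ** Q) = vectorize 0"
      by (simp add: basis_matrix_mult Delta_vectorize) (simp add: vectorize_def vec_eq_iff)
    then have "Q ** ?Z = ?Z ** Q" by (simp add: vectorize_inject)
    then have "?Z = 0"
      by (rule ker[rotated]) (intro span_sum span_scale span_base rangeI)
    have "x $ b = 0" for b
    proof -
      \<comment> \<open>Independence is a property of the set \<open>range \<phi>\<close>, so the
        coefficients are transported to it along the inverse of the injection \<phi>.\<close>
      have "(\<Sum>v\<in>range \<phi>. x $ inv \<phi> v *\<^sub>R v) = ?Z"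
        using assms(1) by (simp add: sum.reindex)
      then have "x $ inv \<phi> (\<phi> b) = 0"
        using \<open>?Z = 0\<close> independentD[OF assms(2), of "range \<phi>" "\<lambda>v. x $ inv \<phi> v" "\<phi> b"] by simp
      then show ?thesis using assms(1) by simp
    qed
    then show ?thesis by (simp add: vec_eq_iff)
  qed
  then show ?thesis
    using invertible_left_inverse matrix_left_invertible_ker by blast
qed

text \<open>The identity is exact, not a first-order expansion: the commutator of \<open>A\<close>
  and \<open>P\<close> is linear in \<open>A - Q\<close> because \<open>Q\<close> commutes with
  \<open>P\<close>. What is left of the delta method is the continuity of the matrix in
  front.\<close>

lemma estimate_error:
  assumes est: "is_estimate \<Phi> p\<^sub>0 A p" and inv: "invertible (gram \<Phi> A)"
    and P: "vectorize P = p\<^sub>0 + \<Phi> *v \<beta>" and comm: "P ** Q = Q ** P"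
  shows "p - vectorize P = B_matrix \<Phi> A P *v vectorize (A - Q)"
proof -
  define K where "K = \<Phi> ** matrix_inv (gram \<Phi> A) ** transpose \<Phi> ** transpose (Delta A)"
  have "Delta A *v vectorize P = vectorize ((A - Q) ** P - P ** (A - Q))"
    by (simp add: Delta_vectorize comm matrix_mult_diff_left matrix_mult_diff_right)
  also have "\<dots> = - (Delta P *v vectorize (A - Q))"
    unfolding Delta_vectorize vectorize_diff[of "_ ** _" "_ ** _"] by simp
  finally have \<Delta>P: "Delta A *v vectorize P = - (Delta P *v vectorize (A - Q))" .
  \<comment> \<open>\<open>K ** Delta A\<close> fixes the range of \<Phi>. Hence moving the base
    point along this range, in particular from \<open>P\<close> to the chosen one, does not change
    the estimate.\<close>
  have "K ** Delta A ** \<Phi> = \<Phi> ** (matrix_inv (gram \<Phi> A) ** gram \<Phi> A)"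
    by (simp add: K_def gram_def matrix_mul_assoc)
  then have K\<Phi>: "K ** Delta A ** \<Phi> = \<Phi>"
    using inv by (simp add: invertible_matrix_inv)
  have p0: "p\<^sub>0 = vectorize P - \<Phi> *v \<beta>" using P by simp
  have "p = (mat 1 - K ** Delta A) *v p\<^sub>0"
    using est inv unfolding is_estimate_def K_def by simp
  also have "\<dots> = p\<^sub>0 - (K ** Delta A) *v p\<^sub>0"
    by (simp add: matrix_vector_mult_diff_rdistrib)
  also have "(K ** Delta A) *v p\<^sub>0 = (K ** Delta A) *v vectorize P - (K ** Delta A ** \<Phi>) *v \<beta>"
    unfolding p0 by (simp add: matrix_vector_mult_diff_distrib matrix_vector_mul_assoc)
  also have "\<dots> = K *v (Delta A *v vectorize P) - \<Phi> *v \<beta>"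
    by (simp add: K\<Phi> matrix_vector_mul_assoc)
  also have "p\<^sub>0 - \<dots> = vectorize P + K *v (Delta P *v vectorize (A - Q))"
    unfolding p0 \<Delta>P by (simp add: linear_neg[OF matrix_vector_mul_linear])
  finally have "p - vectorize P = (K ** Delta P) *v vectorize (A - Q)"
    by (simp add: matrix_vector_mul_assoc)
  then show ?thesis by (simp add: B_matrix_def K_def)
qed

lemma supp_add: "supp (A + B) \<subseteq> supp A \<union> supp B"
  and supp_diff: "supp (A - B) \<subseteq> supp A \<union> supp B"
  by (auto simp: supp_def)

lemma aff_diff: "A \<in> aff S \<Longrightarrow> B \<in> aff S \<Longrightarrow> A - B \<in> aff_lin S"
  using supp_diff[of A B] by (auto simp: aff_def aff_lin_def matrix_vector_mult_diff_rdistrib)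

lemma aff_add_lin: "A \<in> aff S \<Longrightarrow> B \<in> aff_lin S \<Longrightarrow> A + B \<in> aff S"
  using supp_add[of A B] by (auto simp: aff_def aff_lin_def matrix_vector_mult_add_rdistrib)

text \<open>A nonzero commuting direction Z would give a second point P + Z of the affine space that
  commutes with \<open>Q\<close>.\<close>

lemma identifiable_kernel:
  assumes "aff S \<inter> Com Q = {P}" "Z \<in> aff_lin S" "Q ** Z = Z ** Q"
  shows "Z = 0"
proof -
  have "P \<in> aff S" "P ** Q = Q ** P" using assms(1) by (auto simp: Com_def)
  then have "P + Z \<in> aff S \<inter> Com Q"
    using assms(2,3) by (simp add: aff_add_lin Com_def matrix_add_ldistrib matrix_add_rdistrib)
  then show ?thesis using assms(1) by simp
qed

text \<open>Row \<open>i\<close> of the empirical matrix behaves like multinomial proportions, whose covariance factors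
  explicitly: \<open>\<Sum>m. (\<delta>\<^sub>j\<^sub>m - q\<^sub>j) (\<delta>\<^sub>l\<^sub>m - q\<^sub>l) q\<^sub>m = \<delta>\<^sub>j\<^sub>l q\<^sub>j - q\<^sub>j q\<^sub>l\<close>.\<close>

definition multinomial_root :: "real^'n^'n \<Rightarrow> real^'n \<Rightarrow> real^('n \<times> 'n)^('n \<times> 'n)" where
  "multinomial_root Q \<pi> = (\<chi> r c. if snd r = snd c
     then ((if fst r = fst c then 1 else 0) - Q $ snd r $ fst r) * sqrt (Q $ snd r $ fst c / \<pi> $ snd r) else 0)"

lemma asym_cov_root:
  fixes Q :: "real^'n^'n"
  assumes Q: "\<And>i j. 0 \<le> Q $ i $ j" "\<And>i. (\<Sum>j\<in>UNIV. Q $ i $ j) = 1" and \<pi>: "\<And>i. 0 < \<pi> $ i"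
  shows "asym_cov Q \<pi> = multinomial_root Q \<pi> ** transpose (multinomial_root Q \<pi>)"
proof -
  have "(multinomial_root Q \<pi> ** transpose (multinomial_root Q \<pi>)) $ (j, i) $ (l, k) = asym_cov Q \<pi> $ (j, i) $ (l, k)" for i j k l
  proof (cases "i = k")
    case False
    then have "(multinomial_root Q \<pi> ** transpose (multinomial_root Q \<pi>)) $ (j, i) $ (l, k) = 0"
      unfolding matrix_matrix_mult_def transpose_def multinomial_root_def
      by (auto intro!: sum.neutral)
    then show ?thesis using False by (simp add: asym_cov_def)
  next
    case True
    let ?d = "\<lambda>j m. (if j = m then 1 else 0) :: real"
    have "(multinomial_root Q \<pi> ** transpose (multinomial_root Q \<pi>)) $ (j, i) $ (l, k) =
        (\<Sum>m\<in>UNIV. \<Sum>a\<in>UNIV. if i = a then ((?d j m - Q $ i $ j) * sqrt (Q $ i $ m / \<pi> $ i)) * ((?d l m - Q $ i $ l) * sqrt (Q $ i $ m / \<pi> $ i)) else 0)"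
      unfolding sum.cartesian_product UNIV_Times_UNIV True[symmetric]
      unfolding matrix_matrix_mult_def transpose_def multinomial_root_def
      by (auto intro!: sum.cong)
    also have "\<dots> = (\<Sum>m\<in>UNIV. ((?d j m - Q $ i $ j) * (?d l m - Q $ i $ l)) * (Q $ i $ m / \<pi> $ i))"
    proof (intro sum.cong refl)
      fix m
      have r: "sqrt (Q $ i $ m / \<pi> $ i) * sqrt (Q $ i $ m / \<pi> $ i) = Q $ i $ m / \<pi> $ i"
        using Q(1)[of i m] \<pi>[of i] by simp
      \<comment> \<open>Brings the two equal square roots together, so that \<open>r\<close> can
        evaluate their product.\<close>
      have ac: "(x * z) * (y * z) = (x * y) * (z * z)" for x y z :: real
        by simp
      show "(\<Sum>a\<in>UNIV. if i = a then ((?d j m - Q $ i $ j) * sqrt (Q $ i $ m / \<pi> $ i)) * ((?d l m - Q $ i $ l) * sqrt (Q $ i $ m / \<pi> $ i)) else 0)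
          = ((?d j m - Q $ i $ j) * (?d l m - Q $ i $ l)) * (Q $ i $ m / \<pi> $ i)"
        by (simp only: sum.delta' finite UNIV_I if_True) (rule ac[of _ "sqrt (Q $ i $ m / \<pi> $ i)", unfolded r])
    qed
    also have "\<dots> = (\<Sum>m\<in>UNIV. ((?d j m - Q $ i $ j) * (?d l m - Q $ i $ l)) * Q $ i $ m) / \<pi> $ i"
      by (simp add: sum_divide_distrib)
    also have "(\<Sum>m\<in>UNIV. ((?d j m - Q $ i $ j) * (?d l m - Q $ i $ l)) * Q $ i $ m) =
        (\<Sum>m\<in>UNIV. (if j = m then (if l = j then Q $ i $ j else 0) else 0) - (if j = m then Q $ i $ l * Q $ i $ j else 0)
          - (if l = m then Q $ i $ j * Q $ i $ l else 0) + Q $ i $ j * Q $ i $ l * Q $ i $ m)"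
      by (intro sum.cong refl) (auto simp: algebra_simps)
    also have "\<dots> = (if l = j then Q $ i $ j else 0) - Q $ i $ l * Q $ i $ j - Q $ i $ j * Q $ i $ l
        + Q $ i $ j * Q $ i $ l * (\<Sum>m\<in>UNIV. Q $ i $ m)"
      by (simp add: sum.distrib sum_subtractf sum_distrib_left)
    also have "\<dots> = (if l = j then Q $ i $ j else 0) - Q $ i $ j * Q $ i $ l"
      by (simp add: Q(2))
    finally show ?thesis
      using True by (simp add: asym_cov_def right_diff_distrib)
  qed
  then show ?thesis by (simp add: vec_eq_iff split_paired_all)
qed

section \<open>The delta method\<close>

lemma norm_vectorize: "norm (vectorize A) = norm A"
proof -
  have "vectorize A \<bullet> vectorize A = (\<Sum>j\<in>UNIV. \<Sum>i\<in>UNIV. A $ i $ j * A $ i $ j)"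
    unfolding sum.cartesian_product by (simp add: inner_vec_def vectorize_def split_beta)
  also have "\<dots> = A \<bullet> A"
    unfolding inner_vec_def by (subst sum.swap) simp
  finally show ?thesis by (simp add: norm_eq_sqrt_inner)
qed

text \<open>The norm of a matrix as a nested vector is the Frobenius norm, and Cauchy-Schwarz
  applies row by row.\<close>

lemma norm_matrix_vector_le: "norm (A *v x) \<le> norm A * norm x" for A :: "real^'k^'m"
proof -
  have "norm (A *v x) = L2_set (\<lambda>i. \<bar>A $ i \<bullet> x\<bar>) UNIV"
    by (simp add: norm_vec_def matrix_vector_mul_component)
  also have "\<dots> \<le> L2_set (\<lambda>i. norm (A $ i) * norm x) UNIV"
    by (intro L2_set_mono Cauchy_Schwarz_ineq2) auto
  also have "\<dots> = norm A * norm x"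
    by (simp add: L2_set_left_distrib norm_vec_def)
  finally show ?thesis .
qed

lemma norm_iexp_diff_le: "norm (iexp a - iexp b) \<le> \<bar>a - b\<bar>"
proof -
  have "iexp a - iexp b = iexp b * (iexp (a - b) - 1)"
    by (simp add: right_diff_distrib exp_add[symmetric])
  then have "norm (iexp a - iexp b) = norm (iexp (a - b) - 1)"
    by (simp add: norm_mult)
  also have "\<dots> \<le> \<bar>a - b\<bar>"
    using iexp_approx1[of "a - b" 0] by simp
  finally show ?thesis .
qed

text \<open>The two exponentials differ by at most \<open>norm t * \<epsilon>\<close> where the
  variables are close, and by at most 2 on the rest, whose probability tends to 0.\<close>

lemma (in prob_space) char_slutsky:
  fixes Z U :: "nat \<Rightarrow> 'a \<Rightarrow> 'v::euclidean_space"
  assumes [measurable]: "\<And>n. Z n \<in> borel_measurable M" "\<And>n. U n \<in> borel_measurable M"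
    and close: "\<And>\<epsilon>. 0 < \<epsilon> \<Longrightarrow> (\<lambda>n. measure M {\<omega> \<in> space M. norm (Z n \<omega> - U n \<omega>) > \<epsilon>}) \<longlonglongrightarrow> 0"
    and lim: "(\<lambda>n. \<integral>\<omega>. iexp (t \<bullet> U n \<omega>) \<partial>M) \<longlonglongrightarrow> L"
  shows "(\<lambda>n. \<integral>\<omega>. iexp (t \<bullet> Z n \<omega>) \<partial>M) \<longlonglongrightarrow> L"
proof -
  have int: "integrable M (\<lambda>\<omega>. iexp (t \<bullet> W \<omega>))" if [measurable]: "W \<in> borel_measurable M" for W
    by (rule integrable_const_bound[of _ 1]) auto
  have "(\<lambda>n. (\<integral>\<omega>. iexp (t \<bullet> Z n \<omega>) \<partial>M) - (\<integral>\<omega>. iexp (t \<bullet> U n \<omega>) \<partial>M)) \<longlonglongrightarrow> 0"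
  proof (rule LIMSEQ_I)
    fix r :: real
    assume "0 < r"
    \<comment> \<open>Half of r pays for the first contribution, with 1 added to
      \<open>norm t\<close> to allow t = 0; the second is twice a probability below r / 4.\<close>
    define \<epsilon> where "\<epsilon> = r / 2 / (norm t + 1)"
    have \<epsilon>: "0 < \<epsilon>" using \<open>0 < r\<close> by (simp add: \<epsilon>_def add_nonneg_pos)
    have t\<epsilon>: "norm t * \<epsilon> < r / 2"
    proof -
      define N where "N = norm t + 1"
      have "N > 0" unfolding N_def by (simp add: add_nonneg_pos)
      then have "N * \<epsilon> = r / 2" unfolding \<epsilon>_def N_def[symmetric] by simp
      then have "(norm t + 1) * \<epsilon> = r / 2" by (simp only: N_def)
      then show ?thesis using \<epsilon> by (simp add: distrib_right)
    qed
    have bound: "norm ((\<integral>\<omega>. iexp (t \<bullet> Z n \<omega>) \<partial>M) - (\<integral>\<omega>. iexp (t \<bullet> U n \<omega>) \<partial>M)) \<le>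
        norm t * \<epsilon> + 2 * measure M {\<omega> \<in> space M. norm (Z n \<omega> - U n \<omega>) > \<epsilon>}" for n
    proof -
      let ?E = "{\<omega> \<in> space M. norm (Z n \<omega> - U n \<omega>) > \<epsilon>}"
      have i: "integrable M (indicator ?E :: 'a \<Rightarrow> real)"
        by (rule integrable_real_indicator) (auto simp: emeasure_eq_measure)
      have pt: "norm (iexp (t \<bullet> Z n \<omega>) - iexp (t \<bullet> U n \<omega>)) \<le> norm t * \<epsilon> + 2 * indicator ?E \<omega>"
        if "\<omega> \<in> space M" for \<omega>
      proof (cases "\<omega> \<in> ?E")
        case True
        have "norm (iexp (t \<bullet> Z n \<omega>) - iexp (t \<bullet> U n \<omega>)) \<le> 2"
          using norm_triangle_ineq4[of "iexp (t \<bullet> Z n \<omega>)" "iexp (t \<bullet> U n \<omega>)"] by simp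
        then show ?thesis using True \<epsilon> by (simp add: add_increasing)
      next
        case False
        have "norm (iexp (t \<bullet> Z n \<omega>) - iexp (t \<bullet> U n \<omega>)) \<le> \<bar>t \<bullet> (Z n \<omega> - U n \<omega>)\<bar>"
          using norm_iexp_diff_le by (simp add: inner_diff_right)
        also have "\<dots> \<le> norm t * norm (Z n \<omega> - U n \<omega>)" by (rule Cauchy_Schwarz_ineq2)
        also have "\<dots> \<le> norm t * \<epsilon>" using False that by (intro mult_left_mono) auto
        finally show ?thesis using False by simp
      qed
      have "norm ((\<integral>\<omega>. iexp (t \<bullet> Z n \<omega>) \<partial>M) - (\<integral>\<omega>. iexp (t \<bullet> U n \<omega>) \<partial>M)) =
          norm (\<integral>\<omega>. iexp (t \<bullet> Z n \<omega>) - iexp (t \<bullet> U n \<omega>) \<partial>M)"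
        by (subst Bochner_Integration.integral_diff) (auto intro!: int)
      also have "\<dots> \<le> (\<integral>\<omega>. norm (iexp (t \<bullet> Z n \<omega>) - iexp (t \<bullet> U n \<omega>)) \<partial>M)"
        by (rule integral_norm_bound)
      also have "\<dots> \<le> (\<integral>\<omega>. norm t * \<epsilon> + 2 * indicator ?E \<omega> \<partial>M)"
        using i by (intro integral_mono integrable_norm Bochner_Integration.integrable_diff int pt) auto
      also have "\<dots> = norm t * \<epsilon> + 2 * (\<integral>\<omega>. indicator ?E \<omega> \<partial>M)"
        using i by (simp add: prob_space)
      also have "(\<integral>\<omega>. indicator ?E \<omega> \<partial>M) = measure M (?E \<inter> space M)"
        by (rule Bochner_Integration.integral_indicator)
      also have "?E \<inter> space M = ?E" by auto
      finally show ?thesis .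
    qed
    have "eventually (\<lambda>n. measure M {\<omega> \<in> space M. norm (Z n \<omega> - U n \<omega>) > \<epsilon>} < r / 4) sequentially"
      using \<open>0 < r\<close> by (intro order_tendstoD(2)[OF close[OF \<epsilon>]]) simp
    then have "eventually (\<lambda>n. norm ((\<integral>\<omega>. iexp (t \<bullet> Z n \<omega>) \<partial>M) - (\<integral>\<omega>. iexp (t \<bullet> U n \<omega>) \<partial>M)) < r) sequentially"
    proof eventually_elim
      case (elim n)
      show ?case using bound[of n] elim t\<epsilon> by linarith
    qed
    then show "\<exists>no. \<forall>n\<ge>no. norm ((\<integral>\<omega>. iexp (t \<bullet> Z n \<omega>) \<partial>M) - (\<integral>\<omega>. iexp (t \<bullet> U n \<omega>) \<partial>M) - 0) < r"
      by (simp add: eventually_sequentially)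
  qed
  from tendsto_add[OF this lim] show ?thesis by simp
qed

section \<open>The normalised error of the empirical matrix\<close>

context ergodic_chain
begin

text \<open>The compensated indicator of a transition: i and j name the matrix entry, a and b the
  observed transition. Subtracting \<open>Q $ i $ j\<close> at each visit of i makes the conditional
  mean vanish.\<close>

definition dev :: "'n \<Rightarrow> 'n \<Rightarrow> 'n \<Rightarrow> 'n \<Rightarrow> real" where
  "dev i j a b = (if a = i then (if b = j then 1 else 0) - Q $ i $ j else 0)"

text \<open>Normalised by the stationary weight instead of the number of visits, the error of the empirical
  matrix is a martingale, linear in the observed transitions.\<close>

definition scaled_dev :: "nat \<Rightarrow> 'a \<Rightarrow> real^('n \<times> 'n)" where
  "scaled_dev n \<omega> = (\<chi> c. msum (dev (snd c) (fst c)) n \<omega> / (\<pi> $ snd c * sqrt (real n)))"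

lemma pi_pos: "0 < \<pi> $ i"
  by (rule invariant_distribution_pos[OF stoch irr inv])

lemma scaled_dev_measurable [measurable]: "scaled_dev n \<in> borel_measurable M"
proof -
  have "scaled_dev n = (\<lambda>\<omega>. \<Sum>c\<in>UNIV. (msum (dev (snd c) (fst c)) n \<omega> / (\<pi> $ snd c * sqrt (real n))) *\<^sub>R axis c 1)"
    by (simp add: scaled_dev_def fun_eq_iff vec_eq_iff sum_component axis_def if_distrib[of "\<lambda>x. _ * x"] cong: if_cong)
  then show ?thesis by simp
qed

lemma dev_mart: "(\<Sum>b\<in>UNIV. Q $ a $ b * dev i j a b) = 0"
proof (cases "a = i")
  case True
  have "(\<Sum>b\<in>UNIV. Q $ i $ b * dev i j i b) = (\<Sum>b\<in>UNIV. (if b = j then Q $ i $ j else 0) - Q $ i $ b * Q $ i $ j)"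
    by (intro sum.cong) (auto simp: dev_def algebra_simps)
  also have "\<dots> = 0"
    by (simp add: sum_subtractf sum_distrib_right[symmetric] Q_sum)
  finally show ?thesis using True by simp
qed (simp add: dev_def)

lemma dev_bound: "\<bar>dev i j a b\<bar> \<le> 1"
  using Q_nonneg[of i j] stochastic_le_1[OF stoch, of i j] by (auto simp: dev_def)

lemma msum_dev:
  "msum (dev i j) n \<omega> = real (card {k\<in>{1..<n}. Y k \<omega> = i \<and> Y (Suc k) \<omega> = j}) - Q $ i $ j * visits i n \<omega>"
proof -
  have "msum (dev i j) n \<omega> = (\<Sum>k\<in>{1..<n}. (if Y k \<omega> = i \<and> Y (Suc k) \<omega> = j then 1 else 0)
      - Q $ i $ j * (if Y k \<omega> = i then 1 else 0))"
    unfolding msum_def dev_def by (intro sum.cong) auto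
  also have "\<dots> = (\<Sum>k\<in>{1..<n}. if Y k \<omega> = i \<and> Y (Suc k) \<omega> = j then 1 else 0) - Q $ i $ j * visits i n \<omega>"
    unfolding visits_sum by (simp only: sum_subtractf sum_distrib_left)
  also have "(\<Sum>k\<in>{1..<n}. if Y k \<omega> = i \<and> Y (Suc k) \<omega> = j then 1 else 0) =
      real (card {k\<in>{1..<n}. Y k \<omega> = i \<and> Y (Suc k) \<omega> = j})"
    by (simp add: sum.If_cases Int_def)
  finally show ?thesis .
qed

lemma empirical_error:
  assumes "is_empirical (\<lambda>k. Y k \<omega>) n A" "visits i n \<omega> \<noteq> 0"
  shows "A $ i $ j - Q $ i $ j = msum (dev i j) n \<omega> / visits i n \<omega>"
proof -
  have "A $ i $ j = real (card {k\<in>{1..<n}. Y k \<omega> = i \<and> Y (Suc k) \<omega> = j}) / visits i n \<omega>"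
    using assms unfolding is_empirical_def visits_def by simp
  then show ?thesis
    using assms(2) by (simp add: msum_dev diff_divide_distrib)
qed

text \<open>Tightness, uniform in n: the second moment of each martingale sum is at most n, which
  the factor sqrt n in the normalisation compensates.\<close>

lemma scaled_dev_tail:
  "\<exists>C. \<forall>n K. 0 < K \<longrightarrow> measure M {\<omega> \<in> space M. K \<le> norm (scaled_dev n \<omega>)} \<le> C / K\<^sup>2"
proof (intro exI allI impI)
  fix n and K :: real
  assume "0 < K"
  let ?C = "\<Sum>c\<in>(UNIV :: ('n \<times> 'n) set). 1 / (\<pi> $ snd c)\<^sup>2"
  have sq: "(norm (scaled_dev n \<omega>))\<^sup>2 = (\<Sum>c\<in>UNIV. (1 / (\<pi> $ snd c * sqrt (real n)))\<^sup>2 * (msum (dev (snd c) (fst c)) n \<omega>)\<^sup>2)" for \<omega>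
    unfolding power2_norm_eq_inner inner_vec_def
    by (intro sum.cong refl) (simp add: scaled_dev_def power2_eq_square mult_ac)
  have int: "integrable M (\<lambda>\<omega>. (msum g n \<omega>)\<^sup>2)" for g
    by (rule past_fun_integrable[OF msum_past])
  then have int': "integrable M (\<lambda>\<omega>. (norm (scaled_dev n \<omega>))\<^sup>2)"
    unfolding sq by simp
  have "measure M {\<omega> \<in> space M. K \<le> norm (scaled_dev n \<omega>)} = measure M {\<omega> \<in> space M. K\<^sup>2 \<le> (norm (scaled_dev n \<omega>))\<^sup>2}"
    using \<open>0 < K\<close> by (intro arg_cong[where f="measure M"]) (auto simp: abs_le_square_iff[symmetric])
  also have "\<dots> \<le> (\<integral>\<omega>. (norm (scaled_dev n \<omega>))\<^sup>2 \<partial>M) / K\<^sup>2"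
    using \<open>0 < K\<close> int' by (intro integral_Markov_inequality_measure[of _ _ "{}", simplified]) auto
  also have "\<dots> \<le> ?C / K\<^sup>2"
  proof (rule divide_right_mono)
    have "(\<integral>\<omega>. (norm (scaled_dev n \<omega>))\<^sup>2 \<partial>M) =
        (\<Sum>c\<in>UNIV. (1 / (\<pi> $ snd c * sqrt (real n)))\<^sup>2 * (\<integral>\<omega>. (msum (dev (snd c) (fst c)) n \<omega>)\<^sup>2 \<partial>M))"
      unfolding sq using int by simp
    also have "\<dots> \<le> ?C"
    proof (rule sum_mono)
      fix c :: "'n \<times> 'n"
      have "(1 / (\<pi> $ snd c * sqrt (real n)))\<^sup>2 * (\<integral>\<omega>. (msum (dev (snd c) (fst c)) n \<omega>)\<^sup>2 \<partial>M) \<le>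
          (1 / (\<pi> $ snd c * sqrt (real n)))\<^sup>2 * (real n * 1\<^sup>2)"
        by (intro mult_left_mono msum_second_moment dev_mart dev_bound) auto
      also have "\<dots> \<le> 1 / (\<pi> $ snd c)\<^sup>2"
        by (cases "n = 0") (simp_all add: power_divide power_mult_distrib)
      finally show "(1 / (\<pi> $ snd c * sqrt (real n)))\<^sup>2 * (\<integral>\<omega>. (msum (dev (snd c) (fst c)) n \<omega>)\<^sup>2 \<partial>M) \<le> 1 / (\<pi> $ snd c)\<^sup>2" .
    qed
    finally show "(\<integral>\<omega>. (norm (scaled_dev n \<omega>))\<^sup>2 \<partial>M) \<le> ?C" .
  qed simp
  finally show "measure M {\<omega> \<in> space M. K \<le> norm (scaled_dev n \<omega>)} \<le> ?C / K\<^sup>2" .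
qed

text \<open>The Cramer-Wold reduction: a linear functional of \<open>scaled_dev\<close> is again a
  martingale sum, for the single function \<open>G\<close>, so the scalar limit applies. It remains
  to recognise its variance as the quadratic form of the asymptotic covariance.\<close>

lemma scaled_dev_char_limit:
  "(\<lambda>n. \<integral>\<omega>. iexp (y \<bullet> scaled_dev n \<omega>) \<partial>M) \<longlonglongrightarrow> of_real (exp (- (y \<bullet> (asym_cov Q \<pi> *v y)) / 2))"
proof -
  define G where "G a b = (y $ (b, a) - (\<Sum>j\<in>UNIV. Q $ a $ j * y $ (j, a))) / \<pi> $ a" for a b
  have G: "(\<Sum>c\<in>UNIV. y $ c / \<pi> $ snd c * dev (snd c) (fst c) a b) = G a b" for a b
  proof -
    have "(\<Sum>c\<in>UNIV. y $ c / \<pi> $ snd c * dev (snd c) (fst c) a b) =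
        (\<Sum>j\<in>UNIV. \<Sum>i\<in>UNIV. y $ (j, i) / \<pi> $ i * dev i j a b)"
      unfolding sum.cartesian_product by (simp add: split_beta)
    also have "\<dots> = (\<Sum>j\<in>UNIV. \<Sum>i\<in>UNIV. if a = i then y $ (j, i) / \<pi> $ i * ((if b = j then 1 else 0) - Q $ i $ j) else 0)"
      by (intro sum.cong) (auto simp: dev_def)
    also have "\<dots> = (\<Sum>j\<in>UNIV. y $ (j, a) / \<pi> $ a * ((if b = j then 1 else 0) - Q $ a $ j))"
      by (simp only: sum.delta' finite UNIV_I if_True)
    also have "\<dots> = (\<Sum>j\<in>UNIV. (if b = j then y $ (j, a) / \<pi> $ a else 0) - Q $ a $ j * y $ (j, a) / \<pi> $ a)"
      by (intro sum.cong) (auto simp: algebra_simps)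
    also have "\<dots> = G a b"
      by (simp add: sum_subtractf G_def diff_divide_distrib sum_divide_distrib)
    finally show ?thesis .
  qed
  have lin: "y \<bullet> scaled_dev n \<omega> = msum G n \<omega> / sqrt (real n)" for n \<omega>
  proof -
    have "y \<bullet> scaled_dev n \<omega> = (\<Sum>c\<in>UNIV. \<Sum>k\<in>{1..<n}. y $ c / \<pi> $ snd c * dev (snd c) (fst c) (Y k \<omega>) (Y (Suc k) \<omega>)) / sqrt (real n)"
      by (simp add: inner_vec_def scaled_dev_def msum_def sum_divide_distrib sum_distrib_left)
    also have "\<dots> = (\<Sum>k\<in>{1..<n}. \<Sum>c\<in>UNIV. y $ c / \<pi> $ snd c * dev (snd c) (fst c) (Y k \<omega>) (Y (Suc k) \<omega>)) / sqrt (real n)"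
      by (subst sum.swap) (rule refl)
    finally show ?thesis by (simp only: G msum_def)
  qed
  have mart: "(\<Sum>j\<in>UNIV. Q $ i $ j * G i j) = 0" for i
  proof -
    have "(\<Sum>j\<in>UNIV. Q $ i $ j * G i j) = (\<Sum>j\<in>UNIV. \<Sum>c\<in>UNIV. y $ c / \<pi> $ snd c * (Q $ i $ j * dev (snd c) (fst c) i j))"
      by (simp add: G[symmetric] sum_distrib_left mult_ac)
    also have "\<dots> = (\<Sum>c\<in>UNIV. y $ c / \<pi> $ snd c * (\<Sum>j\<in>UNIV. Q $ i $ j * dev (snd c) (fst c) i j))"
      by (subst sum.swap) (simp add: sum_distrib_left)
    finally show ?thesis by (simp add: dev_mart)
  qed
  have var: "(\<Sum>i\<in>UNIV. \<pi> $ i * (\<Sum>j\<in>UNIV. Q $ i $ j * (G i j)\<^sup>2)) = y \<bullet> (asym_cov Q \<pi> *v y)"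
  proof -
    let ?R = "multinomial_root Q \<pi>"
    \<comment> \<open>Applying the factor of the covariance to y centres each row of y under
      \<open>Q\<close>; up to the weight this is \<open>G\<close>, so squared norm and variance can
      be compared term by term.\<close>
    have root: "(y v* ?R) $ (m, i) = sqrt (Q $ i $ m / \<pi> $ i) * (\<pi> $ i * G i m)" for i m
    proof -
      have "(y v* ?R) $ (m, i) = (\<Sum>j\<in>UNIV. \<Sum>a\<in>UNIV. ?R $ (j, a) $ (m, i) * y $ (j, a))"
        unfolding sum.cartesian_product by (simp add: vector_matrix_mult_def split_beta mult.commute)
      also have "\<dots> = (\<Sum>j\<in>UNIV. \<Sum>a\<in>UNIV. if a = i then ((if j = m then 1 else 0) - Q $ a $ j) * sqrt (Q $ a $ m / \<pi> $ a) * y $ (j, a) else 0)"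
        by (intro sum.cong) (auto simp: multinomial_root_def)
      also have "\<dots> = (\<Sum>j\<in>UNIV. ((if j = m then 1 else 0) - Q $ i $ j) * sqrt (Q $ i $ m / \<pi> $ i) * y $ (j, i))"
        by (simp only: sum.delta finite UNIV_I if_True)
      also have "\<dots> = sqrt (Q $ i $ m / \<pi> $ i) * (\<Sum>j\<in>UNIV. (if j = m then y $ (j, i) else 0) - Q $ i $ j * y $ (j, i))"
        unfolding sum_distrib_left by (intro sum.cong) (auto simp: algebra_simps)
      also have "(\<Sum>j\<in>UNIV. (if j = m then y $ (j, i) else 0) - Q $ i $ j * y $ (j, i)) = \<pi> $ i * G i m"
        using pi_pos[of i] by (simp add: sum_subtractf G_def)
      finally show ?thesis .
    qed
    have "y \<bullet> (asym_cov Q \<pi> *v y) = (y v* ?R) \<bullet> (y v* ?R)"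
      unfolding asym_cov_root[OF Q_nonneg Q_sum pi_pos]
      by (simp add: matrix_vector_mul_assoc[symmetric] dot_lmul_matrix)
    also have "\<dots> = (\<Sum>m\<in>UNIV. \<Sum>i\<in>UNIV. (sqrt (Q $ i $ m / \<pi> $ i) * (\<pi> $ i * G i m))\<^sup>2)"
      unfolding sum.cartesian_product by (simp add: inner_vec_def split_beta root[symmetric] power2_eq_square)
    also have "\<dots> = (\<Sum>i\<in>UNIV. \<Sum>m\<in>UNIV. \<pi> $ i * (Q $ i $ m * (G i m)\<^sup>2))"
    proof (subst sum.swap, intro sum.cong refl)
      fix i m
      have "(sqrt (Q $ i $ m / \<pi> $ i))\<^sup>2 = Q $ i $ m / \<pi> $ i"
        using Q_nonneg[of i m] pi_pos[of i] by simp
      then show "(sqrt (Q $ i $ m / \<pi> $ i) * (\<pi> $ i * G i m))\<^sup>2 = \<pi> $ i * (Q $ i $ m * (G i m)\<^sup>2)"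
        using pi_pos[of i] by (simp only: power_mult_distrib) (simp add: power2_eq_square)
    qed
    finally show ?thesis by (simp add: sum_distrib_left)
  qed
  show ?thesis
    using msum_char_limit[OF mart] unfolding var lin .
qed

text \<open>On the event that all visit frequencies are near \<pi> and \<open>scaled_dev\<close> is
  bounded, the conclusion holds for each outcome separately. The matrices
  \<open>A n \<omega>\<close> enter only this pointwise part, so no measurability of them is
  involved.\<close>

lemma delta_method:
  fixes est :: "nat \<Rightarrow> 'a \<Rightarrow> real^'k" and Bf :: "real^'n^'n \<Rightarrow> real^('n \<times> 'n)^'k"
  assumes est [measurable]: "\<And>n. est n \<in> borel_measurable M"
    and emp: "\<And>n \<omega>. \<omega> \<in> space M \<Longrightarrow> is_empirical (\<lambda>k. Y k \<omega>) n (A n \<omega>)"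
    and B: "(Bf \<longlongrightarrow> B) (nhds Q)" and good: "eventually good (nhds Q)"
    and lin: "\<And>n \<omega>. \<omega> \<in> space M \<Longrightarrow> good (A n \<omega>) \<Longrightarrow> est n \<omega> - p = Bf (A n \<omega>) *v vectorize (A n \<omega> - Q)"
    and "0 < \<epsilon>"
  shows "(\<lambda>n. measure M {\<omega> \<in> space M. norm (sqrt (real n) *\<^sub>R (est n \<omega> - p) - B *v scaled_dev n \<omega>) > \<epsilon>}) \<longlonglongrightarrow> 0"
proof (rule LIMSEQ_I)
  fix r :: real
  assume "0 < r"
  obtain C where C: "\<And>n K. 0 < K \<Longrightarrow> measure M {\<omega> \<in> space M. K \<le> norm (scaled_dev n \<omega>)} \<le> C / K\<^sup>2"
    using scaled_dev_tail by blast
  \<comment> \<open>Chosen so that the tail bound \<open>C / K\<^sup>2\<close> is below r / 2; the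
    summand 1 keeps \<open>K\<close> positive when the constant C is 0.\<close>
  define K where "K = sqrt (2 * \<bar>C\<bar> / r + 1)"
  have K2: "K\<^sup>2 = 2 * \<bar>C\<bar> / r + 1"
    using \<open>0 < r\<close> unfolding K_def by (intro real_sqrt_pow2) auto
  have K: "0 < K" using \<open>0 < r\<close> unfolding K_def by (intro real_sqrt_gt_zero add_nonneg_pos) auto
  have "C < (2 * \<bar>C\<bar> / r + 1) * (r / 2)"
    using \<open>0 < r\<close> by (simp add: field_simps abs_if)
  then have CK: "C / K\<^sup>2 < r / 2"
    unfolding K2 using \<open>0 < r\<close> by (subst pos_divide_less_eq) (auto simp: mult.commute intro: add_nonneg_pos)
  define m where "m = Min (range (\<lambda>i. \<pi> $ i))"
  have m: "0 < m" "\<And>i. m \<le> \<pi> $ i"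
    unfolding m_def using pi_pos by (auto simp: Min_gr_iff)
  \<comment> \<open>The vector \<open>V + E\<close> below has norm at most 2 K, so replacing
    \<open>Bf (A n \<omega>)\<close> by \<open>B\<close> costs at most \<epsilon> / 2.\<close>
  define \<eta> where "\<eta> = \<epsilon> / (4 * K)"
  have \<eta>: "0 < \<eta>" using \<open>0 < \<epsilon>\<close> K by (simp add: \<eta>_def)
  have "eventually (\<lambda>A. good A \<and> dist (Bf A) B < \<eta>) (nhds Q)"
    using good tendstoD[OF B \<eta>] by (rule eventually_conj)
  then obtain \<delta> where \<delta>: "0 < \<delta>" "\<And>A. dist A Q < \<delta> \<Longrightarrow> good A \<and> dist (Bf A) B < \<eta>"
    unfolding eventually_nhds_metric by blast
  \<comment> \<open>The first bound keeps every visit frequency above m / 2; the second makes the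
    cost of the normalisation, \<open>norm B * (a * K)\<close>, at most \<epsilon> / 2.\<close>
  define \<gamma> where "\<gamma> = min (m / 2) (m * (\<epsilon> / (4 * K * (norm B + 1))))"
  have \<gamma>: "0 < \<gamma>" "\<gamma> \<le> m / 2" "\<gamma> \<le> m * (\<epsilon> / (4 * K * (norm B + 1)))"
    using m(1) \<open>0 < \<epsilon>\<close> K by (auto simp: \<gamma>_def intro!: mult_pos_pos divide_pos_pos add_nonneg_pos)
  \<comment> \<open>This is \<gamma> / (m / 2), a bound for the relative deviation of the visit
    frequencies from \<pi>.\<close>
  define a where "a = 2 * \<gamma> / m"
  have a: "0 < a" "a \<le> 1" "a * (norm B + 1) \<le> \<epsilon> / (2 * K)"
  proof -
    show "0 < a" "a \<le> 1" using \<gamma> m(1) by (auto simp: a_def)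
    have "a \<le> 2 * (m * (\<epsilon> / (4 * K * (norm B + 1)))) / m"
      unfolding a_def using \<gamma>(3) m(1) by (intro divide_right_mono mult_left_mono) auto
    also have "\<dots> = (\<epsilon> / (2 * K)) / (norm B + 1)"
      using m(1) by simp
    finally show "a * (norm B + 1) \<le> \<epsilon> / (2 * K)"
      by (subst (asm) pos_le_divide_eq) (auto intro: add_nonneg_pos)
  qed
  have det: "norm (sqrt (real n) *\<^sub>R (est n \<omega> - p) - B *v scaled_dev n \<omega>) \<le> \<epsilon>"
    if \<omega>: "\<omega> \<in> space M" and n: "1 \<le> n" "2 * K / sqrt (real n) < \<delta>"
      and vis: "\<And>i. \<bar>visits i n \<omega> / real n - \<pi> $ i\<bar> < \<gamma>" and V: "norm (scaled_dev n \<omega>) < K" for n \<omega>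
  proof -
    define V where "V = scaled_dev n \<omega>"
    define x where "x i = visits i n \<omega> / real n" for i
    have x: "m / 2 \<le> x i" "\<bar>\<pi> $ i - x i\<bar> \<le> \<gamma>" for i
      using vis[of i] \<gamma>(2) m(2)[of i] by (auto simp: x_def)
    have x0: "0 < x i" for i using x(1)[of i] m(1) by linarith
    have sn: "0 < sqrt (real n)" using n(1) by simp
    define D where "D = vectorize (A n \<omega> - Q)"
    \<comment> \<open>The discrepancy between dividing by the number of visits and dividing by n
      \<pi>; each coordinate is that of \<open>V\<close> times the relative deviation of a
      frequency.\<close>
    define E where "E = sqrt (real n) *\<^sub>R D - V"
    have entry: "E $ c = ((\<pi> $ snd c - x (snd c)) / x (snd c)) * V $ c" for c
    proof -
      let ?i = "snd c" and ?j = "fst c"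
      have vn: "visits ?i n \<omega> = real n * x ?i" using n(1) by (simp add: x_def)
      then have "visits ?i n \<omega> \<noteq> 0" using x0[of ?i] n(1) by simp
      then have D: "D $ c = msum (dev ?i ?j) n \<omega> / (real n * x ?i)"
        using empirical_error[OF emp[OF \<omega>], where i="?i" and j="?j"] by (simp add: D_def vectorize_def vn)
      have "msum (dev ?i ?j) n \<omega> = V $ c * (\<pi> $ ?i * sqrt (real n))"
        using pi_pos[of ?i] sn by (simp add: V_def scaled_dev_def)
      then have "sqrt (real n) * D $ c = (sqrt (real n) * sqrt (real n)) * (V $ c * \<pi> $ ?i) / (real n * x ?i)"
        unfolding D by (simp only: times_divide_eq_right mult_ac)
      also have "\<dots> = V $ c * \<pi> $ ?i / x ?i"
        using n(1) by simp
      finally have "sqrt (real n) * D $ c = V $ c * \<pi> $ ?i / x ?i" .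
      then show ?thesis
        using x0[of ?i] by (simp add: E_def field_simps)
    qed
    have E: "norm E \<le> a * norm V"
    proof -
      have "norm (E $ c) \<le> norm ((a *\<^sub>R V) $ c)" for c
      proof -
        have "\<bar>\<pi> $ snd c - x (snd c)\<bar> / x (snd c) \<le> \<gamma> / (m / 2)"
          using x[of "snd c"] m(1) \<gamma>(1) by (intro frac_le) auto
        also have "\<dots> = a" by (simp add: a_def)
        finally have "\<bar>\<pi> $ snd c - x (snd c)\<bar> / x (snd c) * \<bar>V $ c\<bar> \<le> a * \<bar>V $ c\<bar>"
          by (intro mult_right_mono) auto
        then show ?thesis using x0[of "snd c"] a(1) by (simp add: entry abs_mult)
      qed
      then have "norm E \<le> norm (a *\<^sub>R V)" by (rule norm_le_componentwise_cart)
      then show ?thesis using a(1) by simp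
    qed
    have VK: "norm V < K" using V by (simp add: V_def)
    have EK: "norm E \<le> a * K"
      using E VK a(1) by (meson less_imp_le mult_left_mono order_trans)
    have VE: "norm (V + E) \<le> 2 * K"
    proof -
      have "norm E \<le> 1 * K" using EK a(2) K by (meson less_imp_le mult_right_mono order_trans)
      then show ?thesis using norm_triangle_ineq[of V E] VK by linarith
    qed
    have "norm (A n \<omega> - Q) = norm D" by (simp add: D_def norm_vectorize)
    also have "\<dots> = norm (V + E) / sqrt (real n)" using sn by (simp add: E_def)
    also have "\<dots> \<le> 2 * K / sqrt (real n)" using VE sn by (intro divide_right_mono) auto
    finally have "dist (A n \<omega>) Q < \<delta>" using n(2) by (simp add: dist_norm)
    then have gA: "good (A n \<omega>)" and BA: "norm (Bf (A n \<omega>) - B) < \<eta>"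
      using \<delta>(2) by (auto simp: dist_norm)
    have "sqrt (real n) *\<^sub>R (est n \<omega> - p) = Bf (A n \<omega>) *v (V + E)"
      unfolding lin[OF \<omega> gA] by (simp add: E_def D_def matrix_vector_mult_scaleR)
    then have "sqrt (real n) *\<^sub>R (est n \<omega> - p) - B *v V = (Bf (A n \<omega>) - B) *v (V + E) + B *v E"
      by (simp add: matrix_vector_mult_diff_rdistrib matrix_vector_right_distrib)
    also have "norm \<dots> \<le> norm (Bf (A n \<omega>) - B) * norm (V + E) + norm B * norm E"
      by (intro order_trans[OF norm_triangle_ineq] add_mono norm_matrix_vector_le)
    also have "\<dots> \<le> \<eta> * (2 * K) + norm B * (a * K)"
      using BA VE EK \<eta> by (intro add_mono mult_mono) auto
    also have "norm B * (a * K) \<le> (\<epsilon> / (2 * K)) * K"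
    proof -
      have "norm B * a \<le> a * (norm B + 1)" using a(1) by (simp add: algebra_simps)
      also note a(3)
      finally have "norm B * a * K \<le> \<epsilon> / (2 * K) * K" using K by (intro mult_right_mono) auto
      then show ?thesis by (simp add: mult.assoc)
    qed
    also have "\<eta> * (2 * K) + (\<epsilon> / (2 * K)) * K = \<epsilon>"
      using K by (simp add: \<eta>_def field_simps)
    finally show ?thesis by (simp add: V_def)
  qed
  have "(\<lambda>n. \<Sum>i\<in>UNIV. measure M {\<omega> \<in> space M. \<gamma> \<le> \<bar>visits i n \<omega> / real n - \<pi> $ i\<bar>}) \<longlonglongrightarrow> (\<Sum>i\<in>(UNIV :: 'n set). 0)"
    by (intro tendsto_sum visits_in_prob \<gamma>(1))
  then have "(\<lambda>n. \<Sum>i\<in>UNIV. measure M {\<omega> \<in> space M. \<gamma> \<le> \<bar>visits i n \<omega> / real n - \<pi> $ i\<bar>}) \<longlonglongrightarrow> 0"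
    by simp
  from order_tendstoD(2)[OF this, of "r / 2"]
  have "eventually (\<lambda>n. (\<Sum>i\<in>UNIV. measure M {\<omega> \<in> space M. \<gamma> \<le> \<bar>visits i n \<omega> / real n - \<pi> $ i\<bar>}) < r / 2) sequentially"
    using \<open>0 < r\<close> by simp
  moreover have "eventually (\<lambda>n. 2 * K / sqrt (real n) < \<delta>) sequentially"
    using \<delta>(1) by real_asymp
  ultimately have "eventually (\<lambda>n. measure M {\<omega> \<in> space M. norm (sqrt (real n) *\<^sub>R (est n \<omega> - p) - B *v scaled_dev n \<omega>) > \<epsilon>} < r) sequentially"
    using eventually_ge_at_top[of 1]
  proof eventually_elim
    case (elim n)
    let ?U = "\<lambda>i. {\<omega> \<in> space M. \<gamma> \<le> \<bar>visits i n \<omega> / real n - \<pi> $ i\<bar>}"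
    let ?T = "{\<omega> \<in> space M. K \<le> norm (scaled_dev n \<omega>)}"
    have "{\<omega> \<in> space M. norm (sqrt (real n) *\<^sub>R (est n \<omega> - p) - B *v scaled_dev n \<omega>) > \<epsilon>} \<subseteq> (\<Union>i. ?U i) \<union> ?T"
    proof
      fix \<omega>
      assume "\<omega> \<in> {\<omega> \<in> space M. norm (sqrt (real n) *\<^sub>R (est n \<omega> - p) - B *v scaled_dev n \<omega>) > \<epsilon>}"
      then have *: "\<omega> \<in> space M" "\<not> norm (sqrt (real n) *\<^sub>R (est n \<omega> - p) - B *v scaled_dev n \<omega>) \<le> \<epsilon>" by auto
      show "\<omega> \<in> (\<Union>i. ?U i) \<union> ?T"
      proof (rule ccontr)
        assume "\<omega> \<notin> (\<Union>i. ?U i) \<union> ?T"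
        then have "\<bar>visits i n \<omega> / real n - \<pi> $ i\<bar> < \<gamma>" "norm (scaled_dev n \<omega>) < K" for i
          using *(1) by (auto simp: not_le)
        with det[OF *(1) elim(3,2)] *(2) show False by blast
      qed
    qed
    then have "measure M {\<omega> \<in> space M. norm (sqrt (real n) *\<^sub>R (est n \<omega> - p) - B *v scaled_dev n \<omega>) > \<epsilon>} \<le> measure M ((\<Union>i. ?U i) \<union> ?T)"
      by (intro finite_measure_mono) auto
    also have "\<dots> \<le> measure M (\<Union>i. ?U i) + measure M ?T"
      by (intro measure_Un_le) auto
    also have "measure M (\<Union>i. ?U i) \<le> (\<Sum>i\<in>UNIV. measure M (?U i))"
      by (intro finite_measure_subadditive_finite) auto
    finally show ?case using elim(1) C[OF K, of n] CK by linarith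
  qed
  then show "\<exists>no. \<forall>n\<ge>no. norm (measure M {\<omega> \<in> space M. norm (sqrt (real n) *\<^sub>R (est n \<omega> - p) - B *v scaled_dev n \<omega>) > \<epsilon>} - 0) < r"
    by (simp add: eventually_sequentially)
qed

end

section \<open>Consistency and asymptotic normality\<close>

lemma matrix_vector_mult_borel [measurable]:
  fixes A :: "real^'k^'m"
  assumes [measurable]: "f \<in> borel_measurable M"
  shows "(\<lambda>x. A *v f x) \<in> borel_measurable M"
  by (rule borel_measurable_continuous_on[OF _ assms])
    (intro linear_continuous_on matrix_vector_mul_bounded_linear)

text \<open>The scaled error is tight, being within 1 of a tight sequence outside an event of
  vanishing probability; dividing by sqrt n then gives convergence to 0.\<close>

lemma (in ergodic_chain) delta_method_consistent:
  fixes est :: "nat \<Rightarrow> 'a \<Rightarrow> real^'k" and B :: "real^('n \<times> 'n)^'k"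
  assumes [measurable]: "\<And>n. est n \<in> borel_measurable M"
    and close: "(\<lambda>n. measure M {\<omega> \<in> space M. norm (sqrt (real n) *\<^sub>R (est n \<omega> - p) - B *v scaled_dev n \<omega>) > 1}) \<longlonglongrightarrow> 0"
  shows "tendsto_in_prob M est p"
  unfolding tendsto_in_prob_def
proof (intro allI impI)
  fix \<epsilon> :: real
  assume \<epsilon>: "0 < \<epsilon>"
  obtain C where C: "\<And>n K. 0 < K \<Longrightarrow> measure M {\<omega> \<in> space M. K \<le> norm (scaled_dev n \<omega>)} \<le> C / K\<^sup>2"
    using scaled_dev_tail by blast
  define N where "N = norm B + 1"
  have N: "0 < N" unfolding N_def by (simp add: add_nonneg_pos)
  \<comment> \<open>Outside the exceptional event an error above \<epsilon> forces \<open>sqrt (real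
    n) * \<epsilon> \<le> 1 + N * norm (scaled_dev n \<omega>)\<close>; solving for the norm gives
    this threshold, which tends to infinity.\<close>
  define K where "K n = (sqrt (real n) * \<epsilon> - 1) / N" for n
  let ?R = "\<lambda>n. {\<omega> \<in> space M. norm (sqrt (real n) *\<^sub>R (est n \<omega> - p) - B *v scaled_dev n \<omega>) > 1}"
  show "(\<lambda>n. measure M {\<omega> \<in> space M. dist (est n \<omega>) p > \<epsilon>}) \<longlonglongrightarrow> 0"
  proof (rule tendsto_sandwich[OF _ _ tendsto_const])
    show "eventually (\<lambda>n. 0 \<le> measure M {\<omega> \<in> space M. dist (est n \<omega>) p > \<epsilon>}) sequentially"
      by simp
    have "eventually (\<lambda>n. 1 < sqrt (real n) * \<epsilon>) sequentially"
      using \<epsilon> by real_asymp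
    then show "eventually (\<lambda>n. measure M {\<omega> \<in> space M. dist (est n \<omega>) p > \<epsilon>} \<le> measure M (?R n) + C / (K n)\<^sup>2) sequentially"
      using eventually_ge_at_top[of 1]
    proof eventually_elim
      case (elim n)
      have K: "0 < K n" using elim(1) N by (simp add: K_def)
      have "{\<omega> \<in> space M. dist (est n \<omega>) p > \<epsilon>} \<subseteq> ?R n \<union> {\<omega> \<in> space M. K n \<le> norm (scaled_dev n \<omega>)}"
      proof
        fix \<omega>
        assume "\<omega> \<in> {\<omega> \<in> space M. dist (est n \<omega>) p > \<epsilon>}"
        then have \<omega>: "\<omega> \<in> space M" "\<epsilon> < norm (est n \<omega> - p)" by (auto simp: dist_norm)
        show "\<omega> \<in> ?R n \<union> {\<omega> \<in> space M. K n \<le> norm (scaled_dev n \<omega>)}"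
        proof (cases "\<omega> \<in> ?R n")
          case False
          have "sqrt (real n) * \<epsilon> \<le> norm (sqrt (real n) *\<^sub>R (est n \<omega> - p))"
            using \<omega>(2) by (simp add: mult_left_mono)
          also have "\<dots> \<le> norm (sqrt (real n) *\<^sub>R (est n \<omega> - p) - B *v scaled_dev n \<omega>) + norm (B *v scaled_dev n \<omega>)"
            using norm_triangle_ineq[of "sqrt (real n) *\<^sub>R (est n \<omega> - p) - B *v scaled_dev n \<omega>" "B *v scaled_dev n \<omega>"] by simp
          also have "\<dots> \<le> 1 + norm B * norm (scaled_dev n \<omega>)"
            using False \<omega>(1) by (intro add_mono norm_matrix_vector_le) auto
          also have "\<dots> \<le> 1 + N * norm (scaled_dev n \<omega>)"
            by (simp add: N_def mult_right_mono)
          finally have "K n \<le> norm (scaled_dev n \<omega>)"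
            using N unfolding K_def by (simp add: pos_divide_le_eq mult.commute)
          then show ?thesis using \<omega>(1) by simp
        qed simp
      qed
      then have "measure M {\<omega> \<in> space M. dist (est n \<omega>) p > \<epsilon>} \<le> measure M (?R n \<union> {\<omega> \<in> space M. K n \<le> norm (scaled_dev n \<omega>)})"
        by (intro finite_measure_mono) auto
      also have "\<dots> \<le> measure M (?R n) + measure M {\<omega> \<in> space M. K n \<le> norm (scaled_dev n \<omega>)}"
        by (intro measure_Un_le) auto
      also have "\<dots> \<le> measure M (?R n) + C / (K n)\<^sup>2"
        using C[OF K, of n] by simp
      finally show ?case .
    qed
    have "(\<lambda>n. C / (K n)\<^sup>2) \<longlonglongrightarrow> 0"
      unfolding K_def using \<epsilon> N by real_asymp
    from tendsto_add[OF close this]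
    show "(\<lambda>n. measure M (?R n) + C / (K n)\<^sup>2) \<longlonglongrightarrow> 0" by simp
  qed
qed

theorem theorem3p2:
  fixes M :: "'a measure"
    and X :: "nat \<Rightarrow> 'a \<Rightarrow> 'n::finite"
    and T :: "nat \<Rightarrow> 'a \<Rightarrow> nat"
    and \<mu> :: "nat pmf"
    and P Q P\<^sub>0 :: "real^'n^'n"
    and \<pi> :: "real^'n"
    and S :: "('n \<times> 'n) set"
    and \<phi> :: "'b::finite \<Rightarrow> real^'n^'n"
    and \<Phi> :: "real^'b^('n \<times> 'n)"
    and Qhat :: "nat \<Rightarrow> 'a \<Rightarrow> real^'n^'n"
    and phat :: "nat \<Rightarrow> 'a \<Rightarrow> real^('n \<times> 'n)"
  assumes "CARD('n) \<ge> 3"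
    and "prob_space M"
    and "stochastic P" and "irreducible_chain P" and "aperiodic_chain P"
    and "invariant_distribution P \<pi>"
    and "markov_chain M X P"
    and "supp P \<subseteq> S"
    and "observation_times M X T \<mu>"
    and "Q = subsampled \<mu> P"
    and "aff S \<inter> Com Q = {P}"
    and "P\<^sub>0 \<in> aff S"
    and "inj \<phi>" and "independent (range \<phi>)" and "span (range \<phi>) = aff_lin S"
    and "\<Phi> = basis_matrix \<phi>"
    and "\<And>n \<omega>. \<omega> \<in> space M \<Longrightarrow> is_empirical (\<lambda>k. observed X T k \<omega>) n (Qhat n \<omega>)"
    and "\<And>n. phat n \<in> borel_measurable M"
    and "\<And>n \<omega>. \<omega> \<in> space M \<Longrightarrow> is_estimate \<Phi> (vectorize P\<^sub>0) (Qhat n \<omega>) (phat n \<omega>)"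
  shows "tendsto_in_prob M phat (vectorize P) \<and>
    (\<exists>\<nu>. is_gaussian 0 (B_matrix \<Phi> Q P ** asym_cov Q \<pi> ** transpose (B_matrix \<Phi> Q P)) \<nu> \<and>
      tendsto_in_distr M (\<lambda>n \<omega>. sqrt (real n) *\<^sub>R (phat n \<omega> - vectorize P)) \<nu>)"
proof -
  have P: "P \<in> aff S" "P ** Q = Q ** P"
    using assms(11) by (auto simp: Com_def)
  have "\<exists>l\<ge>1. 0 < pmf \<mu> l"
  proof (rule ccontr)
    assume "\<not> (\<exists>l\<ge>1. 0 < pmf \<mu> l)"
    then have 0: "pmf \<mu> l = 0" if "l \<noteq> 0" for l
      using that pmf_nonneg[of \<mu> l] by (metis less_one linorder_not_less order_less_le)
    have Q: "Q $ i $ j = (if i = j then pmf \<mu> 0 else 0)" for i j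
    proof -
      have "(\<lambda>l. pmf \<mu> l * mpow P l $ i $ j) sums (\<Sum>l\<in>{0}. pmf \<mu> l * mpow P l $ i $ j)"
        by (rule sums_finite) (auto simp: 0)
      with subsampled_component[OF assms(3), of \<mu> i j] show ?thesis
        unfolding assms(10) using sums_unique2 by (fastforce simp: mpow_0 mat_def)
    qed
    \<comment> \<open>A scalar matrix commutes with everything, so identifiability would leave only
      0 in \<open>aff_lin S\<close>. But the index type of the basis is inhabited, and a member of
      an independent family is nonzero.\<close>
    have "Q ** Z = Z ** Q" for Z :: "real^'n^'n"
      by (simp add: matrix_matrix_mult_def vec_eq_iff Q if_distrib if_distribR cong: if_cong)
    moreover have "\<phi> undefined \<in> aff_lin S"
      using span_superset[of "range \<phi>"] unfolding assms(15) by blast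
    ultimately have "\<phi> undefined = 0"
      using identifiable_kernel[OF assms(11)] by blast
    then show False
      using assms(14) dependent_zero by (metis rangeI)
  qed
  then obtain l where l: "1 \<le> l" "0 < pmf \<mu> l" by blast
  interpret ergodic_chain M "observed X T" Q \<pi>
  proof (intro ergodic_chain.intro finite_chain.intro finite_chain_axioms.intro ergodic_chain_axioms.intro)
    show "prob_space M" by fact
    show "markov_chain M (observed X T) Q"
      unfolding assms(10) by (rule markov_chain_observed[OF assms(2,3,7,9)])
    show "stochastic Q"
      unfolding assms(10) by (rule stochastic_subsampled[OF assms(3)])
    show "irreducible_chain Q"
      unfolding assms(10) by (rule irreducible_subsampled[OF assms(3-5) l])
    show "invariant_distribution Q \<pi>"
      unfolding assms(10) by (rule invariant_subsampled[OF assms(3,6)])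
  qed
  have gram: "invertible (gram \<Phi> Q)"
    unfolding assms(16) using identifiable_kernel[OF assms(11)]
    by (intro gram_invertible assms(13,14)) (auto simp: assms(15))
  have "P - P\<^sub>0 \<in> span (range \<phi>)"
    unfolding assms(15) by (rule aff_diff[OF P(1) assms(12)])
  then obtain u where "P - P\<^sub>0 = (\<Sum>v\<in>range \<phi>. u v *\<^sub>R v)"
    by (auto simp: span_finite)
  then have "P = P\<^sub>0 + (\<Sum>b\<in>UNIV. u (\<phi> b) *\<^sub>R \<phi> b)"
    using assms(13) by (simp add: sum.reindex algebra_simps)
  then have "vectorize P = vectorize P\<^sub>0 + \<Phi> *v (\<chi> b. u (\<phi> b))"
    unfolding assms(16) basis_matrix_mult vectorize_add[symmetric] by simp
  then obtain \<beta> where \<beta>: "vectorize P = vectorize P\<^sub>0 + \<Phi> *v \<beta>" by blast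
  let ?B = "B_matrix \<Phi> Q P"
  let ?Z = "\<lambda>n \<omega>. sqrt (real n) *\<^sub>R (phat n \<omega> - vectorize P)"
  note [measurable] = assms(18)
  have id: "((\<lambda>A. A) \<longlongrightarrow> Q) (nhds Q)" by (simp add: filterlim_ident)
  have close: "(\<lambda>n. measure M {\<omega> \<in> space M. norm (?Z n \<omega> - ?B *v scaled_dev n \<omega>) > \<epsilon>}) \<longlonglongrightarrow> 0" if "0 < \<epsilon>" for \<epsilon>
  proof (rule delta_method[where A=Qhat and good="\<lambda>A. invertible (gram \<Phi> A)" and Bf="\<lambda>A. B_matrix \<Phi> A P"])
    show "((\<lambda>A. B_matrix \<Phi> A P) \<longlongrightarrow> ?B) (nhds Q)"
      by (rule tendsto_B_matrix[OF id gram])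
    show "eventually (\<lambda>A. invertible (gram \<Phi> A)) (nhds Q)"
      by (rule tendsto_matrix_inv(2)[OF tendsto_gram[OF id] gram])
    show "phat n \<omega> - vectorize P = B_matrix \<Phi> (Qhat n \<omega>) P *v vectorize (Qhat n \<omega> - Q)"
      if "\<omega> \<in> space M" "invertible (gram \<Phi> (Qhat n \<omega>))" for n \<omega>
      by (rule estimate_error[OF assms(19)[OF that(1)] that(2) \<beta> P(2)])
  qed (use assms(17,18) that in auto)
  have cov: "?B ** asym_cov Q \<pi> ** transpose ?B =
      (?B ** multinomial_root Q \<pi>) ** transpose (?B ** multinomial_root Q \<pi>)"
    unfolding asym_cov_root[OF Q_nonneg Q_sum pi_pos] by (simp add: matrix_transpose_mul matrix_mul_assoc)
  obtain \<nu> where \<nu>: "is_gaussian 0 (?B ** asym_cov Q \<pi> ** transpose ?B) \<nu>"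
    unfolding cov using gaussian_exists by blast
  have "tendsto_in_distr M ?Z \<nu>"
  proof (rule levy_continuity_euclidean)
    show "prob_space \<nu>" "sets \<nu> = sets borel" using \<nu> by (simp_all add: is_gaussian_def)
    fix t
    have "(\<lambda>n. \<integral>\<omega>. iexp (t \<bullet> (?B *v scaled_dev n \<omega>)) \<partial>M) \<longlonglongrightarrow>
        of_real (exp (- ((t v* ?B) \<bullet> (asym_cov Q \<pi> *v (t v* ?B))) / 2))"
      using scaled_dev_char_limit[of "t v* ?B"] by (simp only: dot_lmul_matrix)
    moreover have "(t v* ?B) \<bullet> (asym_cov Q \<pi> *v (t v* ?B)) = t \<bullet> ((?B ** asym_cov Q \<pi> ** transpose ?B) *v t)"
      by (simp add: dot_lmul_matrix matrix_vector_mul_assoc[symmetric])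
    ultimately have "(\<lambda>n. \<integral>\<omega>. iexp (t \<bullet> (?B *v scaled_dev n \<omega>)) \<partial>M) \<longlonglongrightarrow> (\<integral>x. iexp (t \<bullet> x) \<partial>\<nu>)"
      by (simp only: char_gaussian[OF \<nu>])
    then show "(\<lambda>n. \<integral>\<omega>. iexp (t \<bullet> ?Z n \<omega>) \<partial>M) \<longlonglongrightarrow> (\<integral>x. iexp (t \<bullet> x) \<partial>\<nu>)"
      by (intro char_slutsky[OF _ _ close]) auto
  qed (use assms(2) in auto)
  moreover have "tendsto_in_prob M phat (vectorize P)"
    by (rule delta_method_consistent[OF assms(18) close]) simp
  ultimately show ?thesis using \<nu> by blast
qed

end
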